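(* The following proper inclusions hold: $\mathit{MON}\subset\mathit{STAR}$, $\mathit{MON}\subset\mathit{SYDEF}$, $\mathit{MON}\subset\mathit{COMM}$, $\mathit{MON}\subset\mathit{NIL}$, $\mathit{MON}\subset\mathit{INF}$, $\mathit{FIN}\subset\mathit{NIL}$, $\mathit{NIL}\subset\mathit{DEF}$, $\mathit{COMB}\subset\mathit{DEF}$, $\mathit{COMB}\subset\mathit{SYDEF}$, $\mathit{DEF}\subset\mathit{ORD}$, $\mathit{ORD}\subset\mathit{NC}$, $\mathit{NC}\subset\mathit{PS}$, $\mathit{PS}\subset\mathit{REG}$, $\mathit{SYDEF}\subset\mathit{LCOM}$, $\mathit{SYDEF}\subset\mathit{RCOM}$, $\mathit{SYDEF}\subset\mathit{PS}$, $\mathit{LCOM}\subset\mathit{2COM}$, $\mathit{RCOM}\subset\mathit{2COM}$, $\mathit{2COM}\subset\mathit{REG}$, $\mathit{STAR}\subset\mathit{UF}$, $\mathit{UF}\subset\mathit{REG}$, $\mathit{COMM}\subset\mathit{CIRC}$, $\mathit{CIRC}\subset\mathit{REG}$, $\mathit{INF}\subset\mathit{PRE}$, $\mathit{INF}\subset\mathit{SUF}$, $\mathit{PRE}\subset\mathit{PS}$, $\mathit{SUF}\subset\mathit{PS}$; moreover $\mathit{NC}=\mathit{SF}$. Furthermore, consider the directed graph whose nodes are the families $\mathit{MON}$, $\mathit{FIN}$, $\mathit{NIL}$, $\mathit{COMB}$, $\mathit{DEF}$, $\mathit{SYDEF}$, $\mathit{ORD}$, $\mathit{INF}$, $\mathit{PRE}$,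 $\mathit{SUF}$, $\mathit{NC}$, $\mathit{PS}$, $\mathit{LCOM}$, $\mathit{RCOM}$, $\mathit{2COM}$, $\mathit{COMM}$, $\mathit{CIRC}$, $\mathit{STAR}$, $\mathit{UF}$, $\mathit{REG}$ and which has an edge $X\to Y$ for each proper inclusion $X\subset Y$ listed above. If $X\neq Y$ are two of these families and there is no directed path from $X$ to $Y$ and none from $Y$ to $X$, then $X$ and $Y$ are incomparable, i.e. $X\not\subseteq Y$ and $Y\not\subseteq X$.
   Context: An alphabet is a non-empty finite set; $\lambda$ is the empty word; $\subset$ denotes proper inclusion. $\mathit{REG}$ is the family of regular languages, $\mathit{FIN}$ the family of finite languages. Each property below is a property of a regular language $L\subseteq V^*$ with respect to an alphabet $V$, and the abbreviation denotes the family of all regular languages having the property (with respect to their alphabet): - $\mathit{MON}$ (monoidal): $L=V^*$. - $\mathit{NIL}$ (nilpotent): $L$ or $V^*\setminus L$ is finite. - $\mathit{COMB}$ (combinational): $L=V^*X$ for some $X\subseteq V$. - $\mathit{DEF}$ (definite): $L=A\cup V^*B$ for finite $A,B\subseteq V^*$. - $\mathit{SYDEF}$ (symmetric definite): $L=EV^*H$ for regular languages $E,H$. - $\mathit{INF}$ (infix-closed): $xyz\in L$ implies $y\in L$, for all $x,y,z\in V^*$. - $\mathit{PRE}$ (prefix-closed): $xy\in L$ implies $x\in L$, for all $x,y\in V^*$. - $\mathit{SUF}$ (suffix-closed): $xy\in L$ implies $y\in L$, for all $x,y\in V^*$. - $\mathit{ORD}$ (ordered): $L$ is accepted by a deterministic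 finite automaton $(V,Z,z_0,F,\delta)$ (input alphabet, states, start state, accepting states, transition mapping) such that $Z$ carries a total order $\preceq$ for which $z\preceq z'$ implies $\delta(z,a)\preceq\delta(z',a)$ for every $a\in V$. - $\mathit{COMM}$ (commutative): $L$ contains with each word all permutations of it. - $\mathit{CIRC}$ (circular): $L$ contains with each word all circular shifts of it. - $\mathit{NC}$ (non-counting): there is $k\ge 1$ such that for all $x,y,z\in V^*$: $xy^kz\in L$ iff $xy^{k+1}z\in L$. - $\mathit{SF}$ (star-free): $L$ is described by a regular expression built by concatenation, union and complementation. - $\mathit{PS}$ (power-separating): there is $m\ge1$ such that for every $x\in V^*$, with $J_x^m=\{x^n: n\ge m\}$, either $J_x^m\cap L=\emptyset$ or $J_x^m\subseteq L$. - $\mathit{UF}$ (union-free): $L$ is described by a regular expression built only by concatenation and Kleene closure. - $\mathit{STAR}$: $L=H^*$ for some regular $H\subseteq V^*$. - $\mathit{LCOM}$ (left-sided comet): $L=EG^*$ for some regular $E$ and regular $G\notin\{\emptyset,\{\lambda\}\}$. - $\mathit{RCOM}$ (right-sided comet): $L=G^*H$ for some regular $H$ and regular $G\notin\{\emptyset,\{\lambda\}\}$. - $\mathit{2COM}$ (two-sided comet): $L=EG^*H$ for regular $E,H$ and regular $G\notin\{\emptyset,\{\lambda\}\}$. Languages differing only in the empty word are regarded as different. *)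

theory Defs
  imports "HOL-Library.Multiset"
begin

definition alphabet :: "'a set \<Rightarrow> bool" where
  "alphabet V \<longleftrightarrow> finite V \<and> V \<noteq> {}"

definition conc :: "'a list set \<Rightarrow> 'a list set \<Rightarrow> 'a list set" (infixr \<open>@@\<close> 75) where
  "A @@ B = {u @ v | u v. u \<in> A \<and> v \<in> B}"

definition star :: "'a list set \<Rightarrow> 'a list set" where
  "star A = concat ` lists A"

definition word_pow :: "'a list \<Rightarrow> nat \<Rightarrow> 'a list" where
  "word_pow x n = concat (replicate n x)"

definition dfa :: "'a set \<Rightarrow> 's set \<Rightarrow> 's \<Rightarrow> 's set \<Rightarrow> ('s \<Rightarrow> 'a \<Rightarrow> 's) \<Rightarrow> bool" where
  "dfa V Z z0 F \<delta> \<longleftrightarrow>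
     finite Z \<and> z0 \<in> Z \<and> F \<subseteq> Z \<and> (\<forall>z\<in>Z. \<forall>a\<in>V. \<delta> z a \<in> Z)"

definition accepted :: "'a set \<Rightarrow> 's \<Rightarrow> 's set \<Rightarrow> ('s \<Rightarrow> 'a \<Rightarrow> 's) \<Rightarrow> 'a list set" where
  "accepted V z0 F \<delta> = {w \<in> lists V. foldl \<delta> z0 w \<in> F}"

text \<open>States are named by natural numbers, which is no restriction because state sets
  are finite.\<close>

definition regular :: "'a set \<Rightarrow> 'a list set \<Rightarrow> bool" where
  "regular V L \<longleftrightarrow>
     (\<exists>(Z :: nat set) z0 F \<delta>. dfa V Z z0 F \<delta> \<and> L = accepted V z0 F \<delta>)"

text \<open>Generalised regular expressions; the complement is taken relative to \<open>lists V\<close>.\<close>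

datatype 'a rexp =
    Empty
  | Eps
  | Letter 'a
  | Plus "'a rexp" "'a rexp"
  | Times "'a rexp" "'a rexp"
  | Star "'a rexp"
  | Compl "'a rexp"

primrec denotes :: "'a set \<Rightarrow> 'a rexp \<Rightarrow> 'a list set" where
  "denotes V Empty = {}"
| "denotes V Eps = {[]}"
| "denotes V (Letter a) = {[a]}"
| "denotes V (Plus r s) = denotes V r \<union> denotes V s"
| "denotes V (Times r s) = denotes V r @@ denotes V s"
| "denotes V (Star r) = star (denotes V r)"
| "denotes V (Compl r) = lists V - denotes V r"

primrec union_free_rexp :: "'a rexp \<Rightarrow> bool" where
  "union_free_rexp Empty \<longleftrightarrow> True"
| "union_free_rexp Eps \<longleftrightarrow> True"
| "union_free_rexp (Letter a) \<longleftrightarrow> True"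
| "union_free_rexp (Plus r s) \<longleftrightarrow> False"
| "union_free_rexp (Times r s) \<longleftrightarrow> union_free_rexp r \<and> union_free_rexp s"
| "union_free_rexp (Star r) \<longleftrightarrow> union_free_rexp r"
| "union_free_rexp (Compl r) \<longleftrightarrow> False"

primrec star_free_rexp :: "'a rexp \<Rightarrow> bool" where
  "star_free_rexp Empty \<longleftrightarrow> True"
| "star_free_rexp Eps \<longleftrightarrow> True"
| "star_free_rexp (Letter a) \<longleftrightarrow> True"
| "star_free_rexp (Plus r s) \<longleftrightarrow> star_free_rexp r \<and> star_free_rexp s"
| "star_free_rexp (Times r s) \<longleftrightarrow> star_free_rexp r \<and> star_free_rexp s"
| "star_free_rexp (Star r) \<longleftrightarrow> False"
| "star_free_rexp (Compl r) \<longleftrightarrow> star_free_rexp r"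

definition monoidal :: "'a set \<Rightarrow> 'a list set \<Rightarrow> bool" where
  "monoidal V L \<longleftrightarrow> L = lists V"

definition nilpotent :: "'a set \<Rightarrow> 'a list set \<Rightarrow> bool" where
  "nilpotent V L \<longleftrightarrow> finite L \<or> finite (lists V - L)"

definition combinational :: "'a set \<Rightarrow> 'a list set \<Rightarrow> bool" where
  "combinational V L \<longleftrightarrow> (\<exists>X\<subseteq>V. L = lists V @@ (\<lambda>a. [a]) ` X)"

definition definite :: "'a set \<Rightarrow> 'a list set \<Rightarrow> bool" where
  "definite V L \<longleftrightarrow>
     (\<exists>A B. A \<subseteq> lists V \<and> finite A \<and> B \<subseteq> lists V \<and> finite B \<and> L = A \<union> lists V @@ B)"

definition symmetric_definite :: "'a set \<Rightarrow> 'a list set \<Rightarrow> bool" where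
  "symmetric_definite V L \<longleftrightarrow>
     (\<exists>E H. regular V E \<and> regular V H \<and> L = E @@ lists V @@ H)"

definition infix_closed :: "'a set \<Rightarrow> 'a list set \<Rightarrow> bool" where
  "infix_closed V L \<longleftrightarrow>
     (\<forall>x\<in>lists V. \<forall>y\<in>lists V. \<forall>z\<in>lists V. x @ y @ z \<in> L \<longrightarrow> y \<in> L)"

definition prefix_closed :: "'a set \<Rightarrow> 'a list set \<Rightarrow> bool" where
  "prefix_closed V L \<longleftrightarrow> (\<forall>x\<in>lists V. \<forall>y\<in>lists V. x @ y \<in> L \<longrightarrow> x \<in> L)"

definition suffix_closed :: "'a set \<Rightarrow> 'a list set \<Rightarrow> bool" where
  "suffix_closed V L \<longleftrightarrow> (\<forall>x\<in>lists V. \<forall>y\<in>lists V. x @ y \<in> L \<longrightarrow> y \<in> L)"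

text \<open>The order is an arbitrary total order on the state set, unrelated to the usual
  order of the natural numbers naming the states.\<close>

definition ordered :: "'a set \<Rightarrow> 'a list set \<Rightarrow> bool" where
  "ordered V L \<longleftrightarrow>
     (\<exists>(Z :: nat set) z0 F \<delta> r.
        dfa V Z z0 F \<delta> \<and> L = accepted V z0 F \<delta> \<and> linear_order_on Z r \<and>
        (\<forall>z\<in>Z. \<forall>z'\<in>Z. (z, z') \<in> r \<longrightarrow> (\<forall>a\<in>V. (\<delta> z a, \<delta> z' a) \<in> r)))"

definition commutative :: "'a set \<Rightarrow> 'a list set \<Rightarrow> bool" where
  "commutative V L \<longleftrightarrow> (\<forall>w\<in>L. \<forall>w'. mset w' = mset w \<longrightarrow> w' \<in> L)"

definition circular :: "'a set \<Rightarrow> 'a list set \<Rightarrow> bool" where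
  "circular V L \<longleftrightarrow> (\<forall>w\<in>L. \<forall>n. rotate n w \<in> L)"

definition non_counting :: "'a set \<Rightarrow> 'a list set \<Rightarrow> bool" where
  "non_counting V L \<longleftrightarrow>
     (\<exists>k\<ge>1. \<forall>x\<in>lists V. \<forall>y\<in>lists V. \<forall>z\<in>lists V.
        x @ word_pow y k @ z \<in> L \<longleftrightarrow> x @ word_pow y (k + 1) @ z \<in> L)"

definition star_free :: "'a set \<Rightarrow> 'a list set \<Rightarrow> bool" where
  "star_free V L \<longleftrightarrow> (\<exists>r. star_free_rexp r \<and> set_rexp r \<subseteq> V \<and> L = denotes V r)"

definition power_separating :: "'a set \<Rightarrow> 'a list set \<Rightarrow> bool" where
  "power_separating V L \<longleftrightarrow>
     (\<exists>m\<ge>1. \<forall>x\<in>lists V.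
        {word_pow x n | n. n \<ge> m} \<inter> L = {} \<or> {word_pow x n | n. n \<ge> m} \<subseteq> L)"

definition union_free :: "'a set \<Rightarrow> 'a list set \<Rightarrow> bool" where
  "union_free V L \<longleftrightarrow> (\<exists>r. union_free_rexp r \<and> set_rexp r \<subseteq> V \<and> L = denotes V r)"

definition star_language :: "'a set \<Rightarrow> 'a list set \<Rightarrow> bool" where
  "star_language V L \<longleftrightarrow> (\<exists>H. regular V H \<and> L = star H)"

definition left_comet :: "'a set \<Rightarrow> 'a list set \<Rightarrow> bool" where
  "left_comet V L \<longleftrightarrow>
     (\<exists>E G. regular V E \<and> regular V G \<and> G \<notin> {{}, {[]}} \<and> L = E @@ star G)"

definition right_comet :: "'a set \<Rightarrow> 'a list set \<Rightarrow> bool" where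
  "right_comet V L \<longleftrightarrow>
     (\<exists>G H. regular V G \<and> regular V H \<and> G \<notin> {{}, {[]}} \<and> L = star G @@ H)"

definition two_sided_comet :: "'a set \<Rightarrow> 'a list set \<Rightarrow> bool" where
  "two_sided_comet V L \<longleftrightarrow>
     (\<exists>E G H. regular V E \<and> regular V G \<and> regular V H \<and> G \<notin> {{}, {[]}} \<and>
        L = E @@ star G @@ H)"

text \<open>Some of the properties depend on the alphabet and not only on the set of words, for
  instance \<open>{a}\<^sup>*\<close> is monoidal with respect to \<open>{a}\<close> but not with respect to
  \<open>{a, b}\<close>. A member of a family is therefore a language together with its alphabet.\<close>

type_synonym 'a language_over = "'a set \<times> 'a list set"

definition regular_family ::
    "('a set \<Rightarrow> 'a list set \<Rightarrow> bool) \<Rightarrow> 'a language_over set" where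
  "regular_family P = {(V, L). alphabet V \<and> regular V L \<and> P V L}"

datatype node =
    MON | FIN | NIL | COMB | DEF | SYDEF | ORD | INFC | PRE | SUF
  | NC | PS | LCOM | RCOM | TWOCOM | COMM | CIRC | STAR | UF | REG

primrec family :: "node \<Rightarrow> 'a language_over set" where
  "family MON = regular_family monoidal"
| "family FIN = {(V, L). alphabet V \<and> L \<subseteq> lists V \<and> finite L}"
| "family NIL = regular_family nilpotent"
| "family COMB = regular_family combinational"
| "family DEF = regular_family definite"
| "family SYDEF = regular_family symmetric_definite"
| "family ORD = regular_family ordered"
| "family INFC = regular_family infix_closed"
| "family PRE = regular_family prefix_closed"
| "family SUF = regular_family suffix_closed"
| "family NC = regular_family non_counting"
| "family PS = regular_family power_separating"
| "family LCOM = regular_family left_comet"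
| "family RCOM = regular_family right_comet"
| "family TWOCOM = regular_family two_sided_comet"
| "family COMM = regular_family commutative"
| "family CIRC = regular_family circular"
| "family STAR = regular_family star_language"
| "family UF = regular_family union_free"
| "family REG = {(V, L). alphabet V \<and> regular V L}"

text \<open>The bare sets of words that have the property with respect to some alphabet.
  Inclusions are stronger for \<open>family\<close>, non-inclusions are stronger for \<open>languages\<close>.\<close>

definition languages :: "node \<Rightarrow> 'a list set set" where
  "languages X = {L. \<exists>V. (V, L) \<in> family X}"

definition inclusions :: "(node \<times> node) set" where
  "inclusions =
    {(MON, STAR), (MON, SYDEF), (MON, COMM), (MON, NIL), (MON, INFC),
     (FIN, NIL), (NIL, DEF), (COMB, DEF), (COMB, SYDEF),
     (DEF, ORD), (ORD, NC), (NC, PS), (PS, REG),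
     (SYDEF, LCOM), (SYDEF, RCOM), (SYDEF, PS),
     (LCOM, TWOCOM), (RCOM, TWOCOM), (TWOCOM, REG),
     (STAR, UF), (UF, REG), (COMM, CIRC), (CIRC, REG),
     (INFC, PRE), (INFC, SUF), (PRE, PS), (SUF, PS)}"

end

(* A language is regular iff it has finitely many left quotients, which gives the closure properties
   and shows that along the powers of a word membership becomes periodic from an exponent on that does
   not depend on the word. Hence non-counting and power-separation only have to be checked for each
   word separately.

   STAR is contained in UF because a regular language is a finite union of union-free languages
   U_1, ..., U_n, whose star is the star of the product of the stars of the U_i. A union-free language
   has a unique shortest word, and at most one word if it is finite. Non-counting languages are
   star-free by Schuetzenberger's theorem, proved by induction on the size of an aperiodic monoid, passing to a
   local divisor. A definite language is accepted by an automaton that remembers the last letters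
   read, most recent first, in lexicographic order; in an ordered automaton the powers of a word move
   every state monotonically, so that they do not count.

   If there is no path from X to Y, then there are paths from X0 to X and from Y to Y0 for one of 33
   pairs (X0, Y0), and for each of these a small language separates X0 from Y0. *)

theory Submission
  imports Defs "HOL-Library.List_Lexorder"
begin

section \<open>Words and regular languages\<close>

text \<open>The same set of words may be regular over several alphabets. An inclusion is therefore
  shown for each language together with its alphabet, while a separating language has to be kept out
  of a family over all alphabets at once. Where letters matter for this, a word of the language
  shows that an arbitrary admissible \<open>V\<close> contains them.

  Closure of the regular languages is proved by counting quotients: for product and star, a quotient
  of the result is determined by finitely many quotients of the parts, and no automaton has to be
  constructed.\<close>

lemma in_conc: "w \<in> A @@ B \<longleftrightarrow> (\<exists>u v. w = u @ v \<and> u \<in> A \<and> v \<in> B)"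
  by (auto simp: conc_def)

lemma concI: "u \<in> A \<Longrightarrow> v \<in> B \<Longrightarrow> u @ v \<in> A @@ B"
  by (auto simp: conc_def)

lemma conc_assoc: "(A @@ B) @@ C = A @@ (B @@ C)"
  unfolding set_eq_iff in_conc by (metis append.assoc)

lemma conc_eps [simp]: "A @@ {[]} = A" "{[]} @@ A = A"
  by (auto simp: conc_def)

lemma conc_empty [simp]: "A @@ {} = {}" "{} @@ A = {}"
  by (auto simp: conc_def)

lemma conc_mono: "A \<subseteq> A' \<Longrightarrow> B \<subseteq> B' \<Longrightarrow> A @@ B \<subseteq> A' @@ B'"
  by (auto simp: conc_def)

lemma conc_subset_lists: "A \<subseteq> lists V \<Longrightarrow> B \<subseteq> lists V \<Longrightarrow> A @@ B \<subseteq> lists V"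
  by (fastforce simp: conc_def)

lemma star_Nil [simp]: "[] \<in> star A"
  unfolding star_def by (rule image_eqI[of _ _ "[]"]) auto

lemma star_append: "u \<in> A \<Longrightarrow> v \<in> star A \<Longrightarrow> u @ v \<in> star A"
  unfolding star_def by (elim imageE, rule image_eqI[of _ _ "u # x" for x]) auto

lemma star_induct [consumes 1, case_names Nil append]:
  assumes "w \<in> star A" and "P []" and "\<And>u v. u \<in> A \<Longrightarrow> v \<in> star A \<Longrightarrow> P v \<Longrightarrow> P (u @ v)"
  shows "P w"
proof -
  obtain ws where ws: "w = concat ws" "ws \<in> lists A"
    using assms(1) by (auto simp: star_def)
  have "concat ws \<in> star A \<and> P (concat ws)"
    using ws(2) by (induction ws) (auto intro: assms star_append)
  then show ?thesis using ws by simp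
qed

lemma star_incl: "u \<in> A \<Longrightarrow> u \<in> star A"
  using star_append[of u A "[]"] by simp

lemma star_closed: "u \<in> star A \<Longrightarrow> v \<in> star A \<Longrightarrow> u @ v \<in> star A"
  by (induction rule: star_induct) (auto intro: star_append)

lemma star_least:
  assumes "A \<subseteq> star B" shows "star A \<subseteq> star B"
proof
  fix w assume "w \<in> star A"
  then show "w \<in> star B"
    by (induction rule: star_induct) (use assms in \<open>auto intro: star_closed\<close>)
qed

lemma star_mono: "A \<subseteq> B \<Longrightarrow> star A \<subseteq> star B"
  by (rule star_least) (auto intro: star_incl)

text \<open>Both stars contain the empty word, so their product contains \<open>A\<close> and
  \<open>B\<close>, and it stays inside the star of the union. Under a star, union can thus be
  traded for concatenation.\<close>

lemma star_Un: "star (A \<union> B) = star (star A @@ star B)"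
proof
  have "u \<in> star A @@ star B" if "u \<in> A \<union> B" for u
    using that concI[of u "star A" "[]" "star B"] concI[of "[]" "star A" u "star B"]
    by (auto intro: star_incl)
  then show "star (A \<union> B) \<subseteq> star (star A @@ star B)"
    by (intro star_mono) auto
  have "star A \<subseteq> star (A \<union> B)" "star B \<subseteq> star (A \<union> B)"
    by (intro star_mono; blast)+
  then show "star (star A @@ star B) \<subseteq> star (A \<union> B)"
    by (intro star_least) (auto simp: conc_def intro: star_closed)
qed

lemma star_subset_lists: "A \<subseteq> lists V \<Longrightarrow> star A \<subseteq> lists V"
proof
  fix w assume "A \<subseteq> lists V" "w \<in> star A"
  from this(2,1) show "w \<in> lists V" by (induction rule: star_induct) auto
qed

lemma star_letters: "star ((\<lambda>a. [a]) ` V) = lists V"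
proof
  show "star ((\<lambda>a. [a]) ` V) \<subseteq> lists V" by (rule star_subset_lists) auto
  show "lists V \<subseteq> star ((\<lambda>a. [a]) ` V)"
  proof
    fix w assume "w \<in> lists V"
    then show "w \<in> star ((\<lambda>a. [a]) ` V)"
      by (induction w) (auto intro: star_append[of "[x]" for x, simplified])
  qed
qed

lemma star_trivial [simp]: "star {} = {[] :: 'a list}" "star {[] :: 'a list} = {[]}"
proof -
  have "w = []" if "w \<in> star {[]}" for w :: "'a list"
    using that by (induction rule: star_induct) auto
  then show "star {[] :: 'a list} = {[]}" by auto
  then show "star {} = {[] :: 'a list}" using star_mono[of "{}" "{[]}"] by fastforce
qed

lemma word_pow_0 [simp]: "word_pow x 0 = []"
  and word_pow_Suc [simp]: "word_pow x (Suc n) = x @ word_pow x n"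
  by (simp_all add: word_pow_def)

lemma word_pow_add: "word_pow x (m + n) = word_pow x m @ word_pow x n"
  by (simp add: word_pow_def replicate_add)

lemma word_pow_Suc': "word_pow x (Suc n) = word_pow x n @ x"
  using word_pow_add[of x n 1] by simp

lemma word_pow_lists [simp]: "x \<in> lists V \<Longrightarrow> word_pow x n \<in> lists V"
  by (induction n) auto

lemma word_pow_single: "word_pow [a] n = replicate n a"
  by (induction n) auto

lemma word_pow_in_star: "x \<in> A \<Longrightarrow> word_pow x n \<in> star A"
  by (induction n) (auto intro: star_append)

lemma length_word_pow [simp]: "length (word_pow x n) = n * length x"
  by (induction n) auto

section \<open>Runs of automata and renaming of states\<close>

lemma foldl_closed:
  assumes "dfa V Z z0 F \<delta>" "z \<in> Z" "w \<in> lists V"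
  shows "foldl \<delta> z w \<in> Z"
  using assms(3,2) by (induction w arbitrary: z) (use assms(1) in \<open>auto simp: dfa_def\<close>)

text \<open>\<open>regular\<close> and \<open>ordered\<close> ask for natural numbers as states.
  Constructions whose states are languages or lists are brought into this form by an injection
  \<open>f\<close>, which \<open>inv_into Z f\<close> undoes on the renamed states.\<close>

lemma
  fixes f :: "'s \<Rightarrow> 't"
  assumes dfa: "dfa V Z z0 F \<delta>" and inj: "inj_on f Z"
  defines "\<delta>' \<equiv> \<lambda>q a. f (\<delta> (inv_into Z f q) a)"
  shows dfa_rename: "dfa V (f ` Z) (f z0) (f ` F) \<delta>'"
    and accepted_rename: "accepted V (f z0) (f ` F) \<delta>' = accepted V z0 F \<delta>"
proof -
  show "dfa V (f ` Z) (f z0) (f ` F) \<delta>'"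
    using dfa inj by (auto simp: dfa_def \<delta>'_def)
  have run: "foldl \<delta>' (f z) w = f (foldl \<delta> z w)" if "z \<in> Z" "w \<in> lists V" for z w
    using that(2,1)
    by (induction w arbitrary: z) (use dfa inj in \<open>auto simp: dfa_def \<delta>'_def\<close>)
  have Z: "z0 \<in> Z" "F \<subseteq> Z" using dfa by (auto simp: dfa_def)
  have "foldl \<delta>' (f z0) w \<in> f ` F \<longleftrightarrow> foldl \<delta> z0 w \<in> F" if "w \<in> lists V" for w
    using run[OF Z(1) that] inj_on_image_mem_iff[OF inj foldl_closed[OF dfa Z(1) that] Z(2)] by simp
  then show "accepted V (f z0) (f ` F) \<delta>' = accepted V z0 F \<delta>"
    unfolding accepted_def by blast
qed

lemma dfa_imp_regular:
  assumes "dfa V Z z0 F \<delta>" shows "regular V (accepted V z0 F \<delta>)"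
proof -
  have "finite Z" using assms by (simp add: dfa_def)
  then obtain f :: "_ \<Rightarrow> nat" where "inj_on f Z"
    using finite_imp_inj_to_nat_seg by blast
  then show ?thesis
    unfolding regular_def using dfa_rename[OF assms] accepted_rename[OF assms] by metis
qed

section \<open>Left quotients and closure properties\<close>

definition deriv :: "'a list \<Rightarrow> 'a list set \<Rightarrow> 'a list set" where
  "deriv w L = {v. w @ v \<in> L}"

definition derivs :: "'a set \<Rightarrow> 'a list set \<Rightarrow> 'a list set set" where
  "derivs V L = (\<lambda>w. deriv w L) ` lists V"

lemma in_deriv [simp]: "v \<in> deriv w L \<longleftrightarrow> w @ v \<in> L"
  by (simp add: deriv_def)

lemma deriv_Nil [simp]: "deriv [] L = L"
  by (simp add: deriv_def)

lemma deriv_append: "deriv (u @ v) L = deriv v (deriv u L)"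
  by (simp add: deriv_def)

lemma derivsI: "w \<in> lists V \<Longrightarrow> deriv w L \<in> derivs V L"
  by (simp add: derivs_def)

text \<open>The Myhill-Nerode theorem, with left quotients in place of equivalence classes. The
  quotient by \<open>w\<close> depends only on the state that \<open>w\<close> reaches; conversely
  the quotients are the states of an automaton, accepting if they contain the empty word.\<close>

lemma regular_iff_finite_derivs:
  fixes L :: "'a list set"
  shows "regular V L \<longleftrightarrow> L \<subseteq> lists V \<and> finite (derivs V L)"
proof
  assume "regular V L"
  then obtain Z :: "nat set" and z0 F \<delta>
    where dfa: "dfa V Z z0 F \<delta>" and L: "L = accepted V z0 F \<delta>"
    by (auto simp: regular_def)
  have "finite Z" "z0 \<in> Z" using dfa by (auto simp: dfa_def)
  have "derivs V L \<subseteq> (\<lambda>z. accepted V z F \<delta>) ` Z"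
    using foldl_closed[OF dfa \<open>z0 \<in> Z\<close>]
    by (auto simp: derivs_def L accepted_def deriv_def intro!: image_eqI[where x = "foldl \<delta> z0 w" for w])
  then show "L \<subseteq> lists V \<and> finite (derivs V L)"
    using \<open>finite Z\<close> by (auto simp: L accepted_def dest: finite_subset)
next
  assume asm: "L \<subseteq> lists V \<and> finite (derivs V L)"
  let ?F = "{D \<in> derivs V L. [] \<in> D}" and ?\<delta> = "\<lambda>D (a :: 'a). deriv [a] D"
  have "deriv [] L \<in> derivs V L" by (rule derivsI) simp
  moreover have "deriv [a] D \<in> derivs V L" if "D \<in> derivs V L" "a \<in> V" for a D
    using that derivsI[of "w @ [a]" V L for w] by (auto simp: derivs_def deriv_append)
  ultimately have "dfa V (derivs V L) L ?F ?\<delta>"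
    using asm by (auto simp: dfa_def)
  moreover have "accepted V L ?F ?\<delta> = L"
  proof -
    have "foldl ?\<delta> D w = deriv w D" for D w
      by (induction w arbitrary: D) (auto simp: deriv_def)
    then have "w \<in> accepted V L ?F ?\<delta> \<longleftrightarrow> w \<in> lists V \<and> w \<in> L" for w
      using derivsI[of w V L] by (simp add: accepted_def) blast
    then show ?thesis using asm by blast
  qed
  ultimately show "regular V L" using dfa_imp_regular by metis
qed

lemma regular_subset_lists: "regular V L \<Longrightarrow> L \<subseteq> lists V"
  by (simp add: regular_iff_finite_derivs)

lemma regular_finite:
  assumes "finite L" "L \<subseteq> lists V" shows "regular V L"
proof -
  \<comment> \<open>A quotient of a finite language is a set of suffixes of its words, and there are
    only finitely many such sets.\<close>
  have "v \<in> (\<lambda>n. drop n x) ` {..length x}" if "x = w @ v" for x w v :: "'a list"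
    using that by (intro image_eqI[where x = "length w"]) auto
  then have "derivs V L \<subseteq> Pow (\<Union>x\<in>L. (\<lambda>n. drop n x) ` {..length x})"
    unfolding derivs_def deriv_def by blast
  then show ?thesis
    using assms by (auto simp: regular_iff_finite_derivs intro: finite_subset)
qed

lemma regular_Compl:
  assumes "regular V L" shows "regular V (lists V - L)"
proof -
  have "derivs V (lists V - L) \<subseteq> (\<lambda>D. lists V - D) ` derivs V L"
    by (auto simp: derivs_def deriv_def image_iff)
  then show ?thesis using assms
    by (auto simp: regular_iff_finite_derivs intro: finite_subset)
qed

lemma regular_Un:
  assumes "regular V A" "regular V B" shows "regular V (A \<union> B)"
proof -
  have eq: "deriv w (A \<union> B) = (\<lambda>(D, E). D \<union> E) (deriv w A, deriv w B)" for w
    by auto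
  have "derivs V (A \<union> B) \<subseteq> (\<lambda>(D, E). D \<union> E) ` (derivs V A \<times> derivs V B)"
    unfolding derivs_def eq by blast
  then show ?thesis using assms
    by (auto simp: regular_iff_finite_derivs intro: finite_subset)
qed

text \<open>In a factorisation of \<open>w @ x\<close>, the cut falls into \<open>x\<close> or into
  \<open>w\<close>. So the quotient by \<open>w\<close> is determined by one quotient of
  \<open>A\<close> and a set of quotients of \<open>B\<close>.\<close>

lemma regular_conc:
  assumes "regular V A" "regular V B" shows "regular V (A @@ B)"
proof -
  have eq: "deriv w (A @@ B) = deriv w A @@ B \<union> \<Union>{deriv s B | p s. w = p @ s \<and> p \<in> A}" for w
  proof (intro equalityI subsetI)
    fix x assume "x \<in> deriv w (A @@ B)"
    then obtain u v where uv: "w @ x = u @ v" "u \<in> A" "v \<in> B" by (auto simp: in_conc)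
    from uv(1) consider r where "u = w @ r" "x = r @ v" | r where "w = u @ r" "v = r @ x"
      by (auto simp: append_eq_append_conv2)
    then show "x \<in> deriv w A @@ B \<union> \<Union>{deriv s B | p s. w = p @ s \<and> p \<in> A}"
    proof cases
      case 1
      then show ?thesis using uv concI[of r "deriv w A" v B] by simp
    next
      case 2
      then have "x \<in> deriv r B" using uv by simp
      then show ?thesis using 2 uv by blast
    qed
  next
    fix x assume "x \<in> deriv w A @@ B \<union> \<Union>{deriv s B | p s. w = p @ s \<and> p \<in> A}"
    then show "x \<in> deriv w (A @@ B)"
    proof
      assume "x \<in> deriv w A @@ B"
      then obtain u v where "x = u @ v" "w @ u \<in> A" "v \<in> B" by (auto simp: in_conc)
      then show ?thesis using concI[of "w @ u" A v B] by simp
    next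
      assume "x \<in> \<Union>{deriv s B | p s. w = p @ s \<and> p \<in> A}"
      then obtain p s where "w = p @ s" "p \<in> A" "s @ x \<in> B" by auto
      then show ?thesis using concI[of p A "s @ x" B] by simp
    qed
  qed
  have "derivs V (A @@ B) \<subseteq> (\<lambda>(D, S). D @@ B \<union> \<Union>S) ` (derivs V A \<times> Pow (derivs V B))"
  proof
    fix X assume "X \<in> derivs V (A @@ B)"
    then obtain w where w: "w \<in> lists V" "X = deriv w (A @@ B)" by (auto simp: derivs_def)
    then have "{deriv s B | p s. w = p @ s \<and> p \<in> A} \<subseteq> derivs V B"
      by (auto intro: derivsI)
    then show "X \<in> (\<lambda>(D, S). D @@ B \<union> \<Union>S) ` (derivs V A \<times> Pow (derivs V B))"
      using w derivsI[OF w(1), of A] unfolding eq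
      by (intro image_eqI[where x = "(deriv w A, {deriv s B | p s. w = p @ s \<and> p \<in> A})"]) auto
  qed
  moreover have "A @@ B \<subseteq> lists V"
    using assms by (simp add: conc_subset_lists regular_subset_lists)
  ultimately show ?thesis using assms
    by (auto simp: regular_iff_finite_derivs intro: finite_subset)
qed

text \<open>As \<open>w\<close> is not empty, its last letter lies in a factor from
  \<open>A\<close>; \<open>s\<close> is the part of this factor in \<open>w\<close> and
  \<open>v1\<close> its part in \<open>v\<close>, which is empty if the border lies between two
  factors.\<close>

lemma star_splitE:
  assumes "w @ v \<in> star A" "w \<noteq> []"
  obtains p s v1 v2 where "w = p @ s" "p \<in> star A" "v = v1 @ v2" "s @ v1 \<in> A" "v2 \<in> star A"
proof -
  have "\<exists>p s v1 v2. w = p @ s \<and> p \<in> star A \<and> v = v1 @ v2 \<and> s @ v1 \<in> A \<and> v2 \<in> star A"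
    if "x \<in> star A" "x = w @ v" "w \<noteq> []" for x
    using that
  proof (induction arbitrary: w rule: star_induct)
    case (append y z)
    from append.prems(1) consider r where "y = w @ r" "v = r @ z"
      | r where "w = y @ r" "z = r @ v" by (auto simp: append_eq_append_conv2)
    then show ?case
    proof cases
      case 1
      then show ?thesis using append.hyps by (intro exI[of _ "[]"] exI[of _ w] exI[of _ r] exI[of _ z]) auto
    next
      case 2
      show ?thesis
      proof (cases "r = []")
        case True
        then show ?thesis using append.hyps 2
          by (intro exI[of _ "[]"] exI[of _ w] exI[of _ "[]"] exI[of _ v]) auto
      next
        case False
        from append.IH[OF 2(2) False] obtain p s v1 v2
          where "r = p @ s" "p \<in> star A" "v = v1 @ v2" "s @ v1 \<in> A" "v2 \<in> star A" by blast
        then show ?thesis using append.hyps 2 star_append[OF append.hyps(1)]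
          by (intro exI[of _ "y @ p"] exI[of _ s] exI[of _ v1] exI[of _ v2]) simp
      qed
    qed
  qed simp
  then show ?thesis using assms that by blast
qed

text \<open>By \<open>star_splitE\<close>, the quotient by a nonempty word is determined by a set of
  quotients of \<open>A\<close>. The quotient by the empty word is \<open>star A\<close> itself and
  is added separately.\<close>

lemma regular_star:
  assumes "regular V A" shows "regular V (star A)"
proof -
  let ?S = "\<lambda>w. {deriv s A | p s. w = p @ s \<and> p \<in> star A}"
  have eq: "deriv w (star A) = \<Union>((\<lambda>D. D @@ star A) ` ?S w)" if "w \<noteq> []" for w
  proof (intro equalityI subsetI)
    fix v assume "v \<in> deriv w (star A)"
    then have "w @ v \<in> star A" by simp
    then obtain p s v1 v2
      where "w = p @ s" "p \<in> star A" "v = v1 @ v2" "s @ v1 \<in> A" "v2 \<in> star A"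
      using \<open>w \<noteq> []\<close> by (rule star_splitE)
    moreover from this have "v \<in> deriv s A @@ star A" by (simp add: concI)
    ultimately show "v \<in> \<Union>((\<lambda>D. D @@ star A) ` ?S w)" by blast
  next
    fix v assume "v \<in> \<Union>((\<lambda>D. D @@ star A) ` ?S w)"
    then obtain p s v1 v2 where "w = p @ s" "p \<in> star A" "v = v1 @ v2" "s @ v1 \<in> A" "v2 \<in> star A"
      by (auto simp: in_conc)
    then show "v \<in> deriv w (star A)"
      using star_closed[of p A "(s @ v1) @ v2"] star_append[of "s @ v1" A v2] by simp
  qed
  have "derivs V (star A)
      \<subseteq> insert (star A) ((\<lambda>S. \<Union>((\<lambda>D. D @@ star A) ` S)) ` Pow (derivs V A))"
  proof
    fix X assume "X \<in> derivs V (star A)"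
    then obtain w where w: "w \<in> lists V" "X = deriv w (star A)" by (auto simp: derivs_def)
    then have "?S w \<in> Pow (derivs V A)" by (auto intro: derivsI)
    then show "X \<in> insert (star A) ((\<lambda>S. \<Union>((\<lambda>D. D @@ star A) ` S)) ` Pow (derivs V A))"
      using w eq by (cases "w = []") auto
  qed
  moreover have "star A \<subseteq> lists V"
    using assms by (simp add: star_subset_lists regular_subset_lists)
  ultimately show ?thesis using assms
    by (auto simp: regular_iff_finite_derivs intro: finite_subset)
qed

lemma regular_lists [simp]: "regular V (lists V)"
  using regular_Compl[OF regular_finite[of "{}"]] by simp

text \<open>The bound \<open>m\<close> does not depend on the words. This is why the exponents in the definitions of
  \<open>non_counting\<close> and \<open>power_separating\<close> may be chosen for each word separately.\<close>

lemma regular_deriv_pow: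
  assumes "regular V L"
  obtains m where "m \<ge> 1"
    and "\<And>x y n N. \<lbrakk>x \<in> lists V; y \<in> lists V; n \<ge> m\<rbrakk> \<Longrightarrow>
      \<exists>n'\<ge>N. deriv (x @ word_pow y n) L = deriv (x @ word_pow y n') L"
proof
  \<comment> \<open>Among the \<open>?m + 1\<close> powers with exponents from 0 to
    \<open>?m\<close>, two lead to the same quotient, whatever \<open>x\<close> and \<open>y\<close>
    are.\<close>
  let ?m = "card (derivs V L)"
  have fin: "finite (derivs V L)" using assms by (simp add: regular_iff_finite_derivs)
  have "deriv [] L \<in> derivs V L" by (rule derivsI) simp
  then show "?m \<ge> 1" using fin by (metis One_nat_def Suc_leI card_gt_0_iff empty_iff)
  fix x y n N assume xy: "x \<in> lists V" "y \<in> lists V" and n: "?m \<le> n"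
  define s where "s n = deriv (x @ word_pow y n) L" for n
  have s_shift: "s (i + k) = deriv (word_pow y k) (s i)" for i k
    by (simp add: s_def word_pow_add flip: deriv_append)
  have "s ` {..?m} \<subseteq> derivs V L" unfolding s_def using xy by (intro image_subsetI derivsI) simp
  then have "card (s ` {..?m}) < card {..?m}" using card_mono[OF fin] by (simp add: le_imp_less_Suc)
  then have "\<not> inj_on s {..?m}" using pigeonhole by blast
  then obtain i j where ij: "i \<le> ?m" "j \<le> ?m" "s i = s j" "i < j"
    by (auto simp: inj_on_def) (metis nat_neq_iff)
  have period: "s k = s (k + t * (j - i))" if "k \<ge> i" for k t
  proof (induction t)
    case (Suc t)
    define d where "d = j - i"
    then have j: "j = i + d" using ij by simp
    have "s (k + t * (j - i)) = s (i + (k - i + t * (j - i)))" using that by simp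
    also have "\<dots> = s (j + (k - i + t * (j - i)))" unfolding s_shift ij(3) ..
    also have "\<dots> = s (k + Suc t * (j - i))" using that by (simp add: j algebra_simps)
    finally show ?case using Suc by simp
  qed simp
  \<comment> \<open>From exponent \<open>i\<close> on, the quotients repeat with period
    \<open>j - i\<close>, which is at least 1. Adding \<open>N\<close> periods to \<open>n\<close>
    gives an exponent of at least \<open>N\<close>.\<close>
  have "N \<le> N * (j - i)" using ij mult_le_mono2[of 1 "j - i" N] by (simp add: Suc_le_eq)
  then have "N \<le> n + N * (j - i)" by (rule trans_le_add2)
  then show "\<exists>n'\<ge>N. deriv (x @ word_pow y n) L = deriv (x @ word_pow y n') L"
    using period[of n N] n ij(1) unfolding s_def by (meson le_trans)
qed

lemma power_separatingI:
  assumes "regular V L"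
    and ev: "\<And>x. x \<in> lists V \<Longrightarrow>
      \<exists>N. (\<forall>n\<ge>N. word_pow x n \<in> L) \<or> (\<forall>n\<ge>N. word_pow x n \<notin> L)"
  shows "power_separating V L"
proof -
  obtain m where m: "m \<ge> 1" "\<And>x y n N. \<lbrakk>x \<in> lists V; y \<in> lists V; n \<ge> m\<rbrakk> \<Longrightarrow>
      \<exists>n'\<ge>N. deriv (x @ word_pow y n) L = deriv (x @ word_pow y n') L"
    by (rule regular_deriv_pow[OF assms(1)]) blast
  have "{word_pow x n | n. n \<ge> m} \<inter> L = {} \<or> {word_pow x n | n. n \<ge> m} \<subseteq> L"
    if x: "x \<in> lists V" for x
  proof -
    obtain N where N: "(\<forall>n\<ge>N. word_pow x n \<in> L) \<or> (\<forall>n\<ge>N. word_pow x n \<notin> L)"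
      using ev[OF x] by blast
    have "\<exists>n'\<ge>N. word_pow x n \<in> L \<longleftrightarrow> word_pow x n' \<in> L" if "n \<ge> m" for n
    proof -
      obtain n' where "n' \<ge> N" "deriv (word_pow x n) L = deriv (word_pow x n') L"
        using m(2)[of "[]" x n N] x \<open>n \<ge> m\<close> by auto
      then show ?thesis using in_deriv[of "[]" "word_pow x n" L] in_deriv[of "[]" "word_pow x n'" L]
        by auto
    qed
    then show ?thesis using N by blast
  qed
  then show ?thesis unfolding power_separating_def using m(1) by blast
qed

lemma non_countingI:
  assumes "regular V L"
    and ev: "\<And>x y z. \<lbrakk>x \<in> lists V; y \<in> lists V; z \<in> lists V\<rbrakk> \<Longrightarrow>
      \<exists>N. \<forall>n\<ge>N. x @ word_pow y n @ z \<in> L \<longleftrightarrow> x @ word_pow y (Suc n) @ z \<in> L"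
  shows "non_counting V L"
proof -
  obtain m where m: "m \<ge> 1" "\<And>x y n N. \<lbrakk>x \<in> lists V; y \<in> lists V; n \<ge> m\<rbrakk> \<Longrightarrow>
      \<exists>n'\<ge>N. deriv (x @ word_pow y n) L = deriv (x @ word_pow y n') L"
    by (rule regular_deriv_pow[OF assms(1)]) blast
  have "x @ word_pow y m @ z \<in> L \<longleftrightarrow> x @ word_pow y (m + 1) @ z \<in> L"
    if xyz: "x \<in> lists V" "y \<in> lists V" "z \<in> lists V" for x y z
  proof -
    obtain N where N: "\<forall>n\<ge>N. x @ word_pow y n @ z \<in> L \<longleftrightarrow> x @ word_pow y (Suc n) @ z \<in> L"
      using ev[OF xyz] by blast
    obtain n' where n': "n' \<ge> N" "deriv (x @ word_pow y m) L = deriv (x @ word_pow y n') L"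
      using m(2)[of x y m N] xyz by auto
    have "x @ word_pow y m @ z \<in> L \<longleftrightarrow> x @ word_pow y n' @ z \<in> L"
      using arg_cong[OF n'(2), of "\<lambda>D. z \<in> D"] by simp
    \<comment> \<open>The next power is reached by testing \<open>y @ z\<close> instead of
      \<open>z\<close> in the same quotient, so one equation between quotients settles both
      exponents.\<close>
    moreover have "x @ word_pow y (m + 1) @ z \<in> L \<longleftrightarrow> x @ word_pow y (Suc n') @ z \<in> L"
      using arg_cong[OF n'(2), of "\<lambda>D. y @ z \<in> D"] by (simp add: word_pow_Suc' del: word_pow_Suc)
    ultimately show ?thesis using N n'(1) by simp
  qed
  then show ?thesis unfolding non_counting_def using m(1) by blast
qed

section \<open>Union-free languages\<close>

lemma union_free_empty: "union_free V {}"
  and union_free_eps: "union_free V {[]}"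
  and union_free_letter: "a \<in> V \<Longrightarrow> union_free V {[a]}"
  unfolding union_free_def
  by (intro exI[of _ Empty], simp) (intro exI[of _ Eps], simp, intro exI[of _ "Letter a"], simp)

lemma union_free_conc:
  assumes "union_free V A" "union_free V B" shows "union_free V (A @@ B)"
proof -
  obtain r s where "union_free_rexp r" "set_rexp r \<subseteq> V" "A = denotes V r"
    "union_free_rexp s" "set_rexp s \<subseteq> V" "B = denotes V s"
    using assms by (auto simp: union_free_def)
  then show ?thesis unfolding union_free_def by (intro exI[of _ "Times r s"]) simp
qed

lemma union_free_star:
  assumes "union_free V A" shows "union_free V (star A)"
proof -
  obtain r where "union_free_rexp r" "set_rexp r \<subseteq> V" "A = denotes V r"
    using assms by (auto simp: union_free_def)
  then show ?thesis unfolding union_free_def by (intro exI[of _ "Star r"]) simp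
qed

lemma union_free_induct [consumes 1, case_names empty eps letter conc star]:
  assumes "union_free V L"
    and "P {}" "P {[]}" "\<And>a. a \<in> V \<Longrightarrow> P {[a]}"
    and "\<And>A B. P A \<Longrightarrow> P B \<Longrightarrow> P (A @@ B)" "\<And>A. P A \<Longrightarrow> P (star A)"
  shows "P L"
proof -
  obtain r where "union_free_rexp r" "set_rexp r \<subseteq> V" "L = denotes V r"
    using assms(1) by (auto simp: union_free_def)
  then show ?thesis by (induction r arbitrary: L) (auto intro: assms(2-))
qed

text \<open>The shortest words of two factors concatenate to the only shortest word of the product,
  and a star has the empty word. A language with two shortest words is thereby excluded from
  UF.\<close>

lemma union_free_shortest_word:
  assumes "union_free V L" "L \<noteq> {}"
  obtains m where "m \<in> L" "\<And>v. v \<in> L \<Longrightarrow> v \<noteq> m \<Longrightarrow> length m < length v"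
proof -
  have "L = {} \<or> (\<exists>m\<in>L. \<forall>v\<in>L. v \<noteq> m \<longrightarrow> length m < length v)"
    using assms(1)
  proof (induction rule: union_free_induct)
    case (conc A B)
    show ?case
    proof (cases "A = {} \<or> B = {}")
      case False
      then obtain m n where "m \<in> A" "\<forall>v\<in>A. v \<noteq> m \<longrightarrow> length m < length v"
          "n \<in> B" "\<forall>v\<in>B. v \<noteq> n \<longrightarrow> length n < length v"
        using conc.IH by blast
      then have "m @ n \<in> A @@ B \<and> (\<forall>v\<in>A @@ B. v \<noteq> m @ n \<longrightarrow> length (m @ n) < length v)"
        by (auto simp: in_conc) (metis add_less_mono less_or_eq_imp_le add_le_less_mono add_less_le_mono)+
      then show ?thesis by blast
    qed auto
  next
    case (star A)
    show ?case by (intro disjI2 bexI[of _ "[]"]) auto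
  qed auto
  then show ?thesis using assms(2) that by blast
qed

lemma infinite_star:
  assumes "w \<in> A" "w \<noteq> []" shows "infinite (star A)"
proof
  assume "finite (star A)"
  then have "finite (range (word_pow w))"
    by (rule finite_subset[rotated]) (auto intro: word_pow_in_star assms(1))
  moreover have "inj (word_pow w)"
    by (rule injI) (use assms(2) in \<open>metis length_word_pow length_0_conv mult_right_cancel\<close>)
  ultimately show False using finite_imageD infinite_UNIV_nat by blast
qed

text \<open>A nonempty finite product has finite factors, each with a single word by induction, and
  a star is finite only if it is \<open>{[]}\<close>.\<close>

lemma union_free_finite:
  assumes "union_free V L" "finite L" "u \<in> L" "v \<in> L" shows "u = v"
proof -
  have "finite L \<longrightarrow> (\<forall>u\<in>L. \<forall>v\<in>L. u = v)"
    using assms(1)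
  proof (induction rule: union_free_induct)
    case (conc A B)
    \<comment> \<open>With \<open>v\<close> fixed, \<open>A\<close> embeds into the product, and so
      does \<open>B\<close> with \<open>u\<close> fixed.\<close>
    have *: "finite A \<and> finite B" if fin: "finite (A @@ B)" and uv: "u \<in> A" "v \<in> B" for u v
    proof
      have "finite ((\<lambda>x. x @ v) ` A)"
        by (rule finite_subset[OF _ fin]) (auto intro: concI uv)
      then show "finite A" by (rule finite_imageD) (auto intro: inj_onI)
      have "finite ((\<lambda>x. u @ x) ` B)"
        by (rule finite_subset[OF _ fin]) (auto intro: concI uv)
      then show "finite B" by (rule finite_imageD) (auto intro: inj_onI)
    qed
    show ?case
    proof (intro impI ballI)
      fix x y assume fin: "finite (A @@ B)" and "x \<in> A @@ B" "y \<in> A @@ B"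
      then obtain x1 x2 y1 y2 where "x = x1 @ x2" "x1 \<in> A" "x2 \<in> B" "y = y1 @ y2" "y1 \<in> A" "y2 \<in> B"
        by (auto simp: in_conc)
      moreover from this have "finite A" "finite B" using *[OF fin] by simp_all
      then have "x1 = y1" "x2 = y2" using conc.IH calculation by simp_all
      then show "x = y" using calculation by simp
    qed
  next
    case (star A)
    show ?case
    proof
      assume "finite (star A)"
      then have "A \<subseteq> {[]}" using infinite_star by blast
      then have "star A \<subseteq> {[]}" using star_mono star_trivial(2) by metis
      then show "\<forall>u\<in>star A. \<forall>v\<in>star A. u = v" by auto
    qed
  qed auto
  then show ?thesis using assms by blast
qed

section \<open>Regular languages as finite unions of union-free languages\<close>

definition union_of_union_free :: "'a set \<Rightarrow> 'a list set \<Rightarrow> bool" where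
  "union_of_union_free V L \<longleftrightarrow> (\<exists>\<U>. finite \<U> \<and> (\<forall>U\<in>\<U>. union_free V U) \<and> L = \<Union>\<U>)"

lemma union_of_union_free_single: "union_free V L \<Longrightarrow> union_of_union_free V L"
  unfolding union_of_union_free_def by (intro exI[of _ "{L}"]) simp

lemma union_of_union_free_Union:
  assumes "finite \<A>" "\<And>A. A \<in> \<A> \<Longrightarrow> union_of_union_free V A"
  shows "union_of_union_free V (\<Union>\<A>)"
proof -
  have "\<forall>A\<in>\<A>. \<exists>\<U>. finite \<U> \<and> (\<forall>U\<in>\<U>. union_free V U) \<and> A = \<Union>\<U>"
    using assms(2) by (simp add: union_of_union_free_def)
  then obtain f where f: "\<forall>A\<in>\<A>. finite (f A) \<and> (\<forall>U\<in>f A. union_free V U) \<and> A = \<Union>(f A)"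
    by metis
  have "\<Union>\<A> = (\<Union>A\<in>\<A>. \<Union>(f A))" by (intro arg_cong[where f = Union]) (use f in \<open>force simp: image_iff\<close>)
  also have "\<dots> = \<Union>(\<Union>(f ` \<A>))" by blast
  finally have "\<Union>\<A> = \<Union>(\<Union>(f ` \<A>))" .
  moreover have "finite (\<Union>(f ` \<A>))" "\<forall>U\<in>\<Union>(f ` \<A>). union_free V U" using f assms(1) by auto
  ultimately show ?thesis unfolding union_of_union_free_def by blast
qed

lemma union_of_union_free_Un:
  "union_of_union_free V A \<Longrightarrow> union_of_union_free V B \<Longrightarrow> union_of_union_free V (A \<union> B)"
  using union_of_union_free_Union[of "{A, B}" V] by auto

lemma union_of_union_free_conc:
  assumes "union_of_union_free V A" "union_of_union_free V B"
  shows "union_of_union_free V (A @@ B)"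
proof -
  obtain \<A> \<B> where "finite \<A>" "\<forall>U\<in>\<A>. union_free V U" "A = \<Union>\<A>"
      "finite \<B>" "\<forall>U\<in>\<B>. union_free V U" "B = \<Union>\<B>"
    using assms by (auto simp: union_of_union_free_def)
  moreover have "\<Union>\<A> @@ \<Union>\<B> = \<Union>((\<lambda>(A, B). A @@ B) ` (\<A> \<times> \<B>))"
    unfolding set_eq_iff in_conc by (auto simp: in_conc)
  ultimately show ?thesis unfolding union_of_union_free_def
    by (intro exI[of _ "(\<lambda>(A, B). A @@ B) ` (\<A> \<times> \<B>)"]) (auto intro: union_free_conc)
qed

text \<open>The union itself need not be union-free, so the induction carries a union-free
  \<open>K\<close> with the same star. Adding a member \<open>U\<close> replaces \<open>K\<close> by
  the product of \<open>star U\<close> and \<open>star K\<close>, by \<open>star_Un\<close>.\<close>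

lemma union_free_star_of_union:
  assumes "union_of_union_free V A" shows "union_free V (star A)"
proof -
  have "\<exists>K. union_free V K \<and> star K = star (\<Union>\<U>)"
    if "finite \<U>" "\<forall>U\<in>\<U>. union_free V U" for \<U>
    using that
  proof (induction rule: finite_induct)
    case empty
    show ?case by (intro exI[of _ "{}"]) (simp add: union_free_empty)
  next
    case (insert U \<U>)
    then obtain K where K: "union_free V K" "star K = star (\<Union>\<U>)" by auto
    have "star (star U @@ star K) = star (\<Union>(insert U \<U>))"
      unfolding K(2) star_Un[symmetric] by simp
    then show ?case using insert.prems K(1)
      by (intro exI[of _ "star U @@ star K"]) (simp add: union_free_conc union_free_star)
  qed
  then show ?thesis using assms union_free_star unfolding union_of_union_free_def by metis
qed

text \<open>As in Kleene's algorithm, \<open>S\<close> contains the states that may occur strictly inside a run.\<close>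

inductive path :: "'a set \<Rightarrow> ('s \<Rightarrow> 'a \<Rightarrow> 's) \<Rightarrow> 's set \<Rightarrow> 's \<Rightarrow> 'a list \<Rightarrow> 's \<Rightarrow> bool"
  for V \<delta> S where
  path_letter: "a \<in> V \<Longrightarrow> path V \<delta> S i [a] (\<delta> i a)"
| path_Cons: "a \<in> V \<Longrightarrow> \<delta> i a \<in> S \<Longrightarrow> path V \<delta> S (\<delta> i a) w j \<Longrightarrow> path V \<delta> S i (a # w) j"

lemma path_append:
  assumes "path V \<delta> S i u k" "k \<in> S" "path V \<delta> S k v j" shows "path V \<delta> S i (u @ v) j"
  using assms by (induction rule: path.induct) (auto intro: path.intros)

lemma path_mono:
  assumes "path V \<delta> S i w j" "S \<subseteq> S'" shows "path V \<delta> S' i w j"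
  using assms by (induction rule: path.induct) (auto intro: path.intros)

text \<open>A run that may pass through \<open>k\<close> either avoids \<open>k\<close> strictly
  inside or is cut at its inner visits to \<open>k\<close>: a first piece up to \<open>k\<close>,
  loops at \<open>k\<close>, and a last piece from \<open>k\<close> on.\<close>

lemma path_insert:
  "{w. path V \<delta> (insert k S) i w j} =
    {w. path V \<delta> S i w j} \<union>
    {w. path V \<delta> S i w k} @@ star {w. path V \<delta> S k w k} @@ {w. path V \<delta> S k w j}"
    (is "_ = ?R i j \<union> ?R i k @@ star (?R k k) @@ ?R k j")
proof (intro equalityI subsetI)
  fix w assume "w \<in> {w. path V \<delta> (insert k S) i w j}"
  then have "path V \<delta> (insert k S) i w j" by simp
  then show "w \<in> ?R i j \<union> ?R i k @@ star (?R k k) @@ ?R k j"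
  proof (induction rule: path.induct)
    case (path_letter a i)
    then show ?case by (auto intro: path.intros)
  next
    case (path_Cons a i w j)
    let ?m = "\<delta> i a"
    have a: "[a] \<in> ?R i ?m" using path_Cons.hyps(1) by (auto intro: path.intros)
    have ext: "a # u \<in> ?R i j" if "u \<in> ?R ?m j" "?m \<in> S" for u j
      using that path_Cons.hyps(1) by (auto intro: path.intros)
    from path_Cons.IH consider "w \<in> ?R ?m j"
      | u s v where "w = u @ s @ v" "u \<in> ?R ?m k" "s \<in> star (?R k k)" "v \<in> ?R k j"
      by (fastforce simp: in_conc)
    \<comment> \<open>If the state \<open>?m\<close> after the first letter lies in
      \<open>S\<close>, the letter is prepended to the first piece of the rest. Otherwise
      \<open>?m\<close> is \<open>k\<close>, the letter alone is the first piece, and the first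
      piece of the rest becomes a loop or the last piece.\<close>
    then show ?case
    proof cases
      case 1
      show ?thesis
      proof (cases "?m \<in> S")
        case False
        then have "?m = k" using path_Cons.hyps(2) by simp
        then have "[a] @ [] @ w \<in> ?R i k @@ star (?R k k) @@ ?R k j"
          using a 1 by (intro concI) auto
        then show ?thesis by simp
      qed (use 1 ext in blast)
    next
      case 2
      show ?thesis
      proof (cases "?m \<in> S")
        case True
        then have "(a # u) @ s @ v \<in> ?R i k @@ star (?R k k) @@ ?R k j"
          using ext 2 by (intro concI) auto
        then show ?thesis using 2 by simp
      next
        case False
        then have "?m = k" using path_Cons.hyps(2) by simp
        then have "[a] @ (u @ s) @ v \<in> ?R i k @@ star (?R k k) @@ ?R k j"
          using a 2 by (intro concI star_append) auto
        then show ?thesis using 2 by simp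
      qed
    qed
  qed
next
  let ?P = "path V \<delta> (insert k S)"
  fix w assume "w \<in> ?R i j \<union> ?R i k @@ star (?R k k) @@ ?R k j"
  then consider "w \<in> ?R i j"
    | u s v where "w = u @ s @ v" "u \<in> ?R i k" "s \<in> star (?R k k)" "v \<in> ?R k j"
    by (fastforce simp: in_conc)
  then have "?P i w j"
  proof cases
    case 1
    then show ?thesis by (auto intro: path_mono)
  next
    case 2
    from 2(3) have "?P k (s @ v) j"
    proof (induction rule: star_induct)
      case Nil
      show ?case using 2(4) by (auto intro: path_mono)
    next
      case (append x y)
      then show ?case using path_append[of V \<delta> "insert k S" k x k "y @ v" j]
        by (auto intro: path_mono)
    qed
    moreover have "?P i u k" using 2(2) by (auto intro: path_mono)
    ultimately show ?thesis unfolding 2(1)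
      using path_append[of V \<delta> "insert k S" i u k "s @ v" j] by simp
  qed
  then show "w \<in> {w. path V \<delta> (insert k S) i w j}" by simp
qed

lemma union_of_union_free_path:
  assumes "finite V" "finite S"
  shows "union_of_union_free V {w. path V \<delta> S i w j}"
  using assms(2)
proof (induction arbitrary: i j rule: finite_induct)
  case empty
  have "{w. path V \<delta> {} i w j} = \<Union>((\<lambda>a. {[a]}) ` {a \<in> V. \<delta> i a = j})"
    by (auto elim: path.cases intro: path.intros)
  moreover have "union_of_union_free V (\<Union>((\<lambda>a. {[a]}) ` {a \<in> V. \<delta> i a = j}))"
    using assms(1) by (intro union_of_union_free_Union)
      (auto intro: union_of_union_free_single union_free_letter)
  ultimately show ?case by simp
next
  case (insert k S)
  then show ?case unfolding path_insert
    by (intro union_of_union_free_Un union_of_union_free_conc)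
      (auto intro: union_of_union_free_single union_free_star_of_union)
qed

lemma path_iff_foldl:
  assumes "dfa V Z z0 F \<delta>" "z \<in> Z"
  shows "path V \<delta> Z z w j \<longleftrightarrow> w \<noteq> [] \<and> w \<in> lists V \<and> foldl \<delta> z w = j"
proof
  show "path V \<delta> Z z w j \<Longrightarrow> w \<noteq> [] \<and> w \<in> lists V \<and> foldl \<delta> z w = j"
    by (induction rule: path.induct) auto
  show "w \<noteq> [] \<and> w \<in> lists V \<and> foldl \<delta> z w = j \<Longrightarrow> path V \<delta> Z z w j"
    using assms(2)
  proof (induction w arbitrary: z)
    case (Cons a w)
    then have "\<delta> z a \<in> Z" using assms(1) by (auto simp: dfa_def)
    then show ?case using Cons by (cases "w = []") (auto intro: path.intros)
  qed simp
qed

lemma regular_imp_union_of_union_free: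
  assumes "finite V" "regular V L" shows "union_of_union_free V L"
proof -
  obtain Z :: "nat set" and z0 F \<delta> where dfa: "dfa V Z z0 F \<delta>" and L: "L = accepted V z0 F \<delta>"
    using assms by (auto simp: regular_def)
  have Z: "finite Z" "z0 \<in> Z" "finite F" using dfa by (auto simp: dfa_def intro: finite_subset)
  \<comment> \<open>Paths read at least one letter, so the empty word is added when the start state
    accepts.\<close>
  have "L = \<Union>((\<lambda>f. {w. path V \<delta> Z z0 w f}) ` F) \<union> (if z0 \<in> F then {[]} else {})"
    by (auto simp: L accepted_def path_iff_foldl[OF dfa Z(2)])
  moreover have "union_of_union_free V (\<Union>((\<lambda>f. {w. path V \<delta> Z z0 w f}) ` F))"
    using union_of_union_free_path[OF assms(1) Z(1)] Z(3)
    by (intro union_of_union_free_Union) auto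
  ultimately show ?thesis
    using union_of_union_free_Un[OF _ union_of_union_free_single[OF union_free_eps]]
    by (cases "z0 \<in> F") simp_all
qed

section \<open>Star-free languages\<close>

lemma star_free_empty: "star_free V {}"
  unfolding star_free_def by (rule exI[of _ Empty]) simp

lemma star_free_eps: "star_free V {[]}"
  unfolding star_free_def by (rule exI[of _ Eps]) simp

lemma star_free_letter: "a \<in> V \<Longrightarrow> star_free V {[a]}"
  unfolding star_free_def by (rule exI[of _ "Letter a"]) simp

lemma star_free_Un:
  assumes "star_free V A" "star_free V B" shows "star_free V (A \<union> B)"
proof -
  obtain r s where "star_free_rexp r" "set_rexp r \<subseteq> V" "A = denotes V r"
    "star_free_rexp s" "set_rexp s \<subseteq> V" "B = denotes V s"
    using assms by (auto simp: star_free_def)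
  then show ?thesis unfolding star_free_def by (intro exI[of _ "Plus r s"]) simp
qed

lemma star_free_conc:
  assumes "star_free V A" "star_free V B" shows "star_free V (A @@ B)"
proof -
  obtain r s where "star_free_rexp r" "set_rexp r \<subseteq> V" "A = denotes V r"
    "star_free_rexp s" "set_rexp s \<subseteq> V" "B = denotes V s"
    using assms by (auto simp: star_free_def)
  then show ?thesis unfolding star_free_def by (intro exI[of _ "Times r s"]) simp
qed

lemma star_free_Compl:
  assumes "star_free V A" shows "star_free V (lists V - A)"
proof -
  obtain r where "star_free_rexp r" "set_rexp r \<subseteq> V" "A = denotes V r"
    using assms by (auto simp: star_free_def)
  then show ?thesis unfolding star_free_def by (intro exI[of _ "Compl r"]) simp
qed

text \<open>Besides the induction hypotheses, the rule supplies that the parts are star-free. The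
  concatenation case of \<open>star_free_imp_non_counting\<close> takes from this that the factors
  lie in \<open>lists V\<close>.\<close>

lemma star_free_induct [consumes 1, case_names empty eps letter Un conc Compl]:
  assumes "star_free V L"
    and "P {}" "P {[]}" "\<And>a. a \<in> V \<Longrightarrow> P {[a]}"
    and "\<And>A B. star_free V A \<Longrightarrow> P A \<Longrightarrow> star_free V B \<Longrightarrow> P B \<Longrightarrow> P (A \<union> B)"
    and "\<And>A B. star_free V A \<Longrightarrow> P A \<Longrightarrow> star_free V B \<Longrightarrow> P B \<Longrightarrow> P (A @@ B)"
    and "\<And>A. star_free V A \<Longrightarrow> P A \<Longrightarrow> P (lists V - A)"
  shows "P L"
proof -
  obtain r where "star_free_rexp r" "set_rexp r \<subseteq> V" "L = denotes V r"
    using assms(1) by (auto simp: star_free_def)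
  then have "star_free V L \<and> P L"
  proof (induction r arbitrary: L)
    case (Plus r s)
    then show ?case by (simp add: star_free_Un assms(5))
  next
    case (Times r s)
    then show ?case by (simp add: star_free_conc assms(6))
  next
    case (Compl r)
    then show ?case by (simp add: star_free_Compl assms(7))
  qed (auto intro: assms(2-4) star_free_empty star_free_eps star_free_letter)
  then show ?thesis ..
qed

lemma star_free_subset_lists:
  assumes "star_free V L" shows "L \<subseteq> lists V"
  using assms by (induction rule: star_free_induct) (simp_all add: conc_subset_lists)

lemma star_free_lists: "star_free V (lists V)"
  using star_free_Compl[OF star_free_empty] by simp

lemma star_free_Diff:
  assumes "star_free V A" "star_free V B" shows "star_free V (A - B)"
proof -
  have "A - B = lists V - ((lists V - A) \<union> B)"
    using assms star_free_subset_lists by blast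
  then show ?thesis by (simp add: assms star_free_Compl star_free_Un)
qed

lemma star_free_UN:
  "finite I \<Longrightarrow> (\<And>i. i \<in> I \<Longrightarrow> star_free V (A i)) \<Longrightarrow> star_free V (\<Union>i\<in>I. A i)"
  by (induction rule: finite_induct) (auto intro: star_free_empty star_free_Un)

section \<open>Star-free languages do not count\<close>

lemma word_pow_cut:
  assumes "word_pow y n = u @ v" "n \<ge> 1"
  obtains i j y1 y2 where "u = word_pow y i @ y1" "v = y2 @ word_pow y j" "y = y1 @ y2" "i + j + 1 = n"
proof -
  have "\<exists>i j y1 y2. u = word_pow y i @ y1 \<and> v = y2 @ word_pow y j \<and> y = y1 @ y2 \<and> i + j + 1 = n"
    using assms
  proof (induction n arbitrary: u)
    case (Suc n)
    from Suc.prems(1) consider r where "y = u @ r" "v = r @ word_pow y n"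
      | r where "u = y @ r" "word_pow y n = r @ v" by (auto simp: append_eq_append_conv2)
    then show ?case
    proof cases
      case 1
      then show ?thesis by (intro exI[of _ 0] exI[of _ n] exI[of _ u] exI[of _ r]) simp
    next
      case 2
      show ?thesis
      proof (cases "n = 0")
        case True
        then show ?thesis using 2 by (intro exI[of _ 0] exI[of _ y] exI[of _ "[]"]) simp
      next
        case False
        then obtain i j y1 y2 where "r = word_pow y i @ y1" "v = y2 @ word_pow y j"
            "y = y1 @ y2" "i + j + 1 = n"
          using Suc.IH[OF 2(2)] by auto
        then show ?thesis using 2(1)
          by (intro exI[of _ "Suc i"] exI[of _ j] exI[of _ y1] exI[of _ y2]) simp
      qed
    qed
  qed simp
  then show ?thesis using that by blast
qed

lemma non_counting_pow:
  assumes "\<forall>x\<in>lists V. \<forall>y\<in>lists V. \<forall>z\<in>lists V.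
      x @ word_pow y k @ z \<in> L \<longleftrightarrow> x @ word_pow y (k + 1) @ z \<in> L"
    and "x \<in> lists V" "y \<in> lists V" "z \<in> lists V" "n \<ge> k" "n' \<ge> k"
  shows "x @ word_pow y n @ z \<in> L \<longleftrightarrow> x @ word_pow y n' @ z \<in> L"
proof -
  have "x @ word_pow y (k + d) @ z \<in> L \<longleftrightarrow> x @ word_pow y k @ z \<in> L" for d
  proof (induction d)
    case (Suc d)
    have "x @ word_pow y (k + Suc d) @ z = x @ word_pow y (k + 1) @ (word_pow y d @ z)"
      by (simp add: word_pow_add)
    also have "\<dots> \<in> L \<longleftrightarrow> x @ word_pow y k @ (word_pow y d @ z) \<in> L"
      using assms by simp
    finally show ?case using Suc by (simp add: word_pow_add)
  qed simp
  from this[of "n - k"] this[of "n' - k"] show ?thesis using assms(5,6) by simp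
qed

text \<open>A cut inside the power passes through one copy of \<open>y\<close> and leaves
  \<open>n - 1\<close> whole copies. For \<open>n\<close> at least \<open>2 * k + 2\<close>, one
  side has at least \<open>k + 1\<close> of them, and there a copy can be added or removed without
  falling below \<open>k\<close>.\<close>

lemma non_counting_conc:
  assumes "non_counting V A" "non_counting V B" and sub: "A \<subseteq> lists V" "B \<subseteq> lists V"
  shows "non_counting V (A @@ B)"
proof -
  let ?nc = "\<lambda>L k. \<forall>x\<in>lists V. \<forall>y\<in>lists V. \<forall>z\<in>lists V.
      x @ word_pow y k @ z \<in> L \<longleftrightarrow> x @ word_pow y (k + 1) @ z \<in> L"
  obtain a b where ab: "?nc A a" "?nc B b"
    using assms(1,2) unfolding non_counting_def by metis
  define k where "k = max a b"
  have A: "x @ word_pow y n' @ z \<in> A"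
    if "x @ word_pow y n @ z \<in> A" "n \<ge> k" "n' \<ge> k" "y \<in> lists V" for x y z n n'
    using non_counting_pow[OF ab(1), of x y z n n'] that subsetD[OF sub(1) that(1)] by (simp add: k_def)
  have B: "x @ word_pow y n' @ z \<in> B"
    if "x @ word_pow y n @ z \<in> B" "n \<ge> k" "n' \<ge> k" "y \<in> lists V" for x y z n n'
    using non_counting_pow[OF ab(2), of x y z n n'] that subsetD[OF sub(2) that(1)] by (simp add: k_def)
  \<comment> \<open>The condition \<open>n \<le> n' + 1\<close> says that at most one copy is
    removed. It admits both directions of the final equivalence.\<close>
  have pump: "x @ word_pow y n' @ z \<in> A @@ B"
    if w: "x @ word_pow y n @ z \<in> A @@ B" and y: "y \<in> lists V"
      and n: "n \<ge> 2 * k + 2" "n' \<ge> 2 * k + 2" "n \<le> n' + 1" for x y z n n'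
  proof -
    obtain u v where uv: "x @ word_pow y n @ z = u @ v" "u \<in> A" "v \<in> B"
      using w unfolding in_conc by blast
    have kn: "n \<ge> k" "n' \<ge> k" using n by simp_all
    from uv(1) consider r where "x = u @ r" "v = r @ word_pow y n @ z"
      | r where "u = x @ word_pow y n @ r" "z = r @ v"
      | r s where "word_pow y n = r @ s" "u = x @ r" "v = s @ z"
      by (auto simp: append_eq_append_conv2)
    then show ?thesis
    proof cases
      case 1
      then show ?thesis using concI[OF uv(2) B[of r y n z n']] uv(3) kn y by simp
    next
      case 2
      then show ?thesis using concI[OF A[of x y n r n'] uv(3)] uv(2) kn y by simp
    next
      case 3
      have "n \<ge> 1" using n(1) by simp
      with 3(1) obtain i j y1 y2 where ij: "r = word_pow y i @ y1" "s = y2 @ word_pow y j"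
          "y = y1 @ y2" "i + j + 1 = n"
        by (rule word_pow_cut)
      have eq: "x @ word_pow y (i' + j' + 1) @ z = (x @ word_pow y i' @ y1) @ (y2 @ word_pow y j' @ z)"
        for i' j'
      proof -
        have "word_pow y (i' + j' + 1) = word_pow y i' @ y @ word_pow y j'"
          using word_pow_add[of y i' "Suc j'"] by simp
        then show ?thesis by (metis append.assoc ij(3))
      qed
      have uA: "x @ word_pow y i @ y1 \<in> A" using uv(2) 3(2) ij(1) by simp
      have vB: "y2 @ word_pow y j @ z \<in> B" using uv(3) 3(3) ij(2) by simp
      show ?thesis
      proof (cases "i \<ge> k + 1")
        case True
        have "k \<le> i" "k \<le> n' - j - 1" using True ij(4) n(3) by simp_all
        then have "x @ word_pow y (n' - j - 1) @ y1 \<in> A" using A[OF uA _ _ y] by blast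
        then have "x @ word_pow y (n' - j - 1 + j + 1) @ z \<in> A @@ B"
          unfolding eq using vB by (rule concI)
        moreover have "n' - j - 1 + j + 1 = n'" using True ij(4) n(3) by simp
        ultimately show ?thesis by simp
      next
        case False
        then have j: "j \<ge> k + 1" using ij(4) n(1) by simp
        have "k \<le> j" "k \<le> n' - i - 1" using j ij(4) n(3) by simp_all
        then have "y2 @ word_pow y (n' - i - 1) @ z \<in> B" using B[OF vB _ _ y] by blast
        with uA have "x @ word_pow y (i + (n' - i - 1) + 1) @ z \<in> A @@ B"
          unfolding eq by (rule concI)
        moreover have "i + (n' - i - 1) + 1 = n'" using j ij(4) n(3) by simp
        ultimately show ?thesis by simp
      qed
    qed
  qed
  have "x @ word_pow y (2 * k + 2) @ z \<in> A @@ B \<longleftrightarrow> x @ word_pow y (2 * k + 2 + 1) @ z \<in> A @@ B"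
    if "y \<in> lists V" for x y z
    using pump[OF _ that, of x "2 * k + 2" z "2 * k + 2 + 1"]
      pump[OF _ that, of x "2 * k + 2 + 1" z "2 * k + 2"] by (auto simp del: word_pow_Suc)
  then show ?thesis unfolding non_counting_def
    by (intro exI[of _ "2 * k + 2"]) simp
qed

lemma star_free_imp_non_counting:
  assumes "star_free V L" shows "non_counting V L"
  using assms
proof (induction rule: star_free_induct)
  case empty
  show ?case unfolding non_counting_def by (intro exI[of _ 1]) simp
next
  case eps
  show ?case unfolding non_counting_def by (intro exI[of _ 1]) auto
next
  case (letter a)
  \<comment> \<open>The exponent 1 fails at \<open>y = [a]\<close> with \<open>x\<close> and
    \<open>z\<close> empty. From 2 on, the power of a nonempty word is too long.\<close>
  have "x @ word_pow y 2 @ z = [a] \<longleftrightarrow> x @ word_pow y (2 + 1) @ z = [a]" for x y z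
    by (cases y) (auto simp: numeral_2_eq_2 append_eq_Cons_conv)
  then show ?case unfolding non_counting_def by (intro exI[of _ 2]) simp
next
  case (Un A B)
  then obtain a b where ab: "a \<ge> 1" "b \<ge> 1"
    "\<forall>x\<in>lists V. \<forall>y\<in>lists V. \<forall>z\<in>lists V.
        x @ word_pow y a @ z \<in> A \<longleftrightarrow> x @ word_pow y (a + 1) @ z \<in> A"
    "\<forall>x\<in>lists V. \<forall>y\<in>lists V. \<forall>z\<in>lists V.
        x @ word_pow y b @ z \<in> B \<longleftrightarrow> x @ word_pow y (b + 1) @ z \<in> B"
    unfolding non_counting_def by metis
  have "x @ word_pow y (max a b) @ z \<in> A \<union> B \<longleftrightarrow> x @ word_pow y (max a b + 1) @ z \<in> A \<union> B"
    if "x \<in> lists V" "y \<in> lists V" "z \<in> lists V" for x y z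
    using non_counting_pow[OF ab(3) that, of "max a b" "max a b + 1"]
      non_counting_pow[OF ab(4) that, of "max a b" "max a b + 1"] by simp
  then show ?case unfolding non_counting_def using ab(1) by (intro exI[of _ "max a b"]) simp
next
  case (conc A B)
  then show ?case by (intro non_counting_conc star_free_subset_lists)
next
  case (Compl A)
  then show ?case by (auto simp: non_counting_def)
qed

subsection \<open>Aperiodic monoids recognise star-free languages\<close>

text \<open>The term \<open>(f x ^^ n) e\<close> is the n-th power of \<open>x\<close>. Carrier,
  operation and unit are all parameters because a local divisor lives on a subset of
  \<open>M\<close> with a multiplication and a unit of its own.\<close>

definition aperiodic_monoid :: "'m set \<Rightarrow> ('m \<Rightarrow> 'm \<Rightarrow> 'm) \<Rightarrow> 'm \<Rightarrow> bool" where
  "aperiodic_monoid M f e \<longleftrightarrow>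
     finite M \<and> e \<in> M \<and> (\<forall>x\<in>M. \<forall>y\<in>M. f x y \<in> M) \<and>
     (\<forall>x\<in>M. \<forall>y\<in>M. \<forall>z\<in>M. f (f x y) z = f x (f y z)) \<and>
     (\<forall>x\<in>M. f e x = x \<and> f x e = x) \<and>
     (\<exists>n. \<forall>x\<in>M. (f x ^^ Suc n) e = (f x ^^ n) e)"

definition word_value :: "('m \<Rightarrow> 'm \<Rightarrow> 'm) \<Rightarrow> 'm \<Rightarrow> ('a \<Rightarrow> 'm) \<Rightarrow> 'a list \<Rightarrow> 'm" where
  "word_value f e h w = foldr (\<lambda>a. f (h a)) w e"

lemma word_value_simps [simp]:
  "word_value f e h [] = e" "word_value f e h (a # w) = f (h a) (word_value f e h w)"
  by (simp_all add: word_value_def)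

text \<open>Only the complement depends on the alphabet. It is repaired by describing
  \<open>lists B\<close> over \<open>V\<close> as the set of words without any letter outside
  \<open>B\<close>.\<close>

lemma star_free_larger_alphabet:
  assumes "star_free B L" "B \<subseteq> V" "finite V" shows "star_free V L"
  using assms(1)
proof (induction rule: star_free_induct)
  case (Compl A)
  have "lists B = lists V - (\<Union>c\<in>V - B. lists V @@ {[c]} @@ lists V)"
  proof (intro equalityI subsetI)
    fix w assume w: "w \<in> lists V - (\<Union>c\<in>V - B. lists V @@ {[c]} @@ lists V)"
    have "c \<in> B" if "c \<in> set w" for c
    proof (rule ccontr)
      assume "c \<notin> B"
      obtain u v where uv: "w = u @ c # v" using split_list[OF \<open>c \<in> set w\<close>] by blast
      have "u @ [c] @ v \<in> lists V @@ {[c]} @@ lists V" using w uv by (intro concI) auto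
      then show False using w uv \<open>c \<notin> B\<close> by auto
    qed
    then show "w \<in> lists B" by auto
  qed (use assms(2) in \<open>auto simp: in_conc\<close>)
  moreover have "star_free V (\<Union>c\<in>V - B. lists V @@ {[c]} @@ lists V)"
    using assms(3)
    by (intro star_free_UN star_free_conc star_free_lists star_free_letter) auto
  ultimately show ?case
    by (metis Compl.IH star_free_Compl star_free_Diff)
qed (use assms(2) in \<open>auto intro: star_free_empty star_free_eps star_free_letter star_free_Un star_free_conc\<close>)

locale aperiodic =
  fixes M :: "'m set" and f :: "'m \<Rightarrow> 'm \<Rightarrow> 'm" and e :: 'm
  assumes aperiodic_monoid: "aperiodic_monoid M f e"
begin

lemma finite_M: "finite M" and e_closed [simp]: "e \<in> M"
  and closed [simp]: "x \<in> M \<Longrightarrow> y \<in> M \<Longrightarrow> f x y \<in> M"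
  and assoc: "x \<in> M \<Longrightarrow> y \<in> M \<Longrightarrow> z \<in> M \<Longrightarrow> f (f x y) z = f x (f y z)"
  and unit [simp]: "x \<in> M \<Longrightarrow> f e x = x" "x \<in> M \<Longrightarrow> f x e = x"
  using aperiodic_monoid by (auto simp: aperiodic_monoid_def)

lemma word_value_closed: "h ` V \<subseteq> M \<Longrightarrow> w \<in> lists V \<Longrightarrow> word_value f e h w \<in> M"
  by (induction w) auto

lemma word_value_append:
  assumes "h ` V \<subseteq> M" "u \<in> lists V" "v \<in> lists V"
  shows "word_value f e h (u @ v) = f (word_value f e h u) (word_value f e h v)"
  using assms(2)
proof (induction u)
  case (Cons a u)
  then have "h a \<in> M" using assms(1) by auto
  then show ?case using Cons assms by (simp add: assoc word_value_closed)
qed (use assms in \<open>simp add: word_value_closed\<close>)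

lemma pow_closed [simp]: "x \<in> M \<Longrightarrow> (f x ^^ n) e \<in> M"
  by (induction n) auto

text \<open>Multiplying by \<open>y\<close> from the left cancels one factor \<open>c\<close>, so
  the equation between two consecutive powers of \<open>c\<close> shrinks down to
  \<open>c = e\<close>. Here aperiodicity rules out nontrivial invertible elements.\<close>

lemma left_invertible:
  assumes "c \<in> M" "y \<in> M" "f y c = e" shows "c = e"
proof -
  obtain n where "(f c ^^ Suc n) e = (f c ^^ n) e"
    using aperiodic_monoid assms(1) unfolding aperiodic_monoid_def by blast
  then show ?thesis
  proof (induction n)
    case (Suc n)
    have cancel: "f y (f c x) = x" if "x \<in> M" for x
      using assms that by (simp flip: assoc)
    have "(f c ^^ Suc n) e = (f c ^^ n) e"
      using arg_cong[OF Suc.prems, of "f y"] assms(1) by (simp add: cancel)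
    then show ?case by (rule Suc.IH)
  qed (use assms in simp)
qed

text \<open>The local divisor at \<open>c\<close>: the set \<open>c M \<inter> M c\<close> with the multiplication
  \<open>(x c) \<circ> (c y) = x c y\<close>. It is smaller than \<open>M\<close> because it does not contain the unit.\<close>

definition local_divisor :: "'m \<Rightarrow> 'm set" where
  "local_divisor c = f c ` M \<inter> (\<lambda>x. f x c) ` M"

definition local_mult :: "'m \<Rightarrow> 'm \<Rightarrow> 'm \<Rightarrow> 'm" where
  "local_mult c u v = f (SOME x. x \<in> M \<and> u = f x c) v"

text \<open>The choice of \<open>x\<close> in the definition does not matter: if \<open>v\<close> is
  \<open>c z\<close>, then \<open>x v\<close> equals \<open>(x c) z\<close> and depends on
  \<open>x c\<close> only.\<close>

lemma local_mult_eq: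
  assumes "c \<in> M" "x \<in> M" "v \<in> local_divisor c" shows "local_mult c (f x c) v = f x v"
proof -
  define y where "y = (SOME y. y \<in> M \<and> f x c = f y c)"
  have y: "y \<in> M" "f x c = f y c"
    using someI[of "\<lambda>y. y \<in> M \<and> f x c = f y c" x] assms(2) by (auto simp: y_def)
  obtain z where z: "z \<in> M" "v = f c z" using assms(3) by (auto simp: local_divisor_def)
  have "f y v = f (f x c) z" using y z assms(1) by (simp add: assoc)
  also have "\<dots> = f x v" using z assms by (simp add: assoc)
  finally show ?thesis by (simp add: local_mult_def y_def)
qed

lemma local_divisorE:
  assumes "u \<in> local_divisor c"
  obtains x y where "x \<in> M" "y \<in> M" "u = f x c" "u = f c y"
  using assms by (auto simp: local_divisor_def)

text \<open>For \<open>u = x c\<close>, the n-th power of \<open>u\<close> in the local divisor is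
  the n-th power of \<open>x\<close> times \<open>c\<close>, so the exponent of \<open>M\<close>
  serves here too. Closure uses both presentations of an element, as a left and as a right multiple
  of \<open>c\<close>.\<close>

lemma aperiodic_local_divisor:
  assumes c: "c \<in> M" shows "aperiodic_monoid (local_divisor c) (local_mult c) c"
proof -
  let ?D = "local_divisor c"
  have c_in: "c \<in> ?D"
    using c by (auto simp: local_divisor_def intro!: image_eqI[where x = e])
  have DM: "?D \<subseteq> M" using c by (auto simp: local_divisor_def)
  have cl: "local_mult c u v \<in> ?D" if "u \<in> ?D" "v \<in> ?D" for u v
  proof -
    obtain x y where xy: "x \<in> M" "y \<in> M" "u = f x c" "u = f c y"
      using \<open>u \<in> ?D\<close> by (rule local_divisorE)
    obtain x' y' where xy': "x' \<in> M" "y' \<in> M" "v = f x' c" "v = f c y'"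
      using \<open>v \<in> ?D\<close> by (rule local_divisorE)
    have eq: "local_mult c u v = f x v" using local_mult_eq[OF c xy(1) that(2)] xy(3) by simp
    have "f x v = f (f x x') c" unfolding xy'(3) using xy(1) xy'(1) c by (simp add: assoc)
    moreover have "f x v = f u y'" unfolding xy(3) xy'(4) using xy(1) xy'(2) c by (simp add: assoc)
    then have "f x v = f c (f y y')" unfolding xy(4) using xy(2) xy'(2) c by (simp add: assoc)
    ultimately show ?thesis unfolding eq local_divisor_def
      using xy(1,2) xy'(1,2) by (metis IntI closed imageI)
  qed
  have as: "local_mult c (local_mult c u v) w = local_mult c u (local_mult c v w)"
    if uvw: "u \<in> ?D" "v \<in> ?D" "w \<in> ?D" for u v w
  proof -
    obtain x where x: "x \<in> M" "u = f x c" using uvw(1) by (auto simp: local_divisor_def)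
    obtain y where y: "y \<in> M" "v = f y c" using uvw(2) by (auto simp: local_divisor_def)
    have "local_mult c u v = f (f x y) c"
      using local_mult_eq[OF c x(1) uvw(2)] x y c by (simp add: assoc)
    then have "local_mult c (local_mult c u v) w = f (f x y) w"
      using local_mult_eq[OF c _ uvw(3)] x y by simp
    also have "\<dots> = f x (f y w)" using x(1) y(1) uvw(3) DM by (auto simp: assoc)
    also have "\<dots> = f x (local_mult c v w)" using local_mult_eq[OF c y(1) uvw(3)] y by simp
    also have "\<dots> = local_mult c u (local_mult c v w)"
      using local_mult_eq[OF c x(1) cl[OF uvw(2,3)]] x by simp
    finally show ?thesis .
  qed
  have un: "local_mult c c u = u \<and> local_mult c u c = u" if u: "u \<in> ?D" for u
  proof -
    obtain x where x: "x \<in> M" "u = f x c" using u by (auto simp: local_divisor_def)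
    have "u \<in> M" using DM u by blast
    then show ?thesis
      using local_mult_eq[OF c e_closed u] local_mult_eq[OF c x(1) c_in] x c by simp
  qed
  obtain n where n: "\<forall>x\<in>M. (f x ^^ Suc n) e = (f x ^^ n) e"
    using aperiodic_monoid unfolding aperiodic_monoid_def by blast
  have "(local_mult c u ^^ Suc n) c = (local_mult c u ^^ n) c" if u: "u \<in> ?D" for u
  proof -
    obtain x where x: "x \<in> M" "u = f x c" using u by (auto simp: local_divisor_def)
    have "(local_mult c u ^^ k) c = f ((f x ^^ k) e) c \<and> (local_mult c u ^^ k) c \<in> ?D" for k
    proof (induction k)
      case (Suc k)
      then have "(local_mult c u ^^ k) c \<in> ?D" ..
      from local_mult_eq[OF c x(1) this] have "(local_mult c u ^^ Suc k) c = f x ((local_mult c u ^^ k) c)"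
        unfolding x(2) by simp
      moreover have "(local_mult c u ^^ Suc k) c \<in> ?D" using cl[OF u conjunct2[OF Suc.IH]] by simp
      ultimately show ?case using Suc x(1) c by (simp add: assoc)
    qed (use c c_in in simp)
    then show ?thesis using n x(1) by metis
  qed
  then show ?thesis
    unfolding aperiodic_monoid_def using cl as un c_in finite_subset[OF DM finite_M] by blast
qed

lemma card_local_divisor:
  assumes "c \<in> M" "c \<noteq> e" shows "card (local_divisor c) < card M"
proof -
  have "e \<notin> local_divisor c"
  proof
    assume "e \<in> local_divisor c"
    then obtain x where "x \<in> M" "f x c = e" by (auto simp: local_divisor_def)
    then show False using left_invertible assms by blast
  qed
  moreover have "local_divisor c \<subseteq> M" using assms(1) by (auto simp: local_divisor_def)
  ultimately have "local_divisor c \<subset> M" using e_closed by blast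
  then show ?thesis using finite_M by (rule psubset_card_mono[rotated])
qed

end

text \<open>A word that starts with the letter \<open>c\<close> is a sequence of blocks \<open>c v\<close> in which \<open>c\<close> does not
  occur in \<open>v\<close>. It is read as a word over the values of the blocks \<open>v\<close>.\<close>

definition blocks :: "'a \<Rightarrow> 'a list list \<Rightarrow> 'a list" where
  "blocks c vs = concat (map ((#) c) vs)"

lemma blocks_simps [simp]: "blocks c [] = []" "blocks c (v # vs) = c # v @ blocks c vs"
  "blocks c (us @ vs) = blocks c us @ blocks c vs"
  by (simp_all add: blocks_def)

lemma blocks_lists: "vs \<in> lists (lists B) \<Longrightarrow> c \<in> V \<Longrightarrow> B \<subseteq> V \<Longrightarrow> blocks c vs \<in> lists V"
  by (induction vs) (auto dest: subsetD)

lemma takeWhile_block: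
  assumes "v \<in> lists (V - {c})" shows "takeWhile (\<lambda>x. x \<noteq> c) (v @ blocks c vs) = v"
proof -
  have "takeWhile (\<lambda>x. x \<noteq> c) (blocks c vs) = []" by (cases vs) auto
  moreover have "\<forall>x\<in>set v. x \<noteq> c" using assms by auto
  ultimately show ?thesis by (simp add: takeWhile_append2)
qed

text \<open>After the leading \<open>c\<close>, the letters before the next \<open>c\<close> recover
  the first block. This uniqueness lets complementation commute with the passage from sequences of
  blocks to words.\<close>

lemma blocks_inject:
  assumes "us \<in> lists (lists (V - {c}))" "vs \<in> lists (lists (V - {c}))" "blocks c us = blocks c vs"
  shows "us = vs"
  using assms
proof (induction us arbitrary: vs)
  case Nil
  then show ?case by (cases vs) auto
next
  case (Cons u us)
  then obtain v vs' where vs: "vs = v # vs'" by (cases vs) auto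
  have v: "v \<in> lists (V - {c})" "vs' \<in> lists (lists (V - {c}))" using Cons.prems(1) vs by simp_all
  have eq: "u @ blocks c us = v @ blocks c vs'" using Cons.prems(2) vs by simp
  then have "u = v" using takeWhile_block[OF Cons.hyps(1)] takeWhile_block[OF v(1)] by metis
  then show ?case using Cons.IH[OF v(2)] eq vs by simp
qed

lemma blocks_exist:
  assumes "w \<in> lists V"
  obtains u vs where "u \<in> lists (V - {c})" "vs \<in> lists (lists (V - {c}))" "w = u @ blocks c vs"
proof -
  have "\<exists>u vs. u \<in> lists (V - {c}) \<and> vs \<in> lists (lists (V - {c})) \<and> w = u @ blocks c vs"
    using assms
  proof (induction w)
    case Nil
    show ?case by (intro exI[of _ "[]"]) simp
  next
    case (Cons a w)
    then obtain u vs where *: "u \<in> lists (V - {c})" "vs \<in> lists (lists (V - {c}))" "w = u @ blocks c vs"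
      by auto
    show ?case
    proof (cases "a = c")
      case True
      then show ?thesis using * by (intro exI[of _ "[]"] exI[of _ "u # vs"]) simp
    next
      case False
      then show ?thesis using * \<open>a \<in> V\<close> by (intro exI[of _ "a # u"] exI[of _ vs]) simp
    qed
  qed
  then show ?thesis using that by blast
qed

text \<open>Each letter \<open>t\<close> is replaced by the star-free language of the blocks
  \<open>c # v\<close> with \<open>g v = t\<close>. Since the decomposition into blocks is unique,
  the substitution respects not only union and concatenation but also complement.\<close>

lemma star_free_blocks:
  assumes "star_free T K" and T: "T = g ` lists (V - {c})" and "c \<in> V"
    and g: "\<And>t. star_free V {v \<in> lists (V - {c}). g v = t}"
  shows "star_free V {blocks c vs | vs. vs \<in> lists (lists (V - {c})) \<and> map g vs \<in> K}"
    (is "star_free V (?S K)")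
  using assms(1)
proof (induction rule: star_free_induct)
  case empty
  show ?case by (simp add: star_free_empty)
next
  case eps
  have "?S {[]} = {[]}" by (auto intro: exI[of _ "[]"])
  then show ?case by (simp add: star_free_eps)
next
  case (letter t)
  have "?S {[t]} = {[c]} @@ {v \<in> lists (V - {c}). g v = t}"
  proof (intro equalityI subsetI)
    fix w assume "w \<in> ?S {[t]}"
    then obtain v where "w = c # v" "v \<in> lists (V - {c})" "g v = t" by (auto simp: map_eq_Cons_conv)
    then show "w \<in> {[c]} @@ {v \<in> lists (V - {c}). g v = t}" by (simp add: in_conc)
  next
    fix w assume "w \<in> {[c]} @@ {v \<in> lists (V - {c}). g v = t}"
    then obtain v where "w = c # v" "v \<in> lists (V - {c})" "g v = t" by (auto simp: in_conc)
    then show "w \<in> ?S {[t]}" by (intro CollectI exI[of _ "[v]"]) simp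
  qed
  then show ?case by (simp add: g star_free_conc star_free_letter assms(3))
next
  case (Un A B)
  have "?S (A \<union> B) = ?S A \<union> ?S B" by blast
  then show ?case using Un.IH by (simp add: star_free_Un)
next
  case (conc A B)
  have "?S (A @@ B) = ?S A @@ ?S B"
  proof (intro equalityI subsetI)
    fix w assume "w \<in> ?S (A @@ B)"
    then obtain vs a b where "w = blocks c vs" "vs \<in> lists (lists (V - {c}))"
        "map g vs = a @ b" "a \<in> A" "b \<in> B" by (auto simp: in_conc)
    moreover from this obtain us us' where "vs = us @ us'" "a = map g us" "b = map g us'"
      by (auto simp: map_eq_append_conv)
    ultimately have "blocks c us @ blocks c us' \<in> ?S A @@ ?S B" "w = blocks c us @ blocks c us'"
      by (auto intro!: concI)
    then show "w \<in> ?S A @@ ?S B" by simp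
  next
    fix w assume "w \<in> ?S A @@ ?S B"
    then obtain us vs where "w = blocks c (us @ vs)" "us \<in> lists (lists (V - {c}))"
        "vs \<in> lists (lists (V - {c}))" "map g us \<in> A" "map g vs \<in> B" by (auto simp: in_conc)
    then show "w \<in> ?S (A @@ B)" by (intro CollectI exI[of _ "us @ vs"]) (auto intro: concI)
  qed
  then show ?case using conc.IH by (simp add: star_free_conc)
next
  case (Compl A)
  \<comment> \<open>A word splits into blocks exactly if it is empty or starts with
    \<open>c\<close>, so the complement is taken inside this language.\<close>
  have "?S (lists T - A) = ({[]} \<union> {[c]} @@ lists V) - ?S A"
  proof (intro equalityI subsetI)
    fix w assume "w \<in> ?S (lists T - A)"
    then obtain vs where vs: "w = blocks c vs" "vs \<in> lists (lists (V - {c}))" "map g vs \<notin> A" by auto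
    then have "w \<notin> ?S A" using blocks_inject[OF vs(2)] by auto
    moreover have "w \<in> {[]} \<union> {[c]} @@ lists V"
      using vs(1,2) blocks_lists[of "tl vs" "V - {c}" c V] assms(3)
      by (cases vs) (auto simp: in_conc simp del: in_lists_conv_set)
    ultimately show "w \<in> ({[]} \<union> {[c]} @@ lists V) - ?S A" by blast
  next
    fix w assume w: "w \<in> ({[]} \<union> {[c]} @@ lists V) - ?S A"
    have "\<exists>vs. vs \<in> lists (lists (V - {c})) \<and> w = blocks c vs"
    proof (cases "w = []")
      case True
      then show ?thesis by (intro exI[of _ "[]"]) simp
    next
      case False
      then obtain v where v: "w = c # v" "v \<in> lists V" using w by (auto simp: in_conc)
      obtain u vs where "u \<in> lists (V - {c})" "vs \<in> lists (lists (V - {c}))" "v = u @ blocks c vs"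
        using blocks_exist[OF v(2)] by blast
      then show ?thesis using v(1) by (intro exI[of _ "u # vs"]) simp
    qed
    then obtain vs where vs: "vs \<in> lists (lists (V - {c}))" "w = blocks c vs" by blast
    have "map g vs \<in> lists T" using vs(1) T by auto
    then show "w \<in> ?S (lists T - A)" using w vs by blast
  qed
  moreover have "star_free V ({[]} \<union> {[c]} @@ lists V)"
    by (intro star_free_Un star_free_conc star_free_eps star_free_letter star_free_lists assms(3))
  ultimately show ?case by (simp only: star_free_Diff Compl.IH)
qed

text \<open>The inductive step of Schuetzenberger's theorem. The letters of the alphabet that is passed to
  the smaller monoid are elements of \<open>M\<close>, which is why the hypothesis and the conclusion are about
  different types of letters.\<close>

lemma star_free_word_value_step:
  fixes V :: "'a set" and M :: "'m set"
  assumes mon: "aperiodic_monoid M f e"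
    and smaller: "\<And>M' f' e' (T :: 'm set) h' p.
      \<lbrakk>aperiodic_monoid M' f' e'; card M' < card M; finite T; h' ` T \<subseteq> (M' :: 'm set)\<rbrakk> \<Longrightarrow>
      star_free T {w \<in> lists T. word_value f' e' h' w = p}"
    and "finite V" "h ` V \<subseteq> M"
  shows "star_free V {w \<in> lists V. word_value f e h w = p}"
  using assms(3,4)
proof (induction V arbitrary: p rule: finite_psubset_induct)
  case (psubset V)
  interpret aperiodic M f e by unfold_locales (rule mon)
  let ?\<phi> = "word_value f e h"
  show ?case
  \<comment> \<open>If every letter has value \<open>e\<close>, so has every word. Otherwise a
    letter \<open>c\<close> of another value is split off: words without \<open>c\<close> fall under
    the induction on the alphabet, and \<open>h c \<noteq> e\<close> makes the local divisor smaller
    than \<open>M\<close>.\<close>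
  proof (cases "\<forall>a\<in>V. h a = e")
    case True
    have "?\<phi> w = e" if "w \<in> lists V" for w
      using that by (induction w) (use True in auto)
    then have "{w \<in> lists V. ?\<phi> w = p} = (if p = e then lists V else {})" by auto
    then show ?thesis by (simp add: star_free_lists star_free_empty)
  next
    case False
    then obtain c where c: "c \<in> V" "h c \<noteq> e" by blast
    let ?B = "V - {c}" and ?\<gamma> = "h c"
    have \<gamma>: "?\<gamma> \<in> M" using c psubset.prems by blast
    have hB: "h ` ?B \<subseteq> M" using psubset.prems by blast
    have N: "star_free V {v \<in> lists ?B. ?\<phi> v = t}" for t
    proof (rule star_free_larger_alphabet)
      show "star_free ?B {v \<in> lists ?B. ?\<phi> v = t}"
        using c(1) hB by (intro psubset.IH) auto
    qed (use psubset.hyps in auto)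
    define T where "T = ?\<phi> ` lists ?B"
    \<comment> \<open>In the local divisor, the product of \<open>\<gamma> t \<gamma>\<close> and
      \<open>\<gamma> s \<gamma>\<close> is \<open>\<gamma> t \<gamma> s \<gamma>\<close>. A
      sequence of blocks thus gets the value in \<open>M\<close> of its word followed by one more
      \<open>c\<close>.\<close>
    define h' where "h' t = f (f ?\<gamma> t) ?\<gamma>" for t
    have TM: "T \<subseteq> M" unfolding T_def using word_value_closed[OF hB] by blast
    have h': "h' t \<in> local_divisor ?\<gamma>" if "t \<in> T" for t
    proof -
      have t: "t \<in> M" using that TM by blast
      have "h' t = f ?\<gamma> (f t ?\<gamma>)" using t \<gamma> by (simp add: h'_def assoc)
      moreover have "h' t = f (f ?\<gamma> t) ?\<gamma>" by (simp add: h'_def)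
      ultimately show ?thesis using t \<gamma> unfolding local_divisor_def by (metis IntI closed imageI)
    qed
    then have "star_free T {ts \<in> lists T. word_value (local_mult ?\<gamma>) ?\<gamma> h' ts = q}" for q
      using finite_subset[OF TM finite_M]
      by (intro smaller[OF aperiodic_local_divisor[OF \<gamma>] card_local_divisor[OF \<gamma> c(2)]]) auto
    from star_free_blocks[OF this T_def c(1) N]
    have S: "star_free V {blocks c vs | vs. vs \<in> lists (lists ?B) \<and>
        map ?\<phi> vs \<in> {ts \<in> lists T. word_value (local_mult ?\<gamma>) ?\<gamma> h' ts = q}}" for q .
    have val: "word_value (local_mult ?\<gamma>) ?\<gamma> h' (map ?\<phi> vs) = ?\<phi> (blocks c vs @ [c]) \<and>
        ?\<phi> (blocks c vs @ [c]) \<in> local_divisor ?\<gamma>" if "vs \<in> lists (lists ?B)" for vs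
      using that
    proof (induction vs)
      case Nil
      have "?\<gamma> \<in> local_divisor ?\<gamma>"
        using aperiodic_local_divisor[OF \<gamma>] by (simp add: aperiodic_monoid_def)
      then show ?case using \<gamma> by simp
    next
      case (Cons v vs)
      let ?r = "?\<phi> (blocks c vs @ [c])"
      have v: "v \<in> lists V" "?\<phi> v \<in> M" using Cons.hyps(1) word_value_closed[OF hB] by auto
      have r: "blocks c vs @ [c] \<in> lists V"
        using blocks_lists[of vs ?B c V] Cons.hyps(2) c(1) by auto
      have rM: "?r \<in> M" using word_value_closed[OF psubset.prems r] .
      have "local_mult ?\<gamma> (h' (?\<phi> v)) ?r = f (f ?\<gamma> (?\<phi> v)) ?r"
        unfolding h'_def using Cons.IH v(2) \<gamma> by (intro local_mult_eq) auto
      also have "\<dots> = ?\<phi> (blocks c (v # vs) @ [c])"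
        using word_value_append[OF psubset.prems v(1) r] v(2) \<gamma> rM by (simp add: assoc)
      finally have eq: "local_mult ?\<gamma> (h' (?\<phi> v)) ?r = ?\<phi> (blocks c (v # vs) @ [c])" .
      moreover have "h' (?\<phi> v) \<in> local_divisor ?\<gamma>"
        using h' Cons.hyps(1) by (simp add: T_def)
      then have "local_mult ?\<gamma> (h' (?\<phi> v)) ?r \<in> local_divisor ?\<gamma>"
        using aperiodic_local_divisor[OF \<gamma>] Cons.IH by (simp add: aperiodic_monoid_def)
      ultimately show ?case using Cons.IH by simp
    qed
    define P where "P q = {blocks c vs | vs. vs \<in> lists (lists ?B) \<and> ?\<phi> (blocks c vs @ [c]) = q}" for q
    have "P q = {blocks c vs | vs. vs \<in> lists (lists ?B) \<and>
        map ?\<phi> vs \<in> {ts \<in> lists T. word_value (local_mult ?\<gamma>) ?\<gamma> h' ts = q}}" for q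
    proof -
      have "map ?\<phi> vs \<in> lists T" if "vs \<in> lists (lists ?B)" for vs
        using that by (auto simp: T_def)
      then have "vs \<in> lists (lists ?B) \<and> ?\<phi> (blocks c vs @ [c]) = q \<longleftrightarrow> vs \<in> lists (lists ?B) \<and>
          map ?\<phi> vs \<in> {ts \<in> lists T. word_value (local_mult ?\<gamma>) ?\<gamma> h' ts = q}" for vs
        using val by (simp cong: conj_cong del: in_lists_conv_set)
      then show ?thesis unfolding P_def by presburger
    qed
    then have P: "star_free V (P q)" for q using S by simp
    let ?I = "{(p1, p2, p3). p1 \<in> M \<and> p2 \<in> M \<and> p3 \<in> M \<and> f p1 (f p2 p3) = p}"
    let ?N = "\<lambda>t. {v \<in> lists ?B. ?\<phi> v = t}"
    \<comment> \<open>A word containing \<open>c\<close> is cut before its first and after its last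
      \<open>c\<close>. The middle part is a sequence of blocks with a closing \<open>c\<close>, as
      required by \<open>val\<close>; the values of the three parts range over the finite set
      \<open>?I\<close>.\<close>
    have "{w \<in> lists V. ?\<phi> w = p} =
        ?N p \<union> (\<Union>(p1, p2, p3)\<in>?I. ?N p1 @@ (P p2 @@ {[c]}) @@ ?N p3)"
    proof (intro equalityI subsetI)
      fix w assume w: "w \<in> {w \<in> lists V. ?\<phi> w = p}"
      then have "w \<in> lists V" by simp
      then obtain u vs where uvs: "u \<in> lists ?B" "vs \<in> lists (lists ?B)" "w = u @ blocks c vs"
        by (rule blocks_exist)
      show "w \<in> ?N p \<union> (\<Union>(p1, p2, p3)\<in>?I. ?N p1 @@ (P p2 @@ {[c]}) @@ ?N p3)"
      proof (cases vs rule: rev_cases)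
        case Nil
        then show ?thesis using uvs w by simp
      next
        case (snoc ws v)
        let ?m = "blocks c ws @ [c]"
        have ws: "ws \<in> lists (lists ?B)" "v \<in> lists ?B" using uvs(2) snoc by auto
        have lists: "u \<in> lists V" "?m \<in> lists V" "v \<in> lists V"
          using uvs(1) ws(2) blocks_lists[OF ws(1), of c V] c(1) by auto
        have "w = u @ ?m @ v" using uvs(3) snoc by simp
        moreover have "?\<phi> (u @ ?m @ v) = f (?\<phi> u) (f (?\<phi> ?m) (?\<phi> v))"
          using lists by (simp only: word_value_append[OF psubset.prems] append_in_lists_conv)
        ultimately have "(?\<phi> u, ?\<phi> ?m, ?\<phi> v) \<in> ?I"
          using w lists word_value_closed[OF psubset.prems] by simp
        moreover have "u @ ?m @ v \<in> ?N (?\<phi> u) @@ (P (?\<phi> ?m) @@ {[c]}) @@ ?N (?\<phi> v)"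
          using uvs(1) ws by (intro concI) (auto simp: P_def)
        ultimately show ?thesis unfolding \<open>w = u @ ?m @ v\<close> by blast
      qed
    next
      fix w assume "w \<in> ?N p \<union> (\<Union>(p1, p2, p3)\<in>?I. ?N p1 @@ (P p2 @@ {[c]}) @@ ?N p3)"
      then consider "w \<in> ?N p"
        | p1 p2 p3 where "(p1, p2, p3) \<in> ?I" "w \<in> ?N p1 @@ (P p2 @@ {[c]}) @@ ?N p3" by blast
      then show "w \<in> {w \<in> lists V. ?\<phi> w = p}"
      proof cases
        case 1
        then show ?thesis by auto
      next
        case 2
        then obtain u m v where m: "w = u @ m @ v" "m \<in> P p2 @@ {[c]}" and
            uv: "u \<in> lists ?B" "v \<in> lists ?B" "?\<phi> u = p1" "?\<phi> v = p3"
          unfolding in_conc by blast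
        from m(2) obtain vs where vs: "m = blocks c vs @ [c]" "vs \<in> lists (lists ?B)"
            "?\<phi> (blocks c vs @ [c]) = p2"
          unfolding in_conc P_def by blast
        have w: "w = u @ (blocks c vs @ [c]) @ v" using m(1) vs(1) by simp
        have lists: "u \<in> lists V" "blocks c vs @ [c] \<in> lists V" "v \<in> lists V"
          using uv(1,2) blocks_lists[OF vs(2), of c V] c(1) by auto
        have "?\<phi> w = f (?\<phi> u) (f (?\<phi> (blocks c vs @ [c])) (?\<phi> v))"
          unfolding w using lists by (simp only: word_value_append[OF psubset.prems] append_in_lists_conv)
        then show ?thesis using 2(1) uv(3,4) vs(3) lists w by simp
      qed
    qed
    moreover have "finite ?I"
      by (rule finite_subset[of _ "M \<times> M \<times> M"]) (auto simp: finite_M)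
    ultimately show ?thesis using N P c(1)
      by (auto intro!: star_free_Un star_free_UN star_free_conc star_free_letter)
  qed
qed

text \<open>The step reduces any alphabet to alphabets of monoid elements. So the induction on the
  size of the monoid is run for the latter, and one more application of the step reaches letters of
  type \<open>'a\<close>.\<close>

lemma star_free_word_value:
  fixes V :: "'a set" and M :: "'m set"
  assumes "aperiodic_monoid M f e" "finite V" "h ` V \<subseteq> M"
  shows "star_free V {w \<in> lists V. word_value f e h w = p}"
proof -
  have "star_free T {w \<in> lists T. word_value f' e' h' w = p'}"
    if "aperiodic_monoid M' f' e'" "finite T" "h' ` T \<subseteq> M'"
    for M' :: "'m set" and f' e' and T :: "'m set" and h' p'
    using that
  proof (induction "card M'" arbitrary: M' f' e' T h' p' rule: less_induct)
    case less
    show ?case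
      by (rule star_free_word_value_step[OF less.prems(1) _ less.prems(2,3)]) (rule less.hyps)
  qed
  then show ?thesis by (rule star_free_word_value_step[OF assms(1) _ assms(2,3)])
qed

text \<open>The monoid is the syntactic monoid of \<open>L\<close>, each class being represented by
  its set of contexts. Non-counting provides one exponent from which consecutive powers have the
  same contexts, which is aperiodicity.\<close>

lemma non_counting_imp_star_free:
  assumes "finite V" "regular V L" "non_counting V L" shows "star_free V L"
proof -
  define ctx where "ctx w = {(x, z). x \<in> lists V \<and> z \<in> lists V \<and> x @ w @ z \<in> L}" for w
  define M where "M = ctx ` lists V"
  define rep where "rep P = (SOME u. u \<in> lists V \<and> ctx u = P)" for P
  define f where "f P Q = ctx (rep P @ rep Q)" for P Q
  have cong: "ctx (u @ v) = ctx (u' @ v')"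
    if "ctx u = ctx u'" "ctx v = ctx v'" "u \<in> lists V" "v' \<in> lists V" for u u' v v'
  proof -
    have "(x, z) \<in> ctx (u @ v) \<longleftrightarrow> (x, z) \<in> ctx (u' @ v')" for x z
    proof -
      have "(x, z) \<in> ctx (u @ v) \<longleftrightarrow> x \<in> lists V \<and> (x @ u, z) \<in> ctx v"
        using that(3) by (auto simp: ctx_def)
      also have "\<dots> \<longleftrightarrow> z \<in> lists V \<and> (x, v' @ z) \<in> ctx u"
        unfolding that(2) using that(3,4) by (auto simp: ctx_def)
      also have "\<dots> \<longleftrightarrow> (x, z) \<in> ctx (u' @ v')"
        unfolding that(1) using that(4) by (auto simp: ctx_def)
      finally show ?thesis .
    qed
    then show ?thesis by auto
  qed
  have f_ctx: "f (ctx u) (ctx v) = ctx (u @ v)" if "u \<in> lists V" "v \<in> lists V" for u v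
  proof -
    have rep: "rep (ctx w) \<in> lists V \<and> ctx (rep (ctx w)) = ctx w" if "w \<in> lists V" for w
      unfolding rep_def using someI[of "\<lambda>u. u \<in> lists V \<and> ctx u = ctx w" w] that by blast
    show ?thesis unfolding f_def using rep that by (intro cong) auto
  qed
  have pow: "(f (ctx w) ^^ n) (ctx []) = ctx (word_pow w n)" if "w \<in> lists V" for w n
    using that by (induction n) (simp_all add: f_ctx)
  obtain k where k: "\<forall>x\<in>lists V. \<forall>y\<in>lists V. \<forall>z\<in>lists V.
      x @ word_pow y k @ z \<in> L \<longleftrightarrow> x @ word_pow y (k + 1) @ z \<in> L"
    using assms(3) unfolding non_counting_def by blast
  have ap: "ctx (word_pow w (Suc k)) = ctx (word_pow w k)" if "w \<in> lists V" for w
    unfolding ctx_def using k that by auto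
  have "finite M"
  \<comment> \<open>The contexts of \<open>w\<close> can be read off from the action of
    \<open>w\<close> on the finitely many quotients of \<open>L\<close>, recorded as a relation on
    \<open>?D\<close>.\<close>
  proof (rule finite_subset)
    let ?D = "derivs V L"
    let ?g = "\<lambda>R. {(x, z). x \<in> lists V \<and> z \<in> lists V \<and> (\<exists>E. (deriv x L, E) \<in> R \<and> z \<in> E)}"
    have "ctx w \<in> ?g ` Pow (?D \<times> ?D)" if "w \<in> lists V" for w
    proof (rule image_eqI)
      show "ctx w = ?g ((\<lambda>D. (D, deriv w D)) ` ?D)"
        by (auto simp: ctx_def image_iff intro: derivsI)
      have "deriv w D \<in> ?D" if "D \<in> ?D" for D
        using that derivsI[of "u @ w" V L for u] \<open>w \<in> lists V\<close> by (auto simp: derivs_def deriv_append)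
      then show "(\<lambda>D. (D, deriv w D)) ` ?D \<in> Pow (?D \<times> ?D)" by auto
    qed
    then show "M \<subseteq> ?g ` Pow (?D \<times> ?D)" by (auto simp: M_def)
    show "finite (?g ` Pow (?D \<times> ?D))" using assms(2) by (simp add: regular_iff_finite_derivs)
  qed
  moreover have "\<forall>P\<in>M. (f P ^^ Suc k) (ctx []) = (f P ^^ k) (ctx [])"
    unfolding M_def using pow ap by (metis imageE)
  ultimately have mon: "aperiodic_monoid M f (ctx [])"
    unfolding aperiodic_monoid_def M_def by (auto simp: f_ctx simp del: in_lists_conv_set funpow.simps)
  have val: "word_value f (ctx []) (\<lambda>a. ctx [a]) w = ctx w" if "w \<in> lists V" for w
    using that by (induction w) (simp_all add: f_ctx)
  have sf: "star_free V {w \<in> lists V. ctx w = P}" for P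
  proof -
    have "{w \<in> lists V. ctx w = P} =
        {w \<in> lists V. word_value f (ctx []) (\<lambda>a. ctx [a]) w = P}" using val by auto
    moreover have "(\<lambda>a. ctx [a]) ` V \<subseteq> M" by (auto simp: M_def)
    ultimately show ?thesis using star_free_word_value[OF mon assms(1)] by simp
  qed
  \<comment> \<open>The context of two empty words decides membership, so \<open>L\<close> is a
    union of classes.\<close>
  have "u \<in> L" if "w \<in> L" "ctx u = ctx w" for u w
    using that by (auto simp: ctx_def set_eq_iff dest!: spec[of _ "[]"])
  then have eq: "(\<Union>P\<in>ctx ` L. {w \<in> lists V. ctx w = P}) = L"
    using regular_subset_lists[OF assms(2)] by blast
  have "finite (ctx ` L)"
    using regular_subset_lists[OF assms(2)] \<open>finite M\<close> by (auto simp: M_def intro: finite_subset)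
  then have "star_free V (\<Union>P\<in>ctx ` L. {w \<in> lists V. ctx w = P})"
    by (rule star_free_UN) (rule sf)
  then show ?thesis unfolding eq .
qed

section \<open>Ordered automata\<close>

text \<open>The injection into the natural numbers need not preserve the order of the states, so the
  order is carried over as a relation on the new names.\<close>

lemma orderedI:
  fixes Z :: "'s::linorder set"
  assumes dfa: "dfa V Z z0 F \<delta>"
    and mono: "\<And>z z' a. \<lbrakk>z \<in> Z; z' \<in> Z; z \<le> z'; a \<in> V\<rbrakk> \<Longrightarrow> \<delta> z a \<le> \<delta> z' a"
  shows "ordered V (accepted V z0 F \<delta>)"
proof -
  have "finite Z" using dfa by (simp add: dfa_def)
  then obtain f :: "'s \<Rightarrow> nat" where inj: "inj_on f Z"
    using finite_imp_inj_to_nat_seg by blast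
  let ?r = "{(f x, f y) | x y. x \<in> Z \<and> y \<in> Z \<and> x \<le> y}"
  let ?\<delta> = "\<lambda>q a. f (\<delta> (inv_into Z f q) a)"
  have step: "\<delta> z a \<in> Z" if "z \<in> Z" "a \<in> V" for z a using dfa that by (simp add: dfa_def)
  have iff: "(f x, f y) \<in> ?r \<longleftrightarrow> x \<le> y" if "x \<in> Z" "y \<in> Z" for x y
    using that inj by (auto dest: inj_onD)
  have "linear_order_on (f ` Z) ?r"
    unfolding order_on_defs
  proof (intro conjI)
    show "?r \<subseteq> f ` Z \<times> f ` Z" by auto
    show "refl_on (f ` Z) ?r" by (auto simp: refl_on_def)
    show "trans ?r"
    proof (rule transI)
      fix p q s assume "(p, q) \<in> ?r" "(q, s) \<in> ?r"
      then obtain x y y' z where xyz: "p = f x" "q = f y" "q = f y'" "s = f z"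
          "x \<in> Z" "y \<in> Z" "y' \<in> Z" "z \<in> Z" "x \<le> y" "y' \<le> z" by blast
      then have "y = y'" using inj by (metis inj_onD)
      then have "x \<le> z" using xyz by simp
      then show "(p, s) \<in> ?r" using xyz by blast
    qed
    show "antisym ?r"
    proof (rule antisymI)
      fix p q assume pq: "(p, q) \<in> ?r" "(q, p) \<in> ?r"
      then obtain x y where xy: "p = f x" "q = f y" "x \<in> Z" "y \<in> Z" by blast
      have "x \<le> y" using pq(1) iff[OF xy(3,4)] unfolding xy(1,2) by blast
      moreover have "y \<le> x" using pq(2) iff[OF xy(4,3)] unfolding xy(1,2) by blast
      ultimately show "p = q" using xy by simp
    qed
    show "total_on (f ` Z) ?r" by (auto simp: total_on_def) (metis linear)
  qed
  moreover have "\<forall>q\<in>f ` Z. \<forall>q'\<in>f ` Z. (q, q') \<in> ?r \<longrightarrow> (\<forall>a\<in>V. (?\<delta> q a, ?\<delta> q' a) \<in> ?r)"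
    using iff step mono inj by simp
  ultimately show ?thesis
    unfolding ordered_def
    by (intro exI[of _ "f ` Z"] exI[of _ "f z0"] exI[of _ "f ` F"] exI[of _ ?\<delta>] exI[of _ ?r] conjI
        dfa_rename[OF dfa inj] accepted_rename[OF dfa inj, symmetric])
qed

lemma orderedE:
  assumes "ordered V L"
  obtains Z :: "nat set" and z0 F \<delta> r where "dfa V Z z0 F \<delta>" "L = accepted V z0 F \<delta>"
    "linear_order_on Z r" "\<And>p q w. \<lbrakk>(p, q) \<in> r; w \<in> lists V\<rbrakk> \<Longrightarrow> (foldl \<delta> p w, foldl \<delta> q w) \<in> r"
proof -
  obtain Z :: "nat set" and z0 F \<delta> r where *: "dfa V Z z0 F \<delta>" "L = accepted V z0 F \<delta>"
    "linear_order_on Z r" and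
    step: "\<forall>z\<in>Z. \<forall>z'\<in>Z. (z, z') \<in> r \<longrightarrow> (\<forall>a\<in>V. (\<delta> z a, \<delta> z' a) \<in> r)"
    using assms unfolding ordered_def by blast
  have "r \<subseteq> Z \<times> Z" using *(3) by (simp add: order_on_defs)
  then have "(foldl \<delta> p w, foldl \<delta> q w) \<in> r" if "(p, q) \<in> r" "w \<in> lists V" for p q w
    using that(2,1) by (induction w arbitrary: p q) (use step in auto)
  then show ?thesis using * that by blast
qed

text \<open>If all neighbours differed, transitivity and antisymmetry would make all members
  distinct, which a finite set forbids.\<close>

lemma linear_order_chain_stabilises:
  assumes "finite Z" "linear_order_on Z r" and chain: "\<And>n :: nat. (s n, s (Suc n)) \<in> r"
  obtains n where "s n = s (Suc n)"
proof (rule ccontr)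
  assume "\<not> thesis"
  then have neq: "s n \<noteq> s (Suc n)" for n using that by blast
  have r: "r \<subseteq> Z \<times> Z" "trans r" "antisym r" using assms(2) by (simp_all add: order_on_defs)
  have le: "(s m, s (Suc m + d)) \<in> r" for m d
  proof (induction d)
    case (Suc d)
    then show ?case using chain[of "Suc m + d"] r(2) by (auto dest: transD)
  qed (simp add: chain)
  have "s m \<noteq> s n" if "m < n" for m n
  proof
    assume eq: "s m = s n"
    obtain d where d: "n = Suc m + d" using \<open>m < n\<close> by (metis Suc_leI le_Suc_ex)
    have "(s (Suc m), s n) \<in> r"
    proof (cases d)
      case 0
      have "s n \<in> Z" using chain[of n] r(1) by auto
      then show ?thesis using 0 d assms(2) by (auto simp: order_on_defs refl_on_def)
    next
      case (Suc d')
      then show ?thesis using le[of "Suc m" d'] d by simp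
    qed
    then show False using chain[of m] neq[of m] eq r(3) by (auto dest: antisymD)
  qed
  then have "inj s" by (metis injI nat_neq_iff)
  moreover have "range s \<subseteq> Z" using chain r(1) by auto
  ultimately show False using assms(1) finite_subset finite_imageD infinite_UNIV_nat by metis
qed

lemma ordered_imp_non_counting:
  assumes "ordered V L" shows "non_counting V L"
proof -
  obtain Z :: "nat set" and z0 F \<delta> r where dfa: "dfa V Z z0 F \<delta>" and L: "L = accepted V z0 F \<delta>"
    and r: "linear_order_on Z r"
    and mono: "\<And>p q w. \<lbrakk>(p, q) \<in> r; w \<in> lists V\<rbrakk> \<Longrightarrow> (foldl \<delta> p w, foldl \<delta> q w) \<in> r"
    using assms by (rule orderedE) blast
  have Z: "finite Z" "z0 \<in> Z" using dfa by (auto simp: dfa_def)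
  show ?thesis
  proof (rule non_countingI)
    show "regular V L" unfolding L by (rule dfa_imp_regular[OF dfa])
    fix x y z assume xyz: "x \<in> lists V" "y \<in> lists V" "z \<in> lists V"
    define s where "s n = foldl \<delta> z0 (x @ word_pow y n)" for n
    have s_Suc: "s (Suc n) = foldl \<delta> (s n) y" for n
      by (simp add: s_def word_pow_Suc' del: word_pow_Suc)
    have "s n \<in> Z" for n unfolding s_def using foldl_closed[OF dfa Z(2), of "x @ word_pow y n"] xyz
      by (simp del: foldl_append)
    then have "(s 0, s 1) \<in> r \<or> (s 1, s 0) \<in> r"
      using r unfolding order_on_defs total_on_def refl_on_def by metis
    \<comment> \<open>Reading \<open>y\<close> is monotone, so the direction of the first move is
      that of all later ones. A descending chain ascends in the converse order.\<close>
    then have "(\<forall>n. (s n, s (Suc n)) \<in> r) \<or> (\<forall>n. (s n, s (Suc n)) \<in> r\<inverse>)"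
    proof
      assume "(s 0, s 1) \<in> r"
      then have "(s n, s (Suc n)) \<in> r" for n
        by (induction n) (simp, metis s_Suc mono xyz(2))
      then show ?thesis by blast
    next
      assume "(s 1, s 0) \<in> r"
      then have "(s (Suc n), s n) \<in> r" for n
        by (induction n) (simp, metis s_Suc mono xyz(2))
      then show ?thesis by blast
    qed
    moreover have "linear_order_on Z (r\<inverse>)" using r by simp
    ultimately obtain N where N: "s N = s (Suc N)"
      using linear_order_chain_stabilises[OF Z(1)] r by metis
    have "s n = s N" if "n \<ge> N" for n
      using that by (induction rule: dec_induct) (use N s_Suc in metis)+
    then have "foldl \<delta> (s n) z = foldl \<delta> (s (Suc n)) z" if "n \<ge> N" for n
      using that by (metis le_SucI)
    then show "\<exists>N. \<forall>n\<ge>N. x @ word_pow y n @ z \<in> L \<longleftrightarrow> x @ word_pow y (Suc n) @ z \<in> L"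
      using xyz by (intro exI[of _ N]) (simp add: L accepted_def s_def)
  qed
qed

lemma list_take_mono:
  fixes xs ys :: "'b::linorder list"
  assumes "xs \<le> ys" shows "take n xs \<le> take n ys"
  using assms
proof (induction n arbitrary: xs ys)
  case (Suc n)
  then show ?case by (cases xs; cases ys) auto
qed simp

text \<open>The automaton remembers the last \<open>n\<close> letters, most recent letter first. Its states are ordered
  lexicographically, so that reading a letter is monotone.\<close>

lemma definite_imp_ordered:
  assumes "finite V" "definite V L" shows "ordered V L"
proof -
  obtain A B where AB: "A \<subseteq> lists V" "finite A" "B \<subseteq> lists V" "finite B" "L = A \<union> lists V @@ B"
    using assms(2) by (auto simp: definite_def)
  \<comment> \<open>As \<open>n\<close> exceeds all lengths in \<open>A\<close> and
    \<open>B\<close>, a word shorter than \<open>n\<close> is stored completely, and any other word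
    can be in \<open>L\<close> only through a suffix in \<open>B\<close>, which is visible in the
    state. \<open>insert 0\<close> covers the case that both sets are empty.\<close>
  define n where "n = Suc (Max (insert 0 (length ` (A \<union> B))))"
  have n: "length w < n" if "w \<in> A \<union> B" for w
    unfolding n_def using that AB(2,4) by (intro le_imp_less_Suc Max_ge) auto
  obtain f :: "'a \<Rightarrow> nat" where inj: "inj_on f V"
    using finite_imp_inj_to_nat_seg[OF assms(1)] by blast
  define st where "st w = take n (rev (map f w))" for w
  define Z where "Z = {s. set s \<subseteq> f ` V \<and> length s \<le> n}"
  define \<delta> where "\<delta> s a = take n (f a # s)" for s a
  have L_lists: "L \<subseteq> lists V" using AB(1,3,5) conc_subset_lists[of "lists V" V B] by auto
  have run: "foldl \<delta> [] w = st w" for w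
  proof (induction w rule: rev_induct)
    case (snoc a w)
    have "take n (f a # take n xs) = take n (f a # xs)" for xs by (cases n) simp_all
    then show ?case using snoc by (simp add: \<delta>_def st_def)
  qed (simp add: st_def)
  have st_Z: "st w \<in> Z" if "w \<in> lists V" for w
    using that set_take_subset[of n "rev (map f w)"] by (auto simp: st_def Z_def)
  have dfa: "dfa V Z [] (st ` L) \<delta>"
    unfolding dfa_def
  proof (intro conjI ballI)
    show "finite Z" unfolding Z_def using assms(1) by (simp add: finite_lists_length_le)
    show "\<delta> z a \<in> Z" if "z \<in> Z" "a \<in> V" for z a
      using that set_take_subset[of n "f a # z"] by (auto simp: Z_def \<delta>_def)
  qed (use st_Z L_lists in \<open>auto simp: Z_def\<close>)
  \<comment> \<open>The accepting states are those reached by words of \<open>L\<close>, so a state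
    has to determine membership.\<close>
  have "w' \<in> L" if eq: "st w = st w'" and w: "w \<in> L" "w' \<in> lists V" for w w'
  proof (cases "length w < n \<or> length w' < n")
    case True
    have "length (st w) = min (length w) n" "length (st w') = min (length w') n" by (simp_all add: st_def min.commute)
    then have "length w < n" "length w' < n" using True eq by auto
    then have "map f w = map f w'" using eq by (simp add: st_def)
    then have "w = w'" using inj w L_lists by (auto intro: map_inj_on[where f = f] inj_on_subset)
    then show ?thesis using w by simp
  next
    case False
    then have "w \<notin> A" using n[of w] by auto
    then obtain u b where b: "w = u @ b" "b \<in> B" using w(1) AB(5) by (auto simp: in_conc)
    then have lb: "length b \<le> n" using n[of b] by simp
    have take_eq: "take (length b) (rev (map f w)) = take (length b) (rev (map f w'))"
      using arg_cong[OF eq, of "take (length b)"] lb by (simp add: st_def min_absorb1)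
    define u' b' where "u' = take (length w' - length b) w'" and "b' = drop (length w' - length b) w'"
    have "map f b' = map f b"
      using take_eq b(1) lb False by (simp add: b'_def take_rev drop_map rev_swap)
    moreover have "b' \<in> lists V" using w(2) set_drop_subset by (fastforce simp: b'_def)
    ultimately have "b' = b"
      using inj b(2) AB(3) by (intro map_inj_on[where f = f]) (auto intro: inj_on_subset)
    moreover have "u' \<in> lists V" using w(2) set_take_subset by (fastforce simp: u'_def)
    moreover have "w' = u' @ b'" by (simp add: u'_def b'_def)
    ultimately show ?thesis using b(2) AB(5) by (auto intro: concI)
  qed
  then have "w \<in> L" if "st w \<in> st ` L" "w \<in> lists V" for w
    using that by (metis imageE)
  then have "accepted V [] (st ` L) \<delta> = L"
    using L_lists unfolding accepted_def run by blast
  moreover have "ordered V (accepted V [] (st ` L) \<delta>)"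
    using dfa by (rule orderedI) (auto simp: \<delta>_def intro!: list_take_mono)
  ultimately show ?thesis by simp
qed

section \<open>The inclusions\<close>

lemma alphabet_letter:
  assumes "alphabet V" obtains a where "a \<in> V"
  using assms by (auto simp: alphabet_def)

lemma regular_letters: "finite X \<Longrightarrow> X \<subseteq> V \<Longrightarrow> regular V ((\<lambda>a. [a]) ` X)"
  by (rule regular_finite) auto

lemma regular_eps: "regular V {[]}"
  by (rule regular_finite) auto

lemma lists_star: "alphabet V \<Longrightarrow> star_language V (lists V)"
  unfolding star_language_def using regular_letters[of V V] star_letters[of V]
  unfolding alphabet_def by blast

lemma monoidal_symmetric_definite: "symmetric_definite V (lists V)"
  unfolding symmetric_definite_def using regular_eps by (intro exI[of _ "{[]}"]) simp

lemma nilpotent_imp_definite: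
  assumes "finite V" "L \<subseteq> lists V" "nilpotent V L" shows "definite V L"
proof (cases "finite L")
  case True
  then show ?thesis unfolding definite_def using assms(2)
    by (intro exI[of _ L] exI[of _ "{}"]) simp
next
  case False
  then have fin: "finite (lists V - L)" using assms(3) by (simp add: nilpotent_def)
  \<comment> \<open>No word of length \<open>n\<close> or more is missing from \<open>L\<close>, so
    beyond the short words in \<open>?A\<close> every suffix of length \<open>n\<close> is
    allowed.\<close>
  define n where "n = Suc (Max (insert 0 (length ` (lists V - L))))"
  have n: "length w < n" if "w \<in> lists V - L" for w
    unfolding n_def using that fin by (intro le_imp_less_Suc Max_ge) auto
  let ?A = "{w \<in> L. length w < n}" and ?B = "{w \<in> lists V. length w = n}"
  have len: "finite {w. set w \<subseteq> V \<and> length w \<le> n}" using assms(1) by (rule finite_lists_length_le)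
  have "L = ?A \<union> lists V @@ ?B"
  proof (intro equalityI subsetI)
    fix w assume w: "w \<in> L"
    show "w \<in> ?A \<union> lists V @@ ?B"
    proof (cases "length w < n")
      case False
      have "set (take (length w - n) w) \<subseteq> V" "set (drop (length w - n) w) \<subseteq> V"
        using w assms(2) set_take_subset set_drop_subset by (fastforce simp: lists_eq_set)+
      then have "take (length w - n) w @ drop (length w - n) w \<in> lists V @@ ?B"
        using False by (intro concI) (auto simp: lists_eq_set)
      then show ?thesis by simp
    qed (use w in simp)
  next
    fix w assume "w \<in> ?A \<union> lists V @@ ?B"
    then show "w \<in> L"
    proof
      assume "w \<in> lists V @@ ?B"
      then have "w \<in> lists V" "\<not> length w < n" by (auto simp: in_conc)
      then show ?thesis using n[of w] by blast
    qed simp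
  qed
  moreover have "finite ?A" "finite ?B"
    using assms(2) by (auto intro!: finite_subset[OF _ len])
  ultimately show ?thesis unfolding definite_def using assms(2)
    by (intro exI[of _ ?A] exI[of _ ?B]) auto
qed

lemma combinational_imp_definite:
  assumes "finite V" "combinational V L" shows "definite V L"
proof -
  obtain X where "X \<subseteq> V" "L = lists V @@ (\<lambda>a. [a]) ` X"
    using assms(2) by (auto simp: combinational_def)
  then show ?thesis unfolding definite_def using finite_subset[OF _ assms(1)]
    by (intro exI[of _ "{}"] exI[of _ "(\<lambda>a. [a]) ` X"]) auto
qed

lemma combinational_imp_symmetric_definite:
  assumes "finite V" "combinational V L" shows "symmetric_definite V L"
proof -
  obtain X where "X \<subseteq> V" "L = lists V @@ (\<lambda>a. [a]) ` X"
    using assms(2) by (auto simp: combinational_def)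
  then show ?thesis unfolding symmetric_definite_def
    using finite_subset[OF _ assms(1)] regular_eps regular_letters[of X V]
    by (intro exI[of _ "{[]}"] exI[of _ "(\<lambda>a. [a]) ` X"]) simp
qed

lemma non_counting_imp_power_separating:
  assumes "non_counting V L" shows "power_separating V L"
proof -
  obtain k where k: "k \<ge> 1" "\<forall>x\<in>lists V. \<forall>y\<in>lists V. \<forall>z\<in>lists V.
      x @ word_pow y k @ z \<in> L \<longleftrightarrow> x @ word_pow y (k + 1) @ z \<in> L"
    using assms unfolding non_counting_def by blast
  have "word_pow x n \<in> L \<longleftrightarrow> word_pow x k \<in> L" if "x \<in> lists V" "n \<ge> k" for x n
    using non_counting_pow[OF k(2), of "[]" x "[]" n k] that by simp
  then show ?thesis unfolding power_separating_def using k(1) by (intro exI[of _ k]) blast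
qed

text \<open>If \<open>x\<^sup>n = u v w\<close> with \<open>u \<in> E\<close> and \<open>w \<in> H\<close>, then every power of \<open>x\<close> with exponent at
  least \<open>2 n\<close> begins with \<open>u\<close> and ends with \<open>w\<close>.\<close>

lemma symmetric_definite_imp_power_separating:
  assumes "regular V L" "symmetric_definite V L" shows "power_separating V L"
proof (rule power_separatingI[OF assms(1)])
  obtain E H where L: "L = E @@ lists V @@ H"
    using assms(2) by (auto simp: symmetric_definite_def)
  fix x assume x: "x \<in> lists V"
  show "\<exists>N. (\<forall>n\<ge>N. word_pow x n \<in> L) \<or> (\<forall>n\<ge>N. word_pow x n \<notin> L)"
  proof (cases "\<exists>n. word_pow x n \<in> L")
    case True
    then obtain n u v w where n: "word_pow x n = u @ v @ w" "u \<in> E" "v \<in> lists V" "w \<in> H"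
      by (auto simp: L in_conc)
    have "u @ v @ w \<in> lists V" using x by (simp flip: n(1))
    then have uw: "u \<in> lists V" "w \<in> lists V" by simp_all
    have "word_pow x m \<in> L" if "m \<ge> 2 * n" for m
    proof -
      have "word_pow x m = word_pow x (n + (m - 2 * n) + n)" using that by simp
      also have "\<dots> = u @ (v @ w @ word_pow x (m - 2 * n) @ u @ v) @ w"
        unfolding word_pow_add n(1) by simp
      also have "\<dots> \<in> L"
        unfolding L using n(2-4) uw x by (intro concI) auto
      finally show ?thesis .
    qed
    then show ?thesis by blast
  qed auto
qed

text \<open>Any \<open>G\<close> that \<open>L\<close> absorbs presents \<open>L\<close> as a comet
  whose other part is \<open>L\<close> itself.\<close>

lemma star_absorb_right:
  assumes "L @@ G \<subseteq> L" shows "L @@ star G = L"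
proof
  have "\<forall>u\<in>L. u @ g \<in> L" if "g \<in> star G" for g
    using that
  proof (induction rule: star_induct)
    case (append g h)
    then show ?case using concI[of _ L g G] assms by (metis append.assoc subsetD)
  qed simp
  then show "L @@ star G \<subseteq> L" by (auto simp: in_conc)
  show "L \<subseteq> L @@ star G" using concI[of _ L "[]" "star G"] by auto
qed

lemma star_absorb_left:
  assumes "G @@ L \<subseteq> L" shows "star G @@ L = L"
proof
  have "\<forall>u\<in>L. g @ u \<in> L" if "g \<in> star G" for g
    using that
  proof (induction rule: star_induct)
    case (append g h)
    then show ?case using concI[of g G _ L] assms by (metis append.assoc subsetD)
  qed simp
  then show "star G @@ L \<subseteq> L" by (auto simp: in_conc)
  show "L \<subseteq> star G @@ L" using concI[of "[]" "star G" _ L] by auto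
qed

lemma lists_conc_lists: "A \<subseteq> lists V \<Longrightarrow> lists V @@ A @@ lists V \<subseteq> lists V"
  by (intro conc_subset_lists) auto

text \<open>Appending a word of \<open>G\<close>, the product of \<open>lists V\<close> and
  \<open>H\<close>, to a word of \<open>L\<close> only enlarges the free middle part, so
  \<open>L\<close> absorbs \<open>G\<close> from the right. A letter of the alphabet gives
  \<open>G\<close> a nonempty word. If \<open>H\<close> is empty, so is \<open>L\<close>, and
  \<open>lists V\<close> serves as \<open>G\<close>. The right-sided case is the mirror
  image.\<close>

lemma symmetric_definite_imp_comet:
  assumes V: "alphabet V" and L: "regular V L" "symmetric_definite V L"
  shows "left_comet V L" and "right_comet V L"
proof -
  obtain E H where EH: "regular V E" "regular V H" "L = E @@ lists V @@ H"
    using L(2) by (auto simp: symmetric_definite_def)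
  obtain a where a: "a \<in> V" using V by (rule alphabet_letter)
  have sub: "E \<subseteq> lists V" "H \<subseteq> lists V" using EH by (simp_all add: regular_subset_lists)
  show "left_comet V L"
  proof (cases "H = {}")
    case True
    have "[a] \<in> lists V" using a by simp
    then have "lists V \<notin> {{}, {[]}}" by blast
    moreover have "L = {} @@ star (lists V)" using True EH(3) by simp
    ultimately show ?thesis unfolding left_comet_def
      using regular_lists regular_finite[of "{}" V] by blast
  next
    case False
    then obtain h where "h \<in> H" by blast
    then have "[a] @ h \<in> lists V @@ H" using a by (intro concI) simp_all
    then have "lists V @@ H \<notin> {{}, {[]}}" by auto
    moreover have "L @@ (lists V @@ H) \<subseteq> L"
      unfolding EH(3) conc_assoc
      using conc_mono[OF subset_refl conc_mono[OF lists_conc_lists[OF sub(2)] subset_refl], of E H]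
      by (simp add: conc_assoc)
    then have "L = L @@ star (lists V @@ H)" by (rule star_absorb_right[symmetric])
    ultimately show ?thesis unfolding left_comet_def
      using L(1) regular_conc[OF regular_lists EH(2)] by blast
  qed
  show "right_comet V L"
  proof (cases "E = {}")
    case True
    have "[a] \<in> lists V" using a by simp
    then have "lists V \<notin> {{}, {[]}}" by blast
    moreover have "L = star (lists V) @@ {}" using True EH(3) by simp
    ultimately show ?thesis unfolding right_comet_def
      using regular_lists regular_finite[of "{}" V] by blast
  next
    case False
    then obtain u where "u \<in> E" by blast
    then have "u @ [a] \<in> E @@ lists V" using a by (intro concI) simp_all
    then have "E @@ lists V \<notin> {{}, {[]}}" by auto
    moreover have "(E @@ lists V) @@ L \<subseteq> L"
      unfolding EH(3) conc_assoc
      using conc_mono[OF subset_refl[of E] conc_mono[OF lists_conc_lists[OF sub(1)] subset_refl[of H]]]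
      by (simp add: conc_assoc)
    then have "L = star (E @@ lists V) @@ L" by (rule star_absorb_left[symmetric])
    ultimately show ?thesis unfolding right_comet_def
      using L(1) regular_conc[OF EH(1) regular_lists] by blast
  qed
qed

lemma left_comet_imp_two_sided: "left_comet V L \<Longrightarrow> two_sided_comet V L"
  unfolding left_comet_def two_sided_comet_def using regular_eps conc_eps(1) by metis

lemma right_comet_imp_two_sided: "right_comet V L \<Longrightarrow> two_sided_comet V L"
  unfolding right_comet_def two_sided_comet_def using regular_eps conc_eps(2) by metis

lemma star_language_imp_union_free:
  "finite V \<Longrightarrow> star_language V L \<Longrightarrow> union_free V L"
  using union_free_star_of_union regular_imp_union_of_union_free
  unfolding star_language_def by blast

lemma mset_rotate [simp]: "mset (rotate n w) = mset w"
proof (induction n)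
  case (Suc n)
  have "mset (rotate1 v) = mset v" for v :: "'a list" by (cases v) simp_all
  then show ?case using Suc by simp
qed simp

lemma commutative_imp_circular: "commutative V L \<Longrightarrow> circular V L"
  unfolding commutative_def circular_def by (metis mset_rotate)

lemma infix_closed_imp_prefix_closed: "infix_closed V L \<Longrightarrow> prefix_closed V L"
  unfolding infix_closed_def prefix_closed_def using append_Nil lists.Nil by metis

lemma infix_closed_imp_suffix_closed: "infix_closed V L \<Longrightarrow> suffix_closed V L"
  unfolding infix_closed_def suffix_closed_def using append_Nil2 lists.Nil by metis

text \<open>The exponents of the powers of \<open>x\<close> that lie in \<open>L\<close> are closed
  downwards, so either all powers are in \<open>L\<close> or none from some exponent on.\<close>

lemma prefix_closed_imp_power_separating:
  assumes "regular V L" "prefix_closed V L" shows "power_separating V L"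
proof (rule power_separatingI[OF assms(1)])
  fix x assume x: "x \<in> lists V"
  have "word_pow x n \<in> L" if "word_pow x (n + d) \<in> L" for n d
    using that assms(2)[unfolded prefix_closed_def, rule_format, of "word_pow x n" "word_pow x d"] x
    by (simp add: word_pow_add)
  then show "\<exists>N. (\<forall>n\<ge>N. word_pow x n \<in> L) \<or> (\<forall>n\<ge>N. word_pow x n \<notin> L)"
    by (metis le_Suc_ex)
qed

lemma suffix_closed_imp_power_separating:
  assumes "regular V L" "suffix_closed V L" shows "power_separating V L"
proof (rule power_separatingI[OF assms(1)])
  fix x assume x: "x \<in> lists V"
  have "word_pow x n \<in> L" if "word_pow x (n + d) \<in> L" for n d
    using that assms(2)[unfolded suffix_closed_def, rule_format, of "word_pow x d" "word_pow x n"] x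
    by (simp add: word_pow_add add.commute[of n])
  then show "\<exists>N. (\<forall>n\<ge>N. word_pow x n \<in> L) \<or> (\<forall>n\<ge>N. word_pow x n \<notin> L)"
    by (metis le_Suc_ex)
qed

lemma regular_family_mono:
  assumes "\<And>V L. \<lbrakk>alphabet V; finite V; regular V L; L \<subseteq> lists V; P V L\<rbrakk> \<Longrightarrow> Q V L"
  shows "regular_family P \<subseteq> regular_family Q"
  unfolding regular_family_def using assms regular_subset_lists unfolding alphabet_def by blast

lemma family_inclusion:
  assumes "(X, Y) \<in> inclusions" shows "(family X :: 'a language_over set) \<subseteq> family Y"
proof -
  have reg: "regular_family P \<subseteq> {(V, L). alphabet V \<and> regular V L}"
    for P :: "'a set \<Rightarrow> 'a list set \<Rightarrow> bool"
    by (auto simp: regular_family_def)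
  have fin: "{(V :: 'a set, L). alphabet V \<and> L \<subseteq> lists V \<and> finite L} \<subseteq> regular_family nilpotent"
    by (auto simp: regular_family_def nilpotent_def regular_finite)
  note imps = lists_star monoidal_symmetric_definite nilpotent_imp_definite
    combinational_imp_definite combinational_imp_symmetric_definite definite_imp_ordered
    ordered_imp_non_counting non_counting_imp_power_separating
    symmetric_definite_imp_comet symmetric_definite_imp_power_separating
    left_comet_imp_two_sided right_comet_imp_two_sided star_language_imp_union_free
    commutative_imp_circular infix_closed_imp_prefix_closed infix_closed_imp_suffix_closed
    prefix_closed_imp_power_separating suffix_closed_imp_power_separating
  have mon: "commutative V (lists V)" "nilpotent V (lists V)" "infix_closed V (lists V)" for V :: "'a set"
    unfolding commutative_def nilpotent_def infix_closed_def lists_eq_set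
    by (auto dest: mset_eq_setD)
  have "\<forall>(X, Y)\<in>inclusions. (family X :: 'a language_over set) \<subseteq> family Y"
    unfolding inclusions_def
    by (simp only: ball_simps prod.case family.simps simp_thms, intro conjI;
      rule reg fin regular_family_mono; simp add: monoidal_def imps mon)
  then show ?thesis using assms by blast
qed

lemma languages_mono:
  assumes "(family X :: 'a language_over set) \<subseteq> family Y"
  shows "(languages X :: 'a list set set) \<subseteq> languages Y"
  using assms unfolding languages_def by blast

section \<open>The separating languages\<close>

lemma infinite_if_unbounded:
  assumes "\<And>n. \<exists>w\<in>L. n < length w" shows "infinite L"
proof
  assume "finite L"
  then have "finite (length ` L)" by simp
  obtain w where "w \<in> L" "Max (length ` L) < length w" using assms by blast
  then show False using Max_ge[OF \<open>finite (length ` L)\<close>, of "length w"] by simp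
qed

lemma star_pair:
  "star {[a, a]} = {w. set w \<subseteq> {a} \<and> even (length w)}"
proof (intro equalityI subsetI)
  fix w assume "w \<in> star {[a, a]}"
  then show "w \<in> {w. set w \<subseteq> {a} \<and> even (length w)}"
    by (induction rule: star_induct) auto
next
  fix w assume w: "w \<in> {w. set w \<subseteq> {a} \<and> even (length w)}"
  then obtain k where k: "length w = 2 * k" by auto
  have "w = replicate (2 * k) a" using w k by (auto intro: replicate_eqI)
  also have "\<dots> = word_pow [a, a] k" by (induction k) auto
  finally show "w \<in> star {[a, a]}" by (simp add: word_pow_in_star)
qed

lemma star_single_letter: "star {[a]} = {w. set w \<subseteq> {a}}"
  using star_letters[of "{a}"] by (auto simp: lists_eq_set)

lemma languagesI: "(V, L) \<in> family X \<Longrightarrow> L \<in> languages X"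
  by (auto simp: languages_def)

lemma regular_singleton: "w \<in> lists V \<Longrightarrow> regular V {w}"
  by (rule regular_finite) auto

lemma alphabet_insert: "alphabet {a}" "alphabet {a, b}" "alphabet {a, b, c}"
  by (simp_all add: alphabet_def)

lemma regular_mem_alphabet: "regular V L \<Longrightarrow> w \<in> L \<Longrightarrow> x \<in> set w \<Longrightarrow> x \<in> V"
  using regular_subset_lists[of V L] by auto

lemmas family_simps = regular_family_def alphabet_insert

text \<open>The powers of \<open>a\<close> alternate between \<open>L\<close> and its
  complement.\<close>

lemma even_powers_separate:
  fixes a :: 'a
  defines "L \<equiv> star {[a, a]}"
  shows "L \<in> languages LCOM" "L \<in> languages RCOM" "L \<in> languages COMM" "L \<in> languages STAR"
    and "L \<notin> languages PS"
proof -
  have g: "regular {a} {[a, a]}" "regular {a} {[]}" by (rule regular_singleton; simp)+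
  have reg: "regular {a} L" unfolding L_def by (rule regular_star[OF g(1)])
  have "left_comet {a} L" unfolding left_comet_def L_def
    using g by (intro exI[of _ "{[]}"] exI[of _ "{[a, a]}"]) auto
  then show "L \<in> languages LCOM"
    using reg by (intro languagesI[of "{a}"]) (simp add: family_simps)
  have "right_comet {a} L" unfolding right_comet_def L_def
    using g by (intro exI[of _ "{[]}"] exI[of _ "{[a, a]}"]) auto
  then show "L \<in> languages RCOM"
    using reg by (intro languagesI[of "{a}"]) (simp add: family_simps)
  have "commutative {a} L" unfolding commutative_def L_def star_pair
    by (auto dest: mset_eq_setD mset_eq_length)
  then show "L \<in> languages COMM"
    using reg by (intro languagesI[of "{a}"]) (simp add: family_simps)
  have "star_language {a} L" unfolding star_language_def L_def using g by blast
  then show "L \<in> languages STAR"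
    using reg by (intro languagesI[of "{a}"]) (simp add: family_simps)
  show "L \<notin> languages PS"
  proof
    assume "L \<in> languages PS"
    then obtain V m where V: "regular V L" and m: "\<forall>x\<in>lists V.
        {word_pow x n | n. n \<ge> m} \<inter> L = {} \<or> {word_pow x n | n. n \<ge> m} \<subseteq> L"
      by (auto simp: languages_def family_simps power_separating_def)
    have "[a, a] \<in> L" by (simp add: L_def star_incl)
    then have "[a] \<in> lists V" using regular_mem_alphabet[OF V] by simp
    with m have "{word_pow [a] n | n. n \<ge> m} \<inter> L = {} \<or> {word_pow [a] n | n. n \<ge> m} \<subseteq> L" by blast
    moreover have "word_pow [a] (2 * m) \<in> {word_pow [a] n | n. n \<ge> m} \<inter> L"
      by (auto simp: L_def star_pair word_pow_single)
    moreover have "word_pow [a] (Suc (2 * m)) \<in> {word_pow [a] n | n. n \<ge> m}"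
      by (intro CollectI exI[of _ "Suc (2 * m)"]) simp
    moreover have "word_pow [a] (Suc (2 * m)) \<notin> L"
      by (simp add: L_def star_pair del: word_pow_Suc)
    ultimately show False by blast
  qed
qed

text \<open>The first \<open>b\<close> ends the block of \<open>a\<close> whose parity is tested,
  and anything may follow it. The free middle part thus does not disturb the counting.\<close>

lemma SYDEF_not_NC:
  fixes a b :: 'a
  assumes "a \<noteq> b"
  defines "L \<equiv> (star {[a, a]} @@ {[b]}) @@ lists {a, b} @@ {[]}"
  shows "L \<in> languages SYDEF" "L \<notin> languages NC"
proof -
  have E: "regular {a, b} (star {[a, a]} @@ {[b]})" "regular {a, b} {[]}"
    by (intro regular_conc regular_star regular_singleton; simp)+
  have "regular {a, b} L"
    unfolding L_def by (rule regular_conc[OF E(1) regular_conc[OF regular_lists E(2)]])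
  moreover have "symmetric_definite {a, b} L"
    unfolding symmetric_definite_def L_def using E by blast
  ultimately show "L \<in> languages SYDEF"
    by (intro languagesI[of "{a, b}"]) (simp add: family_simps)
  have pow: "word_pow [a] n @ [b] \<in> L \<longleftrightarrow> even n" for n
  proof
    assume "even n"
    then have "(word_pow [a] n @ [b]) @ [] @ [] \<in> L"
      unfolding L_def by (intro concI) (auto simp: star_pair word_pow_single)
    then show "word_pow [a] n @ [b] \<in> L" by simp
  next
    assume "word_pow [a] n @ [b] \<in> L"
    then obtain u v where uv: "word_pow [a] n @ [b] = u @ b # v" "u \<in> star {[a, a]}"
      by (auto simp: L_def in_conc)
    then have u: "\<forall>x\<in>set u. x = a" "even (length u)" by (auto simp: star_pair)
    have "takeWhile (\<lambda>x. x = a) (word_pow [a] n @ [b]) = replicate n a"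
      using assms(1) by (induction n) simp_all
    moreover have "takeWhile (\<lambda>x. x = a) (u @ b # v) = u"
      using assms(1) u by (simp add: takeWhile_append2)
    ultimately have "u = replicate n a" using uv(1) by simp
    then show "even n" using u by simp
  qed
  show "L \<notin> languages NC"
  proof
    assume "L \<in> languages NC"
    then obtain V k where V: "regular V L" and k: "\<forall>x\<in>lists V. \<forall>y\<in>lists V. \<forall>z\<in>lists V.
        x @ word_pow y k @ z \<in> L \<longleftrightarrow> x @ word_pow y (k + 1) @ z \<in> L"
      by (auto simp: languages_def family_simps non_counting_def)
    have "word_pow [a] 2 @ [b] \<in> L" by (simp only: pow even_two_times_div_two) simp
    then have "[] \<in> lists V" "[a] \<in> lists V" "[b] \<in> lists V"
      using regular_mem_alphabet[OF V] by (auto simp: word_pow_single)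
    then show False using k pow[of k] pow[of "k + 1"] by (metis append_Nil even_Suc Suc_eq_plus1)
  qed
qed

lemma infix_closed_avoiding: "infix_closed V (lists V - lists V @@ K @@ lists V)"
  unfolding infix_closed_def
proof (intro ballI impI)
  fix x y z assume "x \<in> lists V" "y \<in> lists V" "z \<in> lists V"
    and L: "x @ y @ z \<in> lists V - lists V @@ K @@ lists V"
  have False if "y \<in> lists V @@ K @@ lists V"
  proof -
    from that obtain u k v where "y = u @ k @ v" "u \<in> lists V" "k \<in> K" "v \<in> lists V"
      unfolding in_conc by blast
    moreover from this have "(x @ u) @ k @ (v @ z) \<in> lists V @@ K @@ lists V"
      using \<open>x \<in> lists V\<close> \<open>z \<in> lists V\<close> by (intro concI) simp_all
    ultimately show False using L by simp
  qed
  then show "y \<in> lists V - lists V @@ K @@ lists V" using \<open>y \<in> lists V\<close> by blast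
qed

text \<open>The words of \<open>K\<close> are the odd blocks of \<open>a\<close> enclosed in two
  \<open>b\<close>. Forbidding them as infixes gives an infix-closed language that still tests the
  parity of a block.\<close>

lemma INFC_not_NC:
  fixes a b :: 'a
  assumes "a \<noteq> b"
  defines "K \<equiv> {[b, a]} @@ star {[a, a]} @@ {[b]}"
  defines "L \<equiv> lists {a, b} - lists {a, b} @@ K @@ lists {a, b}"
  shows "L \<in> languages INFC" "L \<notin> languages NC"
proof -
  have "regular {a, b} K"
    unfolding K_def by (intro regular_conc regular_star regular_singleton; simp)
  then have "regular {a, b} L"
    unfolding L_def by (intro regular_Compl regular_conc regular_lists)
  then show "L \<in> languages INFC"
    using infix_closed_avoiding[of "{a, b}" K]
    by (intro languagesI[of "{a, b}"]) (simp add: family_simps L_def)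
  have pow: "[b] @ word_pow [a] n @ [b] \<in> L \<longleftrightarrow> even n" for n
  proof
    assume "even n"
    have False if mem: "[b] @ word_pow [a] n @ [b] \<in> lists {a, b} @@ K @@ lists {a, b}"
    proof -
      obtain x u z where eq: "b # replicate n a @ [b] = x @ b # a # u @ b # z" "u \<in> star {[a, a]}"
        using mem by (auto simp: in_conc K_def word_pow_single)
      \<comment> \<open>An infix from \<open>K\<close> uses both occurrences of \<open>b\<close>,
        which are the end letters, so it is the whole word.\<close>
      have "count (mset (b # replicate n a @ [b])) b = 2" using assms(1) by simp
      then have "count (mset x) b + count (mset u) b + count (mset z) b = 0"
        unfolding eq(1) using assms(1) by simp
      then have "b \<notin> set x" "b \<notin> set z" by (simp_all add: count_eq_zero_iff)
      then have "x = []" using eq(1) by (cases x) auto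
      moreover have "last (b # replicate n a @ [b]) = b" by simp
      then have "z = []" unfolding eq(1) using \<open>b \<notin> set z\<close> by (cases z rule: rev_cases) auto
      ultimately have "replicate n a = a # u" using eq(1) by simp
      then have "n = Suc (length u)" by (metis length_Cons length_replicate)
      then show False using \<open>even n\<close> eq(2) by (simp add: star_pair)
    qed
    then show "[b] @ word_pow [a] n @ [b] \<in> L" by (auto simp: L_def word_pow_single)
  next
    assume L: "[b] @ word_pow [a] n @ [b] \<in> L"
    show "even n"
    proof (rule ccontr)
      assume "odd n"
      then obtain j where n: "n = Suc (2 * j)" by (auto elim: oddE)
      have "[] @ ([b, a] @ word_pow [a] (2 * j) @ [b]) @ [] \<in> lists {a, b} @@ K @@ lists {a, b}"
        unfolding K_def by (intro concI) (auto simp: star_pair word_pow_single)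
      then show False using L by (simp add: n L_def)
    qed
  qed
  show "L \<notin> languages NC"
  proof
    assume "L \<in> languages NC"
    then obtain V k where V: "regular V L" and k: "\<forall>x\<in>lists V. \<forall>y\<in>lists V. \<forall>z\<in>lists V.
        x @ word_pow y k @ z \<in> L \<longleftrightarrow> x @ word_pow y (k + 1) @ z \<in> L"
      by (auto simp: languages_def family_simps non_counting_def)
    have "[b] @ word_pow [a] 2 @ [b] \<in> L" by (simp only: pow) simp
    then have "[a] \<in> lists V" "[b] \<in> lists V"
      using regular_mem_alphabet[OF V] by (auto simp: word_pow_single)
    then show False using k pow[of k] pow[of "k + 1"] by (metis even_Suc Suc_eq_plus1)
  qed
qed

text \<open>In an ordered automaton every letter moves the start state up or down. If two letters \<open>x\<close> and
  \<open>y\<close> move it in the same direction, then prepending them alternately to a word moves the state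
  that is reached in this direction, hence from some point on this state does not change although
  the first letter of the word does. Among three letters two move the start state in the same
  direction.\<close>

lemma NC_not_ORD:
  fixes a b c :: 'a
  assumes abc: "a \<noteq> b" "a \<noteq> c" "b \<noteq> c"
  defines "V \<equiv> {a, b, c}"
  defines "L \<equiv> {w \<in> lists V. w \<noteq> [] \<and> hd w = last w}"
  shows "L \<in> languages NC" "L \<notin> languages ORD"
proof -
  let ?M = "\<lambda>x. {[x]} \<union> {[x]} @@ lists V @@ {[x]}"
  have eq: "L = ?M a \<union> ?M b \<union> ?M c"
  proof (intro equalityI subsetI)
    fix w assume w: "w \<in> L"
    then obtain x v where x: "w = x # v" "x \<in> V" "v \<in> lists V" by (cases w) (auto simp: L_def)
    have "w \<in> ?M x"
    proof (cases v rule: rev_cases)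
      case (snoc u y)
      then have "w = [x] @ u @ [x]" "u \<in> lists V" using w x by (auto simp: L_def)
      then show ?thesis by (simp add: in_conc)
    qed (use x in simp)
    then show "w \<in> ?M a \<union> ?M b \<union> ?M c" using x(2) by (auto simp: V_def)
  next
    have "w \<in> L" if "w \<in> ?M x" "x \<in> V" for w x
      using that by (auto simp: L_def in_conc)
    then show "w \<in> L" if "w \<in> ?M a \<union> ?M b \<union> ?M c" for w using that unfolding V_def by blast
  qed
  have M: "regular V (?M x)" if "x \<in> V" for x
    using that by (intro regular_Un regular_conc regular_singleton regular_lists) simp_all
  have reg: "regular V L"
    unfolding eq by (rule regular_Un[OF regular_Un[OF M M] M]) (simp_all add: V_def)
  have "non_counting V L"
  proof (rule non_countingI[OF reg])
    fix x y z assume xyz: "x \<in> lists V" "y \<in> lists V" "z \<in> lists V"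
    \<comment> \<open>If \<open>y\<close> is not empty, the first and the last letter of
      \<open>x @ word_pow y n @ z\<close> are the same for all \<open>n \<ge> 1\<close>.\<close>
    have "x @ word_pow y n @ z \<in> L \<longleftrightarrow> x @ word_pow y (Suc n) @ z \<in> L" if n: "n \<ge> 1" for n
    proof (cases "y = []")
      case True
      then show ?thesis by simp
    next
      case False
      obtain m where m: "n = Suc m" using n by (cases n) auto
      have hd: "hd (x @ word_pow y (Suc k) @ z) = hd (x @ y)" for k
        using False by (cases x) simp_all
      have last: "last (x @ word_pow y (Suc k) @ z) = last (y @ z)" for k
        using False by (cases z rule: rev_cases) (simp_all add: word_pow_Suc' del: word_pow_Suc)
      show ?thesis unfolding L_def m using xyz False
        by (simp only: mem_Collect_eq hd last) simp
    qed
    then show "\<exists>N. \<forall>n\<ge>N. x @ word_pow y n @ z \<in> L \<longleftrightarrow> x @ word_pow y (Suc n) @ z \<in> L" by blast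
  qed
  then show "L \<in> languages NC" using reg
    by (intro languagesI[of V]) (simp add: family_simps V_def)
  show "L \<notin> languages ORD"
  proof
    assume "L \<in> languages ORD"
    then obtain V' where "ordered V' L" and V': "regular V' L" by (auto simp: languages_def family_simps)
    then obtain Z :: "nat set" and z0 F \<delta> r where dfa: "dfa V' Z z0 F \<delta>" and acc: "L = accepted V' z0 F \<delta>"
      and r: "linear_order_on Z r"
      and mono: "\<And>p q w. \<lbrakk>(p, q) \<in> r; w \<in> lists V'\<rbrakk> \<Longrightarrow> (foldl \<delta> p w, foldl \<delta> q w) \<in> r"
      by (auto elim: orderedE)
    have Z: "finite Z" "z0 \<in> Z" using dfa by (auto simp: dfa_def)
    have "[x] \<in> L" if "x \<in> V" for x using that by (simp add: L_def)
    then have VV': "V \<subseteq> V'" using regular_mem_alphabet[OF V'] by force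
    have clash: False
      if R: "linear_order_on Z R" "\<And>p q w. \<lbrakk>(p, q) \<in> R; w \<in> lists V'\<rbrakk> \<Longrightarrow> (foldl \<delta> p w, foldl \<delta> q w) \<in> R"
        and xy: "x \<in> V" "y \<in> V" "x \<noteq> y" "(z0, \<delta> z0 x) \<in> R" "(z0, \<delta> z0 y) \<in> R" for R x y
    proof -
      \<comment> \<open>These words end in \<open>x\<close> and begin alternately with
        \<open>x\<close> and \<open>y\<close>, so \<open>w n\<close> is in \<open>L\<close> exactly
        for even \<open>n\<close>.\<close>
      define w where "w = rec_nat [x] (\<lambda>n v. (if even n then y else x) # v)"
      have w_simps: "w 0 = [x]" "w (Suc n) = (if even n then y else x) # w n" for n
        by (simp_all add: w_def)
      have w: "w n \<in> lists V \<and> w n \<noteq> [] \<and> last (w n) = x \<and> hd (w n) = (if even n then x else y)" for n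
        by (induction n) (use xy in \<open>auto simp: w_simps\<close>)
      have wV': "w n \<in> lists V'" for n using w[of n] VV' lists_mono by blast
      have "(foldl \<delta> z0 (w n), foldl \<delta> z0 (w (Suc n))) \<in> R" for n
        using R(2)[OF xy(4) wV'] R(2)[OF xy(5) wV'] by (simp add: w_simps)
      then obtain n where "foldl \<delta> z0 (w n) = foldl \<delta> z0 (w (Suc n))"
        using linear_order_chain_stabilises[OF Z(1) R(1), of "\<lambda>n. foldl \<delta> z0 (w n)"] by blast
      then have "w n \<in> L \<longleftrightarrow> w (Suc n) \<in> L" using wV' by (simp add: acc accepted_def)
      moreover have "w n \<in> L \<longleftrightarrow> even n" for n using w[of n] xy(3) by (auto simp: L_def)
      ultimately show False by simp
    qed
    have "(z0, \<delta> z0 x) \<in> r \<or> (z0, \<delta> z0 x) \<in> r\<inverse>" if "x \<in> V" for x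
    proof -
      have "\<delta> z0 x \<in> Z" using that dfa VV' by (auto simp: dfa_def)
      then show ?thesis using r Z(2) unfolding order_on_defs total_on_def refl_on_def by (metis converseI)
    qed
    then obtain x y where "x \<in> V" "y \<in> V" "x \<noteq> y"
      "(z0, \<delta> z0 x) \<in> r \<and> (z0, \<delta> z0 y) \<in> r \<or> (z0, \<delta> z0 x) \<in> r\<inverse> \<and> (z0, \<delta> z0 y) \<in> r\<inverse>"
      using abc unfolding V_def by (metis insertCI)
    moreover have "linear_order_on Z (r\<inverse>)" using r by simp
    moreover have "(foldl \<delta> p w, foldl \<delta> q w) \<in> r\<inverse>" if "(p, q) \<in> r\<inverse>" "w \<in> lists V'" for p q w
      using that mono by simp
    ultimately show False using clash[OF r mono] clash[of "r\<inverse>"] by metis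
  qed
qed

text \<open>An infinite definite language contains every left extension of some word, including one
  that begins with \<open>b\<close>.\<close>

lemma ORD_not_DEF:
  fixes a b :: 'a
  assumes "a \<noteq> b"
  defines "L \<equiv> {[a]} @@ lists {a, b}"
  shows "L \<in> languages ORD" "L \<notin> languages DEF"
proof -
  \<comment> \<open>The start state 1 lies between the rejecting sink 0 and the accepting sink 2,
    which makes both letters monotone.\<close>
  let ?\<delta> = "\<lambda>z x. if z = 1 then (if x = a then 2 else 0) else z :: nat"
  have dfa: "dfa {a, b} {0, 1, 2} 1 {2} ?\<delta>" by (auto simp: dfa_def)
  have stay: "foldl ?\<delta> z w = z" if "z \<noteq> 1" for z w
    using that by (induction w) (simp_all del: One_nat_def)
  have "accepted {a, b} 1 {2} ?\<delta> = L"
  proof (intro equalityI subsetI)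
    fix w assume w: "w \<in> accepted {a, b} 1 {2} ?\<delta>"
    then obtain x v where x: "w = x # v" by (cases w) (auto simp: accepted_def)
    then have "foldl ?\<delta> (if x = a then 2 else 0) v = 2" using w by (simp add: accepted_def)
    then have "x = a" using stay[of 0 v] by (auto simp del: One_nat_def split: if_splits)
    then show "w \<in> L" using w x by (simp add: L_def in_conc accepted_def)
  next
    fix w assume "w \<in> L"
    then show "w \<in> accepted {a, b} 1 {2} ?\<delta>"
      using stay[of 2] by (auto simp: L_def in_conc accepted_def)
  qed
  moreover have "ordered {a, b} (accepted {a, b} 1 {2} ?\<delta>)"
    by (rule orderedI[OF dfa]) auto
  ultimately show "L \<in> languages ORD"
    using dfa_imp_regular[OF dfa] by (intro languagesI[of "{a, b}"]) (simp add: family_simps)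
  show "L \<notin> languages DEF"
  proof
    assume "L \<in> languages DEF"
    then obtain V A B where V: "regular V L" and AB: "finite A" "B \<subseteq> lists V" "L = A \<union> lists V @@ B"
      by (auto simp: languages_def family_simps definite_def)
    have "\<exists>w\<in>L. n < length w" for n
      by (intro bexI[of _ "[a] @ replicate n a"]) (auto simp: L_def in_conc)
    then have "infinite L" by (rule infinite_if_unbounded)
    then obtain w where w: "w \<in> B" using AB by fastforce
    have "[a] @ [b] \<in> L" unfolding L_def by (intro concI) simp_all
    then have "[b] \<in> lists V" using regular_mem_alphabet[OF V] by auto
    then have "[b] @ w \<in> L" using AB(3) concI[OF _ w] by blast
    then show False using assms(1) by (auto simp: L_def in_conc)
  qed
qed

text \<open>\<open>[b, a]\<close> belongs to \<open>L\<close>, but its prefix \<open>[b]\<close>,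
  its suffix \<open>[]\<close> and its rotation \<open>[a, b]\<close> do not; moreover
  \<open>L\<close> and its complement are both infinite.\<close>

lemma last_letter_separates:
  fixes a b :: 'a
  assumes "a \<noteq> b"
  defines "L \<equiv> lists {a, b} @@ {[a]}"
  shows "L \<in> languages COMB"
    and "L \<notin> languages NIL" "L \<notin> languages PRE" "L \<notin> languages SUF" "L \<notin> languages CIRC"
proof -
  have "regular {a, b} L" unfolding L_def by (intro regular_conc regular_singleton) simp_all
  moreover have "combinational {a, b} L"
    unfolding combinational_def L_def by (intro exI[of _ "{a}"]) simp
  ultimately show "L \<in> languages COMB"
    by (intro languagesI[of "{a, b}"]) (simp add: family_simps)
  have "[b] @ [a] \<in> L" unfolding L_def by (intro concI) simp_all
  then have ba: "[b, a] \<in> L" by simp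
  have V: "a \<in> V" "b \<in> V" if "regular V L" for V using regular_mem_alphabet[OF that ba] by simp_all
  have notin: "w \<notin> L" if "w = [] \<or> last w = b" for w
    using that assms(1) by (auto simp: L_def in_conc)
  show "L \<notin> languages NIL"
  proof
    assume "L \<in> languages NIL"
    then obtain V' where V': "regular V' L" and nil: "nilpotent V' L"
      by (auto simp: languages_def family_simps)
    have "\<exists>w\<in>L. n < length w" for n
      by (intro bexI[of _ "replicate n a @ [a]"]) (auto simp: L_def intro!: concI)
    then have "infinite L" by (rule infinite_if_unbounded)
    moreover have "\<exists>w\<in>lists V' - L. n < length w" for n
      using notin[of "replicate (Suc n) b"] V[OF V'] by (intro bexI[of _ "replicate (Suc n) b"]) auto
    then have "infinite (lists V' - L)" by (rule infinite_if_unbounded)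
    ultimately show False using nil by (simp add: nilpotent_def)
  qed
  show "L \<notin> languages PRE"
  proof
    assume "L \<in> languages PRE"
    then obtain V' where V': "regular V' L" and pre: "prefix_closed V' L"
      by (auto simp: languages_def family_simps)
    have "[b] \<in> L" using pre[unfolded prefix_closed_def, rule_format, of "[b]" "[a]"] V[OF V'] ba by simp
    then show False using notin by simp
  qed
  show "L \<notin> languages SUF"
  proof
    assume "L \<in> languages SUF"
    then obtain V' where V': "regular V' L" and suf: "suffix_closed V' L"
      by (auto simp: languages_def family_simps)
    have "[] \<in> L" using suf[unfolded suffix_closed_def, rule_format, of "[b, a]" "[]"] V[OF V'] ba by simp
    then show False using notin by simp
  qed
  show "L \<notin> languages CIRC"
  proof
    assume "L \<in> languages CIRC"
    then have "\<forall>w\<in>L. \<forall>n. rotate n w \<in> L" by (auto simp: languages_def family_simps circular_def)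
    with ba have "rotate 1 [b, a] \<in> L" by blast
    then show False using notin by simp
  qed
qed

lemma MON_not_FIN_COMB:
  fixes a :: 'a
  defines "L \<equiv> lists {a}"
  shows "L \<in> languages MON" "L \<notin> languages FIN" "L \<notin> languages COMB"
proof -
  show "L \<in> languages MON"
    by (intro languagesI[of "{a}"]) (simp add: family_simps monoidal_def L_def)
  have "\<exists>w\<in>L. n < length w" for n by (intro bexI[of _ "replicate (Suc n) a"]) (auto simp: L_def)
  then have "infinite L" by (rule infinite_if_unbounded)
  then show "L \<notin> languages FIN" by (auto simp: languages_def)
  have "[] \<in> L" by (simp add: L_def)
  then show "L \<notin> languages COMB"
    by (auto simp: languages_def family_simps combinational_def in_conc)
qed

text \<open>If \<open>E\<close> and \<open>H\<close> have words \<open>u\<close> and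
  \<open>v\<close>, then a nonempty \<open>g\<close> in \<open>G\<close> puts the nonempty word
  \<open>u @ g @ v\<close> into the comet.\<close>

lemma empty_word_separates:
  "({[]} :: 'a list set) \<in> languages FIN" "({[]} :: 'a list set) \<in> languages INFC"
  "({[]} :: 'a list set) \<in> languages COMM" "({[]} :: 'a list set) \<in> languages STAR"
  "({[]} :: 'a list set) \<notin> languages TWOCOM"
proof -
  have reg: "regular {a} {[]}" for a :: 'a by (rule regular_eps)
  show "({[]} :: 'a list set) \<in> languages FIN" "({[]} :: 'a list set) \<in> languages INFC"
    "({[]} :: 'a list set) \<in> languages COMM"
    using reg by (intro languagesI[of "{a}" for a];
        auto simp: family_simps infix_closed_def commutative_def)+
  have "star_language {a} {[]}" for a :: 'a
    unfolding star_language_def using regular_finite[of "{}" "{a}"] by (intro exI[of _ "{}"]) simp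
  then show "({[]} :: 'a list set) \<in> languages STAR"
    using reg by (intro languagesI[of "{a}" for a]) (simp add: family_simps)
  show "({[]} :: 'a list set) \<notin> languages TWOCOM"
  proof
    assume "({[]} :: 'a list set) \<in> languages TWOCOM"
    then obtain E G H :: "'a list set" where EGH: "G \<notin> {{}, {[]}}" "{[]} = E @@ star G @@ H"
      unfolding languages_def family.simps regular_family_def two_sided_comet_def by blast
    then obtain g where g: "g \<in> G" "g \<noteq> []" by blast
    have "[] \<in> E @@ star G @@ H" using EGH(2) by blast
    then obtain u v where "u \<in> E" "v \<in> H" unfolding in_conc by blast
    then have "u @ g @ v \<in> {[]}" unfolding EGH(2) using star_incl[OF g(1)] by (intro concI)
    then show False using g(2) by simp
  qed
qed

text \<open>For \<open>u\<close> in \<open>E\<close> and a nonempty \<open>g\<close> in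
  \<open>G\<close>, both \<open>u\<close> and \<open>u @ g\<close> contain exactly one
  \<open>b\<close> and end in it, so \<open>g\<close> would end in \<open>b\<close> without
  containing it.\<close>

lemma RCOM_not_LCOM:
  fixes a b :: 'a
  assumes "a \<noteq> b"
  defines "L \<equiv> star {[a]} @@ {[b]}"
  shows "L \<in> languages RCOM" "L \<notin> languages LCOM"
proof -
  have g: "regular {a, b} {[a]}" "regular {a, b} {[b]}" by (rule regular_singleton; simp)+
  then have "regular {a, b} L" unfolding L_def by (intro regular_conc regular_star)
  moreover have "right_comet {a, b} L" unfolding right_comet_def L_def
    using g by (intro exI[of _ "{[a]}"] exI[of _ "{[b]}"]) auto
  ultimately show "L \<in> languages RCOM"
    by (intro languagesI[of "{a, b}"]) (simp add: family_simps)
  have L: "w \<noteq> [] \<and> last w = b \<and> count (mset w) b = 1" if "w \<in> L" for w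
    using that assms(1) by (auto simp: L_def in_conc star_single_letter count_eq_zero_iff)
  show "L \<notin> languages LCOM"
  proof
    assume "L \<in> languages LCOM"
    then obtain E G where EG: "G \<notin> {{}, {[]}}" "L = E @@ star G"
      by (auto simp: languages_def family_simps left_comet_def)
    then obtain g where g: "g \<in> G" "g \<noteq> []" by blast
    have "[] @ [b] \<in> L" unfolding L_def by (intro concI) simp_all
    then obtain u where u: "u \<in> E" unfolding EG(2) in_conc by blast
    have "u @ [] \<in> L" "u @ g \<in> L" unfolding EG(2)
      using concI[OF u star_Nil] concI[OF u star_incl[OF g(1)]] by simp_all
    then have "count (mset u) b = 1" "last (u @ g) = b" "count (mset (u @ g)) b = 1"
      using L by fastforce+
    then have "last g = b" "count (mset g) b = 0" using g(2) by simp_all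
    then show False using last_in_set[OF g(2)] by (simp add: count_eq_zero_iff)
  qed
qed

lemma LCOM_not_RCOM:
  fixes a b :: 'a
  assumes "a \<noteq> b"
  defines "L \<equiv> {[b]} @@ star {[a]}"
  shows "L \<in> languages LCOM" "L \<notin> languages RCOM"
proof -
  have g: "regular {a, b} {[a]}" "regular {a, b} {[b]}" by (rule regular_singleton; simp)+
  then have "regular {a, b} L" unfolding L_def by (intro regular_conc regular_star)
  moreover have "left_comet {a, b} L" unfolding left_comet_def L_def
    using g by (intro exI[of _ "{[b]}"] exI[of _ "{[a]}"]) auto
  ultimately show "L \<in> languages LCOM"
    by (intro languagesI[of "{a, b}"]) (simp add: family_simps)
  have L: "hd w = b \<and> count (mset w) b = 1" if "w \<in> L" for w
    using that assms(1) by (auto simp: L_def in_conc star_single_letter count_eq_zero_iff)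
  show "L \<notin> languages RCOM"
  proof
    assume "L \<in> languages RCOM"
    then obtain G H where GH: "G \<notin> {{}, {[]}}" "L = star G @@ H"
      by (auto simp: languages_def family_simps right_comet_def)
    then obtain g where g: "g \<in> G" "g \<noteq> []" by blast
    have "[b] @ [] \<in> L" unfolding L_def by (intro concI) simp_all
    then obtain u where u: "u \<in> H" unfolding GH(2) in_conc by blast
    have "[] @ u \<in> L" "g @ u \<in> L" unfolding GH(2)
      using concI[OF star_Nil u] concI[OF star_incl[OF g(1)] u] by simp_all
    then have "count (mset u) b = 1" "hd (g @ u) = b" "count (mset (g @ u)) b = 1"
      using L by fastforce+
    then have "hd g = b" "count (mset g) b = 0" using g(2) by simp_all
    then show False using list.set_sel(1)[OF g(2)] by (simp add: count_eq_zero_iff)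
  qed
qed

lemma one_letter_separates:
  fixes a :: 'a
  defines "L \<equiv> {[a]}"
  shows "L \<in> languages FIN" "L \<in> languages UF"
    and "L \<notin> languages PRE" "L \<notin> languages SUF" "L \<notin> languages STAR"
proof -
  show "L \<in> languages FIN" by (intro languagesI[of "{a}"]) (simp add: family_simps L_def)
  show "L \<in> languages UF"
    by (intro languagesI[of "{a}"]) (simp add: family_simps L_def union_free_letter regular_singleton)
  have V: "[a] \<in> lists V" if "regular V L" for V
    using regular_mem_alphabet[OF that, of "[a]" a] by (simp add: L_def)
  show "L \<notin> languages PRE"
  proof
    assume "L \<in> languages PRE"
    then obtain V where "regular V L" "prefix_closed V L" by (auto simp: languages_def family_simps)
    then have "[] \<in> L"
      using V unfolding prefix_closed_def by (metis L_def append_Nil insertI1 lists.Nil)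
    then show False by (simp add: L_def)
  qed
  show "L \<notin> languages SUF"
  proof
    assume "L \<in> languages SUF"
    then obtain V where "regular V L" "suffix_closed V L" by (auto simp: languages_def family_simps)
    then have "[] \<in> L"
      using V unfolding suffix_closed_def by (metis L_def append_Nil2 insertI1 lists.Nil)
    then show False by (simp add: L_def)
  qed
  have "[] \<notin> L" by (simp add: L_def)
  then show "L \<notin> languages STAR" by (auto simp: languages_def family_simps star_language_def)
qed

lemma SUF_not_PRE:
  fixes a b :: 'a
  assumes "a \<noteq> b"
  defines "L \<equiv> {[], [b], [a, b]}"
  shows "L \<in> languages SUF" "L \<notin> languages PRE"
proof -
  have "suffix_closed {a, b} L"
    unfolding suffix_closed_def L_def by (auto simp: append_eq_Cons_conv)
  moreover have "regular {a, b} L" unfolding L_def by (rule regular_finite) auto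
  ultimately show "L \<in> languages SUF" by (intro languagesI[of "{a, b}"]) (simp add: family_simps)
  show "L \<notin> languages PRE"
  proof
    assume "L \<in> languages PRE"
    then obtain V where V: "regular V L" and pre: "prefix_closed V L"
      by (auto simp: languages_def family_simps)
    have "[a, b] \<in> L" by (simp add: L_def)
    then have "[a] \<in> L"
      using pre[unfolded prefix_closed_def, rule_format, of "[a]" "[b]"] regular_mem_alphabet[OF V] by simp
    then show False using assms(1) by (simp add: L_def)
  qed
qed

lemma PRE_not_SUF:
  fixes a b :: 'a
  assumes "a \<noteq> b"
  defines "L \<equiv> {[], [a], [a, b]}"
  shows "L \<in> languages PRE" "L \<notin> languages SUF"
proof -
  have "prefix_closed {a, b} L"
    unfolding prefix_closed_def L_def by (auto simp: append_eq_Cons_conv)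
  moreover have "regular {a, b} L" unfolding L_def by (rule regular_finite) auto
  ultimately show "L \<in> languages PRE" by (intro languagesI[of "{a, b}"]) (simp add: family_simps)
  show "L \<notin> languages SUF"
  proof
    assume "L \<in> languages SUF"
    then obtain V where V: "regular V L" and suf: "suffix_closed V L"
      by (auto simp: languages_def family_simps)
    have "[a, b] \<in> L" by (simp add: L_def)
    then have "[b] \<in> L"
      using suf[unfolded suffix_closed_def, rule_format, of "[a]" "[b]"] regular_mem_alphabet[OF V] by simp
    then show False using assms(1) by (simp add: L_def)
  qed
qed

lemma infixes_of_two_letters_separate:
  fixes a b :: 'a
  assumes "a \<noteq> b"
  defines "L \<equiv> {[], [a], [b], [a, b]}"
  shows "L \<in> languages FIN" "L \<in> languages INFC" "L \<notin> languages CIRC"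
proof -
  show "L \<in> languages FIN" by (intro languagesI[of "{a, b}"]) (auto simp: family_simps L_def)
  have "infix_closed {a, b} L"
    unfolding infix_closed_def L_def by (auto simp: append_eq_Cons_conv)
  moreover have "regular {a, b} L" unfolding L_def by (rule regular_finite) auto
  ultimately show "L \<in> languages INFC" by (intro languagesI[of "{a, b}"]) (simp add: family_simps)
  show "L \<notin> languages CIRC"
  proof
    assume "L \<in> languages CIRC"
    then have "\<forall>w\<in>L. \<forall>n. rotate n w \<in> L" by (auto simp: languages_def family_simps circular_def)
    moreover have "[a, b] \<in> L" by (simp add: L_def)
    ultimately have "rotate 1 [a, b] \<in> L" by blast
    then show False using assms(1) by (simp add: L_def)
  qed
qed

lemma STAR_not_CIRC:
  fixes a b :: 'a
  assumes "a \<noteq> b"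
  defines "L \<equiv> star {[a, b]}"
  shows "L \<in> languages STAR" "L \<notin> languages CIRC"
proof -
  have g: "regular {a, b} {[a, b]}" by (rule regular_singleton) simp
  then show "L \<in> languages STAR" unfolding L_def
    by (intro languagesI[of "{a, b}"]) (auto simp: family_simps star_language_def intro: regular_star)
  have "w = [] \<or> hd w = a" if "w \<in> L" for w
    using that unfolding L_def by (induction rule: star_induct) auto
  then have "[b, a] \<notin> L" using assms(1) by fastforce
  moreover have "[a, b] \<in> L" by (simp add: L_def star_incl)
  ultimately have "rotate 1 [a, b] \<notin> L" "[a, b] \<in> L" by simp_all
  then have "\<not> (\<forall>w\<in>L. \<forall>n. rotate n w \<in> L)" by blast
  then show "L \<notin> languages CIRC" by (auto simp: languages_def family_simps circular_def)
qed

lemma CIRC_not_COMM: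
  fixes a b c :: 'a
  assumes "a \<noteq> b" "a \<noteq> c" "b \<noteq> c"
  defines "L \<equiv> {[a, b, c], [b, c, a], [c, a, b]}"
  shows "L \<in> languages CIRC" "L \<notin> languages COMM"
proof -
  have "rotate1 w \<in> L" if "w \<in> L" for w using that by (auto simp: L_def)
  then have "rotate n w \<in> L" if "w \<in> L" for n w
    using that by (induction n) simp_all
  then have "circular {a, b, c} L" by (simp add: circular_def)
  moreover have "regular {a, b, c} L" unfolding L_def by (rule regular_finite) auto
  ultimately show "L \<in> languages CIRC" by (intro languagesI[of "{a, b, c}"]) (simp add: family_simps)
  have "mset [b, a, c] = mset [a, b, c]" "[a, b, c] \<in> L" by (simp_all add: L_def)
  moreover have "[b, a, c] \<notin> L" using assms(1-3) by (simp add: L_def)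
  ultimately have "\<not> (\<forall>w\<in>L. \<forall>w'. mset w' = mset w \<longrightarrow> w' \<in> L)" by blast
  then show "L \<notin> languages COMM" by (auto simp: languages_def family_simps commutative_def)
qed

lemma two_word_language_separates:
  fixes a :: 'a
  defines "L \<equiv> {[], [a]}"
  shows "L \<in> languages FIN" "L \<in> languages INFC" "L \<in> languages COMM" "L \<notin> languages UF"
proof -
  have reg: "regular {a} L" unfolding L_def by (rule regular_finite) auto
  show "L \<in> languages FIN" by (intro languagesI[of "{a}"]) (auto simp: family_simps L_def)
  have "infix_closed {a} L"
    unfolding infix_closed_def L_def by (auto simp: append_eq_Cons_conv)
  then show "L \<in> languages INFC" using reg by (intro languagesI[of "{a}"]) (simp add: family_simps)
  have "commutative {a} L" unfolding commutative_def L_def by auto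
  then show "L \<in> languages COMM" using reg by (intro languagesI[of "{a}"]) (simp add: family_simps)
  show "L \<notin> languages UF"
    using union_free_finite[of _ L "[]" "[a]"]
    by (auto simp: languages_def family_simps L_def)
qed

text \<open>\<open>L\<close> consists of all nonempty words over two letters and so has two shortest
  words.\<close>

lemma COMB_not_UF:
  fixes a b :: 'a
  assumes "a \<noteq> b"
  defines "L \<equiv> lists {a, b} @@ (\<lambda>x. [x]) ` {a, b}"
  shows "L \<in> languages COMB" "L \<notin> languages UF"
proof -
  have "regular {a, b} L" unfolding L_def by (intro regular_conc regular_lists regular_letters) auto
  moreover have "combinational {a, b} L" unfolding combinational_def L_def by blast
  ultimately show "L \<in> languages COMB"
    by (intro languagesI[of "{a, b}"]) (simp add: family_simps)
  have "[] @ [a] \<in> L" "[] @ [b] \<in> L" unfolding L_def by (intro concI; simp)+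
  then have ab: "[a] \<in> L" "[b] \<in> L" by simp_all
  have pos: "w \<noteq> []" if "w \<in> L" for w using that by (auto simp: L_def in_conc)
  show "L \<notin> languages UF"
  proof
    assume "L \<in> languages UF"
    then obtain V where "union_free V L" by (auto simp: languages_def family_simps)
    then obtain m where m: "m \<in> L" "\<And>v. v \<in> L \<Longrightarrow> v \<noteq> m \<Longrightarrow> length m < length v"
      using ab(1) by (auto elim: union_free_shortest_word)
    then have "m = [a]" "m = [b]" using m(2)[OF ab(1)] m(2)[OF ab(2)] pos[OF m(1)] by auto
    then show False using assms(1) by simp
  qed
qed

section \<open>The graph of inclusions\<close>

text \<open>The reflexive transitive closure of the edges as an explicit table, so that
  simplification decides questions about it. \<open>reachable_imp_path\<close> confirms the entries,
  and \<open>reachable_or_separated\<close> treats the pairs outside the table.\<close>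

primrec reachable :: "node \<Rightarrow> node set" where
  "reachable MON = UNIV - {FIN, COMB}"
| "reachable FIN = {FIN, NIL, DEF, ORD, NC, PS, REG}"
| "reachable NIL = {NIL, DEF, ORD, NC, PS, REG}"
| "reachable COMB = {COMB, DEF, SYDEF, ORD, NC, PS, LCOM, RCOM, TWOCOM, REG}"
| "reachable DEF = {DEF, ORD, NC, PS, REG}"
| "reachable SYDEF = {SYDEF, PS, LCOM, RCOM, TWOCOM, REG}"
| "reachable ORD = {ORD, NC, PS, REG}"
| "reachable INFC = {INFC, PRE, SUF, PS, REG}"
| "reachable PRE = {PRE, PS, REG}"
| "reachable SUF = {SUF, PS, REG}"
| "reachable NC = {NC, PS, REG}"
| "reachable PS = {PS, REG}"
| "reachable LCOM = {LCOM, TWOCOM, REG}"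
| "reachable RCOM = {RCOM, TWOCOM, REG}"
| "reachable TWOCOM = {TWOCOM, REG}"
| "reachable COMM = {COMM, CIRC, REG}"
| "reachable CIRC = {CIRC, REG}"
| "reachable STAR = {STAR, UF, REG}"
| "reachable UF = {UF, REG}"
| "reachable REG = {REG}"

text \<open>A rank that drops along every edge, as the measure of the induction that unfolds table
  entries into paths.\<close>

primrec height :: "node \<Rightarrow> nat" where
  "height MON = 7"
| "height FIN = 6"
| "height NIL = 5"
| "height COMB = 5"
| "height DEF = 4"
| "height SYDEF = 3"
| "height ORD = 3"
| "height INFC = 3"
| "height PRE = 2"
| "height SUF = 2"
| "height NC = 2"
| "height PS = 1"
| "height LCOM = 2"
| "height RCOM = 2"
| "height TWOCOM = 1"
| "height COMM = 2"
| "height CIRC = 1"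
| "height STAR = 2"
| "height UF = 1"
| "height REG = 0"

lemma reachable_step:
  assumes "Y \<in> reachable X" "Y \<noteq> X"
  obtains Z where "(X, Z) \<in> inclusions" "Y \<in> reachable Z" "height Z < height X"
proof -
  have "\<exists>Z. (X, Z) \<in> inclusions \<and> Y \<in> reachable Z \<and> height Z < height X"
    using assms by (cases X; cases Y; simp add: inclusions_def; force)
  then show ?thesis using that by blast
qed

lemma reachable_imp_path: "Y \<in> reachable X \<Longrightarrow> (X, Y) \<in> inclusions\<^sup>*"
proof (induction "height X" arbitrary: X rule: less_induct)
  case less
  show ?case
  proof (cases "Y = X")
    case False
    with less.prems obtain Z where "(X, Z) \<in> inclusions" "Y \<in> reachable Z" "height Z < height X"
      by (rule reachable_step)
    then show ?thesis using less.hyps by (meson converse_rtrancl_into_rtrancl)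
  qed simp
qed

lemma family_mono:
  assumes "Y \<in> reachable X" shows "(family X :: 'a language_over set) \<subseteq> family Y"
  using reachable_imp_path[OF assms]
  by (induction rule: rtrancl_induct) (use family_inclusion in blast)+

definition separated :: "(node \<times> node) set" where
  "separated =
    {(LCOM, PS), (RCOM, PS), (COMM, PS), (STAR, PS), (SYDEF, NC), (INFC, NC), (NC, ORD), (ORD, DEF),
     (COMB, NIL), (COMB, PRE), (COMB, SUF), (COMB, CIRC), (COMB, UF), (MON, FIN), (MON, COMB),
     (FIN, TWOCOM), (INFC, TWOCOM), (COMM, TWOCOM), (STAR, TWOCOM), (RCOM, LCOM), (LCOM, RCOM),
     (FIN, PRE), (FIN, SUF), (SUF, PRE), (PRE, SUF), (FIN, CIRC), (INFC, CIRC), (STAR, CIRC),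
     (CIRC, COMM), (FIN, UF), (INFC, UF), (COMM, UF), (UF, STAR)}"

lemma separated_not_subset:
  assumes "infinite (UNIV :: 'a set)" "(X, Y) \<in> separated"
  shows "\<not> (languages X :: 'a list set set) \<subseteq> languages Y"
proof -
  \<comment> \<open>The separating languages use up to three different letters.\<close>
  obtain a :: 'a where True by blast
  obtain b where "b \<notin> {a}" using ex_new_if_finite[OF assms(1), of "{a}"] by blast
  obtain c where "c \<notin> {a, b}" using ex_new_if_finite[OF assms(1), of "{a, b}"] by blast
  have "a \<noteq> b" "a \<noteq> c" "b \<noteq> c" using \<open>b \<notin> {a}\<close> \<open>c \<notin> {a, b}\<close> by auto
  note witnesses = even_powers_separate[of a] SYDEF_not_NC[OF \<open>a \<noteq> b\<close>] INFC_not_NC[OF \<open>a \<noteq> b\<close>]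
    NC_not_ORD[OF \<open>a \<noteq> b\<close> \<open>a \<noteq> c\<close> \<open>b \<noteq> c\<close>] ORD_not_DEF[OF \<open>a \<noteq> b\<close>]
    last_letter_separates[OF \<open>a \<noteq> b\<close>] MON_not_FIN_COMB[of a] empty_word_separates
    RCOM_not_LCOM[OF \<open>a \<noteq> b\<close>] LCOM_not_RCOM[OF \<open>a \<noteq> b\<close>] one_letter_separates[of a]
    SUF_not_PRE[OF \<open>a \<noteq> b\<close>] PRE_not_SUF[OF \<open>a \<noteq> b\<close>] infixes_of_two_letters_separate[OF \<open>a \<noteq> b\<close>]
    STAR_not_CIRC[OF \<open>a \<noteq> b\<close>] CIRC_not_COMM[OF \<open>a \<noteq> b\<close> \<open>a \<noteq> c\<close> \<open>b \<noteq> c\<close>]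
    two_word_language_separates[of a] COMB_not_UF[OF \<open>a \<noteq> b\<close>]
  have "\<forall>(X, Y)\<in>separated. \<not> (languages X :: 'a list set set) \<subseteq> languages Y"
    unfolding separated_def
    by (simp only: ball_simps prod.case simp_thms, intro conjI; rule notI, drule subsetD;
      use witnesses in blast)
  then show ?thesis using assms(2) by blast
qed

text \<open>A finite check over the 400 pairs of nodes, which certifies that the separated pairs
  suffice.\<close>

lemma reachable_or_separated:
  "Y \<in> reachable X \<or> (\<exists>(X0, Y0)\<in>separated. X \<in> reachable X0 \<and> Y0 \<in> reachable Y)"
  unfolding separated_def bex_simps prod.case reachable.simps by (cases X; cases Y; simp)

lemma not_reachable_imp_not_subset:
  assumes "infinite (UNIV :: 'a set)" "Y \<notin> reachable X"
  shows "\<not> (languages X :: 'a list set set) \<subseteq> languages Y"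
proof
  assume sub: "(languages X :: 'a list set set) \<subseteq> languages Y"
  obtain X0 Y0 where XY: "(X0, Y0) \<in> separated" "X \<in> reachable X0" "Y0 \<in> reachable Y"
    using reachable_or_separated[of Y X] assms(2) by blast
  have "(languages X0 :: 'a list set set) \<subseteq> languages X" "(languages Y :: 'a list set set) \<subseteq> languages Y0"
    using XY(2,3) by (simp_all add: family_mono languages_mono)
  then show False using sub separated_not_subset[OF assms(1) XY(1)] by blast
qed

theorem theorem14:
  assumes "infinite (UNIV :: 'a set)"
  shows "(\<forall>(X, Y) \<in> inclusions.
            (family X :: 'a language_over set) \<subset> family Y \<and>
            (languages X :: 'a list set set) \<subset> languages Y) \<and>
         (family NC :: 'a language_over set) = regular_family star_free \<and>
         (\<forall>X Y. X \<noteq> Y \<and> (X, Y) \<notin> inclusions\<^sup>* \<and> (Y, X) \<notin> inclusions\<^sup>* \<longrightarrow>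
            \<not> (family X :: 'a language_over set) \<subseteq> family Y \<and>
            \<not> (family Y :: 'a language_over set) \<subseteq> family X \<and>
            \<not> (languages X :: 'a list set set) \<subseteq> languages Y \<and>
            \<not> (languages Y :: 'a list set set) \<subseteq> languages X)"
proof (intro conjI)
  have not_sub: "\<not> (family X :: 'a language_over set) \<subseteq> family Y \<and>
      \<not> (languages X :: 'a list set set) \<subseteq> languages Y" if "Y \<notin> reachable X" for X Y
    using not_reachable_imp_not_subset[OF assms that] languages_mono by blast
  have "(family X :: 'a language_over set) \<subset> family Y \<and> (languages X :: 'a list set set) \<subset> languages Y"
    if XY: "(X, Y) \<in> inclusions" for X Y
  proof -
    \<comment> \<open>No entry of the table reverses an edge, so the separations used for
      incomparability also make the inclusions proper.\<close>
    have "\<forall>(X, Y)\<in>inclusions. X \<notin> reachable Y"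
      unfolding inclusions_def by simp
    then have "X \<notin> reachable Y" using XY by blast
    then show ?thesis
      using not_sub family_inclusion[OF XY] languages_mono[OF family_inclusion[OF XY]] by blast
  qed
  then show "\<forall>(X, Y) \<in> inclusions.
      (family X :: 'a language_over set) \<subset> family Y \<and> (languages X :: 'a list set set) \<subset> languages Y"
    by blast
  show "(family NC :: 'a language_over set) = regular_family star_free"
    unfolding family.simps
    by (intro equalityI regular_family_mono)
      (simp_all add: non_counting_imp_star_free star_free_imp_non_counting)
  show "\<forall>X Y. X \<noteq> Y \<and> (X, Y) \<notin> inclusions\<^sup>* \<and> (Y, X) \<notin> inclusions\<^sup>* \<longrightarrow>
      \<not> (family X :: 'a language_over set) \<subseteq> family Y \<and>
      \<not> (family Y :: 'a language_over set) \<subseteq> family X \<and>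
      \<not> (languages X :: 'a list set set) \<subseteq> languages Y \<and>
      \<not> (languages Y :: 'a list set set) \<subseteq> languages X"
    using reachable_imp_path not_sub by blast
qed

end
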